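(* Let $q$ be a power of a prime $p$ with $q>2$, and let $A=\mathbb{F}_q[T]$. Let $\mathfrak{P}$ be a prime ideal of $A$ of degree $h$ with additive valuation $v_{\mathfrak{P}}$. Then $v_{\mathfrak{P}}(\mathfrak{d}_j)$ is an invariant of the action of $S_{(q^h)}$ on the positive integers divisible by $q-1$; that is, $v_{\mathfrak{P}}(\mathfrak{d}_j)=v_{\mathfrak{P}}(\mathfrak{d}_{\sigma(j)})$ for every positive integer $j$ divisible by $q-1$ and every $\sigma\in S_{(q^h)}$.
   Context: Notation for $A=\mathbb{F}_q[T]$, $k=\mathbb{F}_q(T)$, $k_\infty=\mathbb{F}_q((1/T))$, $\mathbb{C}_\infty$ the completion of an algebraic closure of $k_\infty$. Let $\xi\in\mathbb{C}_\infty$ be a generator of the period lattice $A\xi$ of the Carlitz module (the rank one Drinfeld module with $C_T(z)=Tz+z^q$), i.e. $A\xi$ is the kernel of its exponential. For a positive integer $j$ put $\zeta(j)=\sum_{f\in A\text{ monic}}f^{-j}\in k_\infty$. For $j$ divisible by $q-1$ it is known that $0\ne\zeta(j)/\xi^j\in k$. Factorial: $[i](x)=x^{q^i}-x$, $D_0(x)=1$, $D_i(x)=[i](x)[i-1](x)^q\cdots[1](x)^{q^{i-1}}$; for $j=\sum_e c_eq^e$ with $0\le c_e<q$, $\Pi_j(x)=\prod_eD_e(x)^{c_e}$; and $\tilde\Pi_j$ is the ideal of $A$ generated by all $\Pi_j(a)$, $a\in A$ (it is known that it is generated by $\Pi_j(T)$). For $j>0$ divisible by $q-1$, $\widetilde{BC}_j$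 is the fractional ideal $\tilde\Pi_j\cdot\zeta(j)/\xi^j$ of $A$, and $\mathfrak{d}_j:=\{a\in A\mid a\,\widetilde{BC}_j\subseteq A\}$, an ideal of $A$. $S_{(Q)}$ for a power $Q$ of $p$: for a permutation $\rho$ of $\{0,1,2,\dots\}$ and $x=\sum_{i\ge0}c_iQ^i\in\mathbb{Z}_p$ with $0\le c_i<Q$, put $\rho_\ast(x)=\sum_{i\ge0}c_iQ^{\rho(i)}$; $S_{(Q)}$ is the group of all bijections $\rho_\ast$ of $\mathbb{Z}_p$. These permute the positive integers and preserve residue classes of integers modulo $Q-1$. *)

theory Defs
  imports
    "HOL-Analysis.Analysis"
    "HOL-Algebra.Algebraic_Closure_Type"
    "HOL-Algebra.Ideal_Product"
begin

section \<open>The field \<open>C\<^sub>\<infinity>\<close>\<close>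

text \<open>
  The type \<^typ>\<open>'a fls\<close> of formal Laurent series in the uniformizer \<open>1/T\<close> is the field \<open>k\<^sub>\<infinity>\<close>, so that
  \<open>T\<close> is \<^term>\<open>fls_X_inv\<close>. The distance on \<^typ>\<open>'a fls\<close> is that of the absolute value at infinity,
  normalized by \<open>|T| = 2\<close>.
\<close>

definition poly_to_fls :: "'a::field poly \<Rightarrow> 'a fls" where
  "poly_to_fls f = poly (map_poly fls_const f) fls_X_inv"

text \<open>
  \<open>\<kappa>\<close> exhibits the type \<open>'c\<close> as the completion of the algebraic closure of \<open>k\<^sub>\<infinity>\<close> with respect to the
  extension of the absolute value of \<open>k\<^sub>\<infinity>\<close>. The absolute value of \<open>x\<close> is \<^term>\<open>dist x 0\<close>; completeness
  is in the class of \<open>'c\<close>.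
\<close>

locale C_infinity =
  fixes \<kappa> :: "'a::{finite,field} fls alg_closure \<Rightarrow> 'c::{field,complete_space}"
  assumes dist_diff: "dist x y = dist (x - y) (0 :: 'c)"
    and dist_mult: "dist (x * y) 0 = dist x 0 * dist y (0 :: 'c)"
    and ultrametric: "dist x z \<le> max (dist x y) (dist y (z :: 'c))"
    and hom_one: "\<kappa> 1 = 1"
    and hom_add: "\<kappa> (u + v) = \<kappa> u + \<kappa> v"
    and hom_mult: "\<kappa> (u * v) = \<kappa> u * \<kappa> v"
    and isometry: "dist (\<kappa> (to_ac s)) (\<kappa> (to_ac t)) = dist s t"
    and dense: "closure (range \<kappa>) = UNIV"

definition of_A :: "('a::{finite,field} fls alg_closure \<Rightarrow> 'c) \<Rightarrow> 'a poly \<Rightarrow> 'c" where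
  "of_A \<kappa> f = \<kappa> (to_ac (poly_to_fls f))"

abbreviation T_of :: "('a::{finite,field} fls alg_closure \<Rightarrow> 'c) \<Rightarrow> 'c" where
  "T_of \<kappa> \<equiv> of_A \<kappa> [:0, 1:]"

section \<open>The Carlitz module and zeta values\<close>

text \<open>
  The functional equation \<open>e(Tz) = C\<^sub>T(e(z))\<close> with \<open>C\<^sub>T(z) = Tz + z^q\<close>. It has exactly one solution
  of the form \<open>z + \<dots>\<close> in formal power series; that solution is \<open>F\<^sub>q\<close>-linear and entire.
\<close>

definition carlitz_exponential ::
    "('a::{finite,field} fls alg_closure \<Rightarrow> 'c::field) \<Rightarrow> 'c fps \<Rightarrow> bool" where
  "carlitz_exponential \<kappa> e \<longleftrightarrow>
     fps_nth e 0 = 0 \<and> fps_nth e 1 = 1 \<and>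
     fps_compose e (fps_const (T_of \<kappa>) * fps_X) = fps_const (T_of \<kappa>) * e + e ^ CARD('a)"

definition fps_kernel :: "'c::{field,topological_space} fps \<Rightarrow> 'c set" where
  "fps_kernel e = {z. (\<lambda>n. fps_nth e n * z ^ n) sums 0}"

definition period_lattice_generator ::
    "('a::{finite,field} fls alg_closure \<Rightarrow> 'c::{field,topological_space}) \<Rightarrow> 'c fps \<Rightarrow> 'c \<Rightarrow> bool" where
  "period_lattice_generator \<kappa> e \<xi> \<longleftrightarrow> fps_kernel e = range (\<lambda>a. of_A \<kappa> a * \<xi>)"

definition carlitz_zeta :: "nat \<Rightarrow> 'a::{finite,field} fls" where
  "carlitz_zeta j = (\<Sum>\<^sub>\<infinity>f\<in>{f. Polynomial.lead_coeff f = 1}. inverse (poly_to_fls f ^ j))"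

section \<open>Factorials and Bernoulli-Carlitz ideals\<close>

abbreviation poly_A :: "'a::field poly ring" where
  "poly_A \<equiv> ring_of_type_algebra"

definition bracket :: "nat \<Rightarrow> 'a::{finite,field} poly \<Rightarrow> 'a poly" where
  "bracket i x = x ^ (CARD('a) ^ i) - x"

definition carlitz_D :: "nat \<Rightarrow> 'a::{finite,field} poly \<Rightarrow> 'a poly" where
  "carlitz_D i x = (\<Prod>l\<in>{1..i}. bracket l x ^ (CARD('a) ^ (i - l)))"

text \<open>The \<open>q\<close>-adic digits of \<open>j\<close> in positions beyond \<open>j\<close> all vanish.\<close>

definition carlitz_factorial :: "nat \<Rightarrow> 'a::{finite,field} poly \<Rightarrow> 'a poly" where
  "carlitz_factorial j x =
     (\<Prod>e\<in>{..j}. carlitz_D e x ^ (j div CARD('a) ^ e mod CARD('a)))"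

definition factorial_ideal :: "nat \<Rightarrow> 'a::{finite,field} poly set" where
  "factorial_ideal j = Idl\<^bsub>poly_A\<^esub> (range (carlitz_factorial j))"

text \<open>The fractional ideal is formed inside \<open>C\<^sub>\<infinity>\<close>, where \<open>\<zeta>(j)/\<xi>^j\<close> lives by definition.\<close>

definition bernoulli_carlitz ::
    "('a::{finite,field} fls alg_closure \<Rightarrow> 'c::field) \<Rightarrow> 'c \<Rightarrow> nat \<Rightarrow> 'c set" where
  "bernoulli_carlitz \<kappa> \<xi> j =
     (\<lambda>b. of_A \<kappa> b * (\<kappa> (to_ac (carlitz_zeta j)) / \<xi> ^ j)) ` factorial_ideal j"

definition denominator_ideal ::
    "('a::{finite,field} fls alg_closure \<Rightarrow> 'c::field) \<Rightarrow> 'c \<Rightarrow> nat \<Rightarrow> 'a poly set" where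
  "denominator_ideal \<kappa> \<xi> j =
     {a. (\<lambda>x. of_A \<kappa> a * x) ` bernoulli_carlitz \<kappa> \<xi> j \<subseteq> range (of_A \<kappa>)}"

section \<open>Degree of an ideal and valuation at a prime ideal\<close>

text \<open>The degree of a nonzero ideal of \<open>A\<close> is the degree of any of its generators.\<close>

definition ideal_degree :: "'a::field poly set \<Rightarrow> nat" where
  "ideal_degree I = (THE d. \<exists>f. I = PIdl\<^bsub>poly_A\<^esub> f \<and> Polynomial.degree f = d)"

lemma mem_PIdl_poly_A: "x \<in> PIdl\<^bsub>poly_A\<^esub> f \<longleftrightarrow> f dvd x"
  by (auto simp: cgenideal_def ring_of_type_algebra_def dvd_def mult.commute)

lemma ideal_degree_PIdl: "ideal_degree (PIdl\<^bsub>poly_A\<^esub> f) = Polynomial.degree f"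
  unfolding ideal_degree_def
proof (rule the_equality)
  fix d assume "\<exists>g. PIdl\<^bsub>poly_A\<^esub> f = PIdl\<^bsub>poly_A\<^esub> g \<and> Polynomial.degree g = d"
  then obtain g where g: "PIdl\<^bsub>poly_A\<^esub> f = PIdl\<^bsub>poly_A\<^esub> g" "Polynomial.degree g = d" by blast
  then have "f dvd g" "g dvd f" by (metis dvd_refl mem_PIdl_poly_A)+
  then show "d = Polynomial.degree f"
    using g(2) by (metis dvd_0_left dvd_imp_degree_le le_antisym)
qed blast

text \<open>The exponent of \<open>P\<close> in the factorization of \<open>I\<close>; it is \<open>\<infinity>\<close> for the zero ideal.\<close>

definition ideal_valuation :: "'a::field poly set \<Rightarrow> 'a poly set \<Rightarrow> enat" where
  "ideal_valuation P I = (SUP n\<in>{n. I \<subseteq> P [^]\<^bsub>ideals_set poly_A\<^esub> n}. enat n)"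

section \<open>The digit permutation groups\<close>

text \<open>
  \<open>Z\<^sub>p\<close> is the inverse limit of the rings \<open>Z/p^n\<close>, whose elements are represented by \<open>0, \<dots>, p^n - 1\<close>.
\<close>

definition padic_ints :: "nat \<Rightarrow> (nat \<Rightarrow> nat) set" where
  "padic_ints p = {x. \<forall>n. x n < p ^ n \<and> x (Suc n) mod p ^ n = x n}"

definition padic_of_nat :: "nat \<Rightarrow> nat \<Rightarrow> (nat \<Rightarrow> nat)" where
  "padic_of_nat p j = (\<lambda>n. j mod p ^ n)"

text \<open>
  For \<open>Q = p^m\<close>, the residue of \<open>x\<close> modulo \<open>Q^(i+1)\<close> determines the \<open>i\<close>-th digit of \<open>x\<close> to the
  base \<open>Q\<close>.
\<close>

definition padic_digit :: "nat \<Rightarrow> nat \<Rightarrow> (nat \<Rightarrow> nat) \<Rightarrow> nat \<Rightarrow> nat" where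
  "padic_digit p m x i = x (m * Suc i) div (p ^ m) ^ i"

text \<open>
  The terms of \<open>\<Sum>i. c\<^sub>i Q^(\<rho> i)\<close> that do not vanish modulo \<open>p^n\<close> satisfy \<open>m * \<rho> i < n\<close>.
\<close>

definition digit_perm :: "nat \<Rightarrow> nat \<Rightarrow> (nat \<Rightarrow> nat) \<Rightarrow> (nat \<Rightarrow> nat) \<Rightarrow> (nat \<Rightarrow> nat)" where
  "digit_perm p m \<rho> =
     (\<lambda>x\<in>padic_ints p. \<lambda>n. (\<Sum>i\<in>{i. m * \<rho> i < n}. padic_digit p m x i * (p ^ m) ^ \<rho> i) mod p ^ n)"

text \<open>\<open>digit_perm_group p m\<close> is the group \<open>S\<^sub>(\<^sub>Q\<^sub>)\<close> for \<open>Q = p^m\<close>.\<close>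

definition digit_perm_group :: "nat \<Rightarrow> nat \<Rightarrow> ((nat \<Rightarrow> nat) \<Rightarrow> (nat \<Rightarrow> nat)) set" where
  "digit_perm_group p m = {digit_perm p m \<rho> | \<rho>. bij \<rho>}"

definition nat_action :: "nat \<Rightarrow> ((nat \<Rightarrow> nat) \<Rightarrow> (nat \<Rightarrow> nat)) \<Rightarrow> nat \<Rightarrow> nat" where
  "nat_action p \<sigma> j = (THE j'. padic_of_nat p j' = \<sigma> (padic_of_nat p j))"

lemma padic_of_nat_mem: "p > 1 \<Longrightarrow> padic_of_nat p j \<in> padic_ints p"
  by (auto simp: padic_ints_def padic_of_nat_def mod_mod_cancel)

lemma padic_of_nat_inject:
  assumes "p > 1" and "padic_of_nat p j = padic_of_nat p j'"
  shows "j = j'"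
proof -
  let ?n = "j + j'"
  have "?n < p ^ ?n" using assms(1) by (intro power_gt_expt) simp
  then have "j mod p ^ ?n = j" "j' mod p ^ ?n = j'" by auto
  then show ?thesis using fun_cong[OF assms(2), of ?n] by (simp add: padic_of_nat_def)
qed

lemma padic_digit_of_nat: "padic_digit p m (padic_of_nat p j) i = j div (p ^ m) ^ i mod p ^ m"
proof -
  define Q where "Q = p ^ m"
  have "p ^ (m * Suc i) = Q ^ i * Q"
    unfolding Q_def by (metis add.commute mult_Suc_right power_add power_mult)
  then have "padic_digit p m (padic_of_nat p j) i = j mod (Q ^ i * Q) div Q ^ i"
    unfolding padic_digit_def padic_of_nat_def Q_def by (simp only:)
  also have "\<dots> = j div Q ^ i mod Q"
    by (cases "Q = 0 \<and> i > 0") (auto simp: mod_mult2_eq)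
  finally show ?thesis by (simp only: Q_def)
qed

lemma digit_perm_of_nat:
  assumes p: "p > 1" and m: "m > 0" and \<rho>: "bij \<rho>"
  shows "digit_perm p m \<rho> (padic_of_nat p j) =
         padic_of_nat p (\<Sum>i\<le>j. (j div (p ^ m) ^ i mod p ^ m) * (p ^ m) ^ \<rho> i)"
proof
  fix n
  let ?t = "\<lambda>i. (j div (p ^ m) ^ i mod p ^ m) * (p ^ m) ^ \<rho> i"
  let ?J = "{i. m * \<rho> i < n}"
  have "?J \<subseteq> \<rho> -` {..<n}"
  proof
    fix i assume "i \<in> ?J"
    moreover have "\<rho> i \<le> m * \<rho> i" using m by simp
    ultimately have "\<rho> i < n" by (simp only: mem_Collect_eq)
    then show "i \<in> \<rho> -` {..<n}" by simp
  qed
  then have fin: "finite ?J"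
    using \<rho> by (auto intro: finite_subset finite_vimageI simp: bij_def)
  have z1: "?t i = 0" if "i > j" for i
  proof -
    have "p ^ m > 1" using p m by (metis one_less_power)
    then have "i < (p ^ m) ^ i" by (intro power_gt_expt) simp
    then have "j < (p ^ m) ^ i" using that by (rule less_trans[rotated])
    then show ?thesis by (simp only: div_less mod_0 mult_0)
  qed
  have z2: "p ^ n dvd ?t i" if "i \<notin> ?J" for i
  proof -
    have "p ^ n dvd (p ^ m) ^ \<rho> i"
      unfolding power_mult[symmetric] by (rule le_imp_power_dvd) (use that in simp)
    then show ?thesis by (rule dvd_mult)
  qed
  have "(\<Sum>i\<in>?J. ?t i) mod p ^ n = (\<Sum>i\<in>?J \<union> {..j}. ?t i) mod p ^ n"
  proof -
    have "(\<Sum>i\<in>?J \<union> {..j}. ?t i) = (\<Sum>i\<in>?J. ?t i) + (\<Sum>i\<in>{..j} - ?J. ?t i)"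
      using fin sum.union_disjoint[of ?J "{..j} - ?J" ?t] by auto
    moreover have "p ^ n dvd (\<Sum>i\<in>{..j} - ?J. ?t i)"
      by (rule dvd_sum) (use z2 in blast)
    ultimately show ?thesis by (elim dvdE) (simp only: mod_mult_self2)
  qed
  also have "(\<Sum>i\<in>?J \<union> {..j}. ?t i) = (\<Sum>i\<le>j. ?t i)"
    by (rule sum.mono_neutral_right) (use fin in simp, blast, use z1 in \<open>metis DiffE atMost_iff not_le\<close>)
  finally show "digit_perm p m \<rho> (padic_of_nat p j) n = padic_of_nat p (\<Sum>i\<le>j. ?t i) n"
    unfolding digit_perm_def restrict_apply' [OF padic_of_nat_mem[OF p]] padic_digit_of_nat
    by (simp only: padic_of_nat_def)
qed

lemma nat_action_eq:
  assumes "p > 1" "m > 0" "bij \<rho>"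
  shows "nat_action p (digit_perm p m \<rho>) j =
         (\<Sum>i\<le>j. (j div (p ^ m) ^ i mod p ^ m) * (p ^ m) ^ \<rho> i)"
  unfolding nat_action_def digit_perm_of_nat[OF assms]
  by (rule the_equality) (auto dest: padic_of_nat_inject[OF assms(1)])

end

theory Submission
  imports Defs "HOL-Number_Theory.Residues"
begin

text \<open>
  Let \<open>e\<close> be the Carlitz exponential, \<open>\<Pi>\<^sub>m\<close> the Carlitz factorial at \<open>T\<close> (it generates the factorial
  ideal), and \<open>[l] = T^(q^l) - T\<close>. Fix a prime \<open>f\<close> of \<open>A\<close> of degree \<open>h\<close> and put \<open>Q = q^h\<close>. The statement
  follows from a von Staudt theorem: the valuation of the denominator at \<open>f\<close> is \<open>0\<close> or \<open>1\<close>, and which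
  of the two it is depends only on the digits of \<open>j\<close> to the base \<open>Q\<close>, in whatever order they come.

  The link between zeta values and \<open>e\<close> is the partial fraction expansion of \<open>z/e(z)\<close>. Since \<open>e\<close> has
  derivative \<open>1\<close> and its zeros are the elements of \<open>A\<xi>\<close>, the coefficient of \<open>z^j\<close> in \<open>z/e(z)\<close> is minus
  the sum of \<open>(a\<xi>)^(-j)\<close> over the nonzero \<open>a\<close>, which is \<open>\<zeta>(j)/\<xi>^j\<close> when \<open>q - 1\<close> divides \<open>j\<close>
  (\<open>exponential_reciprocal_nth\<close>). A product expansion of \<open>e\<close> over its zeros is not part of the
  hypotheses. It is obtained from the polynomials \<open>E\<^sub>d\<close> with simple zeros at the \<open>a\<close> of degree
  below \<open>d\<close>: they converge to a power series that satisfies the functional equation of \<open>e\<close> up to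
  a scaling factor \<open>\<delta>\<close>, and comparison of zeros shows that \<open>\<delta>\<close> is \<open>\<xi>\<close> times a constant
  (\<open>period_scaling\<close>).

  So the Bernoulli-Carlitz ideal is generated by \<open>\<Pi>\<^sub>j\<close> times the coefficient of \<open>z^j\<close> in \<open>z/e(z)\<close>.
  Carlitz's logarithm gives \<open>z/e(z) = \<Sum>\<^sub>i (-1)^i e(z)^(q^i - 1) / L\<^sub>i\<close> with \<open>L\<^sub>i = [1]\<dots>[i]\<close>. The
  numbers \<open>H\<^sub>k(m) = \<Pi>\<^sub>m\<close> times the coefficient of \<open>z^m\<close> in \<open>e(z)^k\<close> lie in \<open>A\<close>, the exponent of \<open>f\<close> in
  \<open>L\<^sub>i\<close> is the integral part of \<open>i/h\<close>, and for \<open>i > h\<close> the number \<open>H\<^sub>k(j)\<close> with \<open>k = q^i - 1\<close> is divisible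
  by at least that power of \<open>f\<close>, because \<open>q > 2\<close>. Only \<open>i = h\<close> can produce a denominator, and it
  does so exactly when \<open>f\<close> does not divide \<open>H\<^sub>k(j)\<close> for \<open>k = Q - 1\<close> (\<open>bernoulli_carlitz_local\<close>).

  Finally, \<open>H\<^sub>k(m)\<close> modulo \<open>f\<close> does not change when the base \<open>Q\<close> digits of \<open>m\<close> are permuted
  (\<open>residue_exp_power_coeff_permuted\<close>). Multiplication by \<open>e\<close> adds powers \<open>q^s\<close> to the exponent and
  introduces a factorial binomial. Modulo \<open>f\<close> this binomial vanishes whenever the addition
  carries in base \<open>Q\<close>; otherwise it depends only on the one digit that changes, since
  \<open>T^(q^l)\<close> modulo \<open>f\<close> depends only on \<open>l\<close> modulo \<open>h\<close>.
\<close>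

section \<open>Polynomials over a finite field\<close>

lemma finite_field_power_card: "(x::'a::{finite,field}) ^ CARD('a) = x"
proof (cases "x = 0")
  case False
  have "x * (\<Prod>y\<in>UNIV-{0}. x * y) = x * x ^ (CARD('a) - 1) * \<Prod>(UNIV-{0})"
    by (simp add: prod.distrib mult_ac)
  also have "x * x ^ (CARD('a) - 1) = x ^ CARD('a)"
    by (simp flip: power_Suc)
  also have "(\<Prod>y\<in>UNIV-{0}. x * y) = (\<Prod>y\<in>UNIV-{0}. y)"
    by (rule prod.reindex_bij_witness[of _ "\<lambda>y. y / x" "\<lambda>y. x * y"]) (use False in auto)
  finally show ?thesis
    by simp
qed simp

lemma finite_field_power_card_power: "(x::'a::{finite,field}) ^ (CARD('a) ^ i) = x"
  by (induction i) (simp_all add: finite_field_power_card power_mult)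

lemma two_le_card_field: "2 \<le> CARD('a::{finite,field})"
  using card_mono[of UNIV "{0, 1::'a}"] by simp

text \<open>
  The polynomials \<open>(1 + X)^q\<close> and \<open>1 + X^q\<close> have the same leading term and agree at all \<open>q\<close> points of
  the field, so they are equal. This makes \<open>x \<mapsto> x^q\<close> additive in every commutative ring of
  the same characteristic.
\<close>

lemma of_nat_choose_card_eq_0:
  assumes "0 < k" "k < CARD('a::{finite,field})"
  shows "of_nat (CARD('a) choose k) = (0 :: 'a)"
proof -
  let ?N = "CARD('a)"
  have deg: "Polynomial.degree ([:1, 1::'a:] ^ ?N) \<le> ?N"
    by (rule order_trans[OF degree_power_le]) simp
  have eq: "[:1, 1::'a:] ^ ?N = Polynomial.monom 1 ?N + 1"
  proof (rule poly_eqI_degree_lead_coeff[where A = UNIV and n = ?N])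
    show "Polynomial.coeff ([:1, 1::'a:] ^ ?N) ?N = Polynomial.coeff (Polynomial.monom 1 ?N + 1) ?N"
      using assms by (simp add: coeff_linear_poly_power)
    show "Polynomial.degree (Polynomial.monom 1 ?N + 1 :: 'a poly) \<le> ?N"
      by (rule degree_add_le) (simp_all add: degree_monom_le)
  qed (use deg in \<open>simp_all add: finite_field_power_card poly_monom\<close>)
  have "of_nat (?N choose k) = Polynomial.coeff ([:1, 1::'a:] ^ ?N) k"
    using assms by (simp add: coeff_linear_poly_power)
  also have "\<dots> = 0"
    unfolding eq using assms by simp
  finally show ?thesis .
qed

lemma frobenius_add:
  fixes x y :: "'b::comm_semiring_1"
  assumes "CHAR('b) = CHAR('a::{finite,field})"
  shows "(x + y) ^ (CARD('a) ^ i) = x ^ (CARD('a) ^ i) + y ^ (CARD('a) ^ i)"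
proof (induction i)
  case (Suc i)
  have step: "(u + v) ^ CARD('a) = u ^ CARD('a) + v ^ CARD('a)" for u v :: 'b
  proof -
    have "(u + v) ^ CARD('a) = (\<Sum>k\<le>CARD('a). of_nat (CARD('a) choose k) * u ^ k * v ^ (CARD('a) - k))"
      by (rule binomial_ring)
    also have "\<dots> = (\<Sum>k\<in>{0, CARD('a)}. of_nat (CARD('a) choose k) * u ^ k * v ^ (CARD('a) - k))"
    proof (intro sum.mono_neutral_right ballI)
      fix k assume "k \<in> {..CARD('a)} - {0, CARD('a)}"
      then have "of_nat (CARD('a) choose k) = (0 :: 'a)"
        by (intro of_nat_choose_card_eq_0) auto
      then have "of_nat (CARD('a) choose k) = (0 :: 'b)"
        by (simp add: of_nat_eq_0_iff_char_dvd assms)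
      then show "of_nat (CARD('a) choose k) * u ^ k * v ^ (CARD('a) - k) = 0"
        by simp
    qed auto
    also have "\<dots> = u ^ CARD('a) + v ^ CARD('a)"
      by (simp add: add.commute)
    finally show ?thesis .
  qed
  show ?case
    using Suc step by (simp add: power_mult mult.commute[of "CARD('a)"])
qed simp

lemma frobenius_sum:
  fixes f :: "'i \<Rightarrow> 'b::comm_semiring_1"
  assumes "CHAR('b) = CHAR('a::{finite,field})"
  shows "sum f A ^ (CARD('a) ^ i) = (\<Sum>x\<in>A. f x ^ (CARD('a) ^ i))"
  by (induction A rule: infinite_finite_induct) (simp_all add: frobenius_add[OF assms] power_0_left)

lemma frobenius_diff:
  fixes x y :: "'b::comm_ring_1"
  assumes "CHAR('b) = CHAR('a::{finite,field})"
  shows "(x - y) ^ (CARD('a) ^ i) = x ^ (CARD('a) ^ i) - y ^ (CARD('a) ^ i)"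
  by (metis frobenius_add[OF assms] add_diff_cancel_right' diff_add_cancel)

lemma poly_map_hom_add:
  assumes "h 0 = (0::'b::comm_ring_1)" "\<And>u v. h (u + v) = h u + h v"
  shows "poly (map_poly h (f + g)) x = poly (map_poly h f) x + poly (map_poly h g) x"
proof -
  have "map_poly h (f + g) = map_poly h f + map_poly h g"
    by (rule poly_eqI) (simp add: coeff_map_poly assms)
  then show ?thesis by simp
qed

lemma poly_map_hom_mult:
  fixes f g :: "'a::comm_ring_1 poly"
  assumes "h 0 = (0::'b::comm_ring_1)" "\<And>u v. h (u + v) = h u + h v" "\<And>u v. h (u * v) = h u * h v"
  shows "poly (map_poly h (f * g)) x = poly (map_poly h f) x * poly (map_poly h g) x"
proof (induction f)
  case (pCons c f)
  note add = poly_map_hom_add[where h = h, OF assms(1,2)]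
  have smult: "poly (map_poly h (Polynomial.smult c g)) x = h c * poly (map_poly h g) x" for c
    by (induction g) (simp_all add: map_poly_pCons assms algebra_simps)
  show ?case
    using pCons.IH
    by (simp add: add smult map_poly_pCons assms(1) algebra_simps)
qed (simp add: assms)

text \<open>
  Used for prime ideals and for the kernel of evaluation at an algebraic element, which are given
  as sets and not through the ideals of a ring record.
\<close>

lemma poly_ideal_principal:
  fixes I :: "'a::field poly set"
  assumes "0 \<in> I" and diff: "\<And>x y. x \<in> I \<Longrightarrow> y \<in> I \<Longrightarrow> x - y \<in> I"
    and mult: "\<And>x y. x \<in> I \<Longrightarrow> y * x \<in> I"
  obtains g where "\<And>x. x \<in> I \<longleftrightarrow> g dvd x"
proof (cases "I = {0}")
  case True
  then show ?thesis using that[of 0] by auto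
next
  case False
  define d where "d = (LEAST d. \<exists>x\<in>I - {0}. Polynomial.degree x = d)"
  have ex: "\<exists>d. \<exists>x\<in>I - {0}. Polynomial.degree x = d"
    using False assms(1) by auto
  obtain g where g: "g \<in> I" "g \<noteq> 0" "Polynomial.degree g = d"
    using LeastI_ex[OF ex] unfolding d_def by blast
  have "g dvd x" if "x \<in> I" for x
  proof -
    have "x mod g = x - (x div g) * g" by (simp add: minus_div_mult_eq_mod)
    then have mem: "x mod g \<in> I" using that g(1) diff mult by metis
    have "x mod g = 0"
    proof (rule ccontr)
      assume nz: "x mod g \<noteq> 0"
      then have "d \<le> Polynomial.degree (x mod g)"
        unfolding d_def using mem by (intro Least_le) auto
      then show False using degree_mod_less'[OF g(2) nz] g(3) by simp
    qed
    then show ?thesis by (simp add: dvd_eq_mod_eq_0)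
  qed
  moreover have "x \<in> I" if "g dvd x" for x
    using that g(1) mult by (metis dvdE mult.commute)
  ultimately have "x \<in> I \<longleftrightarrow> g dvd x" for x by blast
  then show ?thesis by (rule that)
qed

section \<open>Reduction modulo a prime of \<open>A\<close>\<close>

text \<open>
  Vanishing of the high coefficients, rather than a bound on the degree, makes this a subspace that
  contains \<open>0\<close> for every \<open>n\<close>, including \<open>n = 0\<close>.
\<close>

definition polys_below :: "nat \<Rightarrow> 'a::zero poly set" where
  "polys_below n = {g. \<forall>i\<ge>n. Polynomial.coeff g i = 0}"

lemma polys_below_0: "polys_below 0 = {0}"
  by (auto simp: polys_below_def poly_eq_iff)

lemma zero_in_polys_below [simp]: "0 \<in> polys_below n"
  by (simp add: polys_below_def)

lemma polys_below_Suc: "polys_below (Suc n) = (\<lambda>(c, g). pCons c g) ` (UNIV \<times> polys_below n)"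
proof -
  have "g \<in> (\<lambda>(c, g). pCons c g) ` (UNIV \<times> polys_below n)" if "g \<in> polys_below (Suc n)" for g :: "'a poly"
    using that by (cases g) (force simp: polys_below_def coeff_pCons split: nat.splits)
  then show ?thesis
    by (auto simp: polys_below_def coeff_pCons split: nat.splits)
qed

lemma finite_polys_below [simp]: "finite (polys_below n :: 'a::{finite,zero} poly set)"
  and card_polys_below: "card (polys_below n :: 'a::{finite,zero} poly set) = CARD('a) ^ n"
proof (induction n)
  case (Suc n)
  case 1
  show ?case unfolding polys_below_Suc using Suc by simp
  case 2
  have "inj_on (\<lambda>(c, g). pCons c g) (UNIV \<times> (polys_below n :: 'a poly set))"
    by (auto simp: inj_on_def)
  then show ?case unfolding polys_below_Suc
    by (simp add: card_image card_cartesian_product Suc)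
qed (simp_all add: polys_below_0)

lemma polys_below_iff_degree: "g \<in> polys_below n \<longleftrightarrow> g = 0 \<or> Polynomial.degree g < n"
proof
  assume g: "g \<in> polys_below n"
  have "Polynomial.degree g < n" if "g \<noteq> 0"
    using g that unfolding polys_below_def
    by (metis (mono_tags, lifting) leading_coeff_0_iff mem_Collect_eq not_less)
  then show "g = 0 \<or> Polynomial.degree g < n" by blast
qed (auto simp: polys_below_def intro: coeff_eq_0)

text \<open>
  If \<open>\<alpha>\<close> is a root of the prime \<open>f\<close>, evaluation at \<open>\<alpha>\<close> is reduction modulo \<open>f\<close>: congruences become
  equations in the algebraic closure of the constant field.
\<close>

definition residue :: "'a::field alg_closure \<Rightarrow> 'a poly \<Rightarrow> 'a alg_closure" where
  "residue \<alpha> g = poly (map_poly to_ac g) \<alpha>"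

lemma residue_add: "residue \<alpha> (f + g) = residue \<alpha> f + residue \<alpha> g"
  unfolding residue_def by (rule poly_map_hom_add) simp_all

lemma residue_mult: "residue \<alpha> (f * g) = residue \<alpha> f * residue \<alpha> g"
  unfolding residue_def by (rule poly_map_hom_mult) simp_all

lemma residue_pCons: "residue \<alpha> (pCons c g) = to_ac c + \<alpha> * residue \<alpha> g"
  by (simp add: residue_def map_poly_pCons)

lemma residue_0 [simp]: "residue \<alpha> 0 = 0"
  by (simp add: residue_def)

lemma residue_1 [simp]: "residue \<alpha> 1 = 1"
  by (simp add: residue_def)

lemma residue_diff: "residue \<alpha> (f - g) = residue \<alpha> f - residue \<alpha> g"
  using residue_add[of \<alpha> "f - g" g] by simp

lemma residue_power: "residue \<alpha> (f ^ n) = residue \<alpha> f ^ n"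
  by (induction n) (simp_all add: residue_mult)

lemma residue_sum: "residue \<alpha> (sum f A) = (\<Sum>x\<in>A. residue \<alpha> (f x))"
  by (induction A rule: infinite_finite_induct) (simp_all add: residue_add)

lemma residue_prod: "residue \<alpha> (prod f A) = (\<Prod>x\<in>A. residue \<alpha> (f x))"
  by (induction A rule: infinite_finite_induct) (simp_all add: residue_mult)

lemma residue_frobenius:
  fixes g :: "'a::{finite,field} poly"
  assumes "\<alpha> ^ (CARD('a) ^ l) = \<alpha>"
  shows "residue \<alpha> g ^ (CARD('a) ^ l) = residue \<alpha> g"
proof (induction g)
  case (pCons c g)
  have "to_ac c ^ (CARD('a) ^ l) = to_ac c"
    by (simp flip: to_ac_power add: finite_field_power_card_power)
  then show ?case
    using pCons.IH assms
    by (simp add: residue_pCons frobenius_add[where 'a = 'a] power_mult_distrib)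
qed (simp add: power_0_left)

locale place =
  fixes f :: "'a::{finite,field} poly" and \<alpha> :: "'a alg_closure"
  assumes prime: "prime_elem f" and root: "residue \<alpha> f = 0"
begin

text \<open>
  The kernel of evaluation at \<open>\<alpha>\<close> is a proper principal ideal that contains the irreducible \<open>f\<close>.
\<close>

lemma residue_eq_0_iff: "residue \<alpha> g = 0 \<longleftrightarrow> f dvd g"
proof -
  obtain g0 where g0: "\<And>x. x \<in> {g. residue \<alpha> g = 0} \<longleftrightarrow> g0 dvd x"
    by (rule poly_ideal_principal[of "{g. residue \<alpha> g = 0}"])
       (auto simp: residue_diff residue_mult)
  have "Factorial_Ring.irreducible f" using prime by (rule prime_elem_imp_irreducible)
  moreover have "g0 dvd f" using g0[of f] root by simp
  moreover have "\<not> is_unit g0"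
    using g0[of 1] by simp
  ultimately have "f dvd g0"
    by (auto simp: Factorial_Ring.irreducible_altdef)
  with \<open>g0 dvd f\<close> show ?thesis
    using g0[of g] by (auto intro: dvd_trans)
qed

lemma degree_pos: "0 < Polynomial.degree f"
proof (rule ccontr)
  assume "\<not> 0 < Polynomial.degree f"
  then have "is_unit f" using prime
    by (auto simp: is_unit_iff_degree prime_elem_def)
  then show False using prime by (simp add: prime_elem_def)
qed

lemma inj_on_residue: "inj_on (residue \<alpha>) (polys_below (Polynomial.degree f))"
proof (rule inj_onI)
  fix x y assume *: "x \<in> polys_below (Polynomial.degree f)" "y \<in> polys_below (Polynomial.degree f)"
    "residue \<alpha> x = residue \<alpha> y"
  then have "x - y \<in> polys_below (Polynomial.degree f)" by (simp add: polys_below_def)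
  moreover have "f dvd x - y"
    using * by (simp add: residue_diff flip: residue_eq_0_iff)
  ultimately have "x - y = 0"
    by (meson dvd_imp_degree_le not_less polys_below_iff_degree)
  then show "x = y" by simp
qed

lemma card_residues: "card (residue \<alpha> ` polys_below (Polynomial.degree f)) = CARD('a) ^ Polynomial.degree f"
  by (simp add: card_image[OF inj_on_residue] card_polys_below)

text \<open>
  Fermat's argument: multiplication by \<open>\<alpha>\<close> permutes the \<open>q^h - 1\<close> nonzero residues, so comparing
  their products before and after gives \<open>\<alpha>^(q^h - 1) = 1\<close>.
\<close>

lemma root_power_card: "\<alpha> ^ (CARD('a) ^ Polynomial.degree f) = \<alpha>"
proof (cases "\<alpha> = 0")
  case False
  define S where "S = residue \<alpha> ` polys_below (Polynomial.degree f) - {0}"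
  have fin: "finite S" by (simp add: S_def)
  have "0 \<in> residue \<alpha> ` polys_below (Polynomial.degree f)"
    by (rule image_eqI[of _ _ 0]) simp_all
  then have card: "card S = CARD('a) ^ Polynomial.degree f - 1"
    by (simp add: S_def card_residues card_Diff_singleton)
  have into: "(*) \<alpha> ` S \<subseteq> S"
  proof
    fix y assume "y \<in> (*) \<alpha> ` S"
    then obtain g where g: "y = \<alpha> * residue \<alpha> g" "residue \<alpha> g \<noteq> 0"
      by (auto simp: S_def)
    have "f dvd pCons 0 g - pCons 0 g mod f"
      by (simp add: minus_mod_eq_mult_div)
    then have "residue \<alpha> (pCons 0 g - pCons 0 g mod f) = 0"
      by (simp only: residue_eq_0_iff)
    then have "y = residue \<alpha> (pCons 0 g mod f)"
      by (simp add: g residue_diff residue_pCons)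
    moreover have "pCons 0 g mod f \<in> polys_below (Polynomial.degree f)"
      using degree_mod_less[of f "pCons 0 g"] prime
      by (auto simp: polys_below_iff_degree prime_elem_def)
    ultimately show "y \<in> S" using g False by (auto simp: S_def)
  qed
  have inj: "inj_on ((*) \<alpha>) S" using False by (auto simp: inj_on_def)
  have "(*) \<alpha> ` S = S" by (rule endo_inj_surj[OF fin into inj])
  then have "\<Prod>S = (\<Prod>x\<in>S. \<alpha> * x)"
    using prod.reindex[OF inj, of "\<lambda>x. x"] by simp
  also have "\<dots> = \<alpha> ^ card S * \<Prod>S" by (simp add: prod.distrib)
  finally have "\<alpha> ^ card S = 1" using fin by (simp add: S_def)
  then have "\<alpha> ^ Suc (card S) = \<alpha>" by simp
  then show ?thesis by (simp add: card)
qed simp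

lemma root_power_shift: "\<alpha> ^ (CARD('a) ^ (Polynomial.degree f * i + l)) = \<alpha> ^ (CARD('a) ^ l)"
proof (induction i)
  case (Suc i)
  have "\<alpha> ^ (CARD('a) ^ (Polynomial.degree f * Suc i + l)) =
      (\<alpha> ^ (CARD('a) ^ Polynomial.degree f)) ^ (CARD('a) ^ (Polynomial.degree f * i + l))"
    by (simp add: power_add flip: power_mult) (simp add: mult_ac)
  then show ?case using Suc by (simp add: root_power_card)
qed simp

text \<open>
  If \<open>\<alpha>\<close> were fixed by the \<open>q^d\<close>-th power map with \<open>0 < d < h\<close>, all \<open>q^h\<close> residues would be roots of
  \<open>X^(q^d) - X\<close>, which has too small a degree.
\<close>

lemma root_power_eq_iff: "\<alpha> ^ (CARD('a) ^ l) = \<alpha> \<longleftrightarrow> Polynomial.degree f dvd l"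
proof
  assume *: "\<alpha> ^ (CARD('a) ^ l) = \<alpha>"
  define d where "d = l mod Polynomial.degree f"
  have \<alpha>: "\<alpha> ^ (CARD('a) ^ d) = \<alpha>"
    using root_power_shift[of "l div Polynomial.degree f" d] * by (simp add: d_def)
  show "Polynomial.degree f dvd l"
  proof (rule ccontr)
    assume "\<not> Polynomial.degree f dvd l"
    then have d: "0 < d" "d < Polynomial.degree f"
      using degree_pos by (auto simp: d_def dvd_eq_mod_eq_0)
    define p :: "'a alg_closure poly" where
      "p = Polynomial.monom 1 (CARD('a) ^ d) - Polynomial.monom 1 1"
    have gt: "1 < CARD('a) ^ d"
      using two_le_card_field[where 'a = 'a] d(1) by (intro one_less_power) auto
    then have "Polynomial.coeff p (CARD('a) ^ d) = 1" by (simp add: p_def)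
    then have "p \<noteq> 0" by auto
    have "Polynomial.degree p \<le> CARD('a) ^ d"
      unfolding p_def using gt by (intro degree_diff_le) (auto intro: order_trans[OF degree_monom_le])
    have "CARD('a) ^ Polynomial.degree f \<le> card {x. poly p x = 0}"
      unfolding card_residues[symmetric]
    proof (rule card_mono)
      show "residue \<alpha> ` polys_below (Polynomial.degree f) \<subseteq> {x. poly p x = 0}"
        using residue_frobenius[OF \<alpha>] by (auto simp: p_def poly_monom)
    qed (use poly_roots_finite[OF \<open>p \<noteq> 0\<close>] in simp)
    also have "\<dots> \<le> Polynomial.degree p" by (rule card_poly_roots_bound) fact
    also have "\<dots> \<le> CARD('a) ^ d" by fact
    finally have "Polynomial.degree f \<le> d"
      using two_le_card_field[where 'a = 'a] by (simp add: power_increasing_iff)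
    then show False using d by simp
  qed
next
  assume "Polynomial.degree f dvd l"
  then show "\<alpha> ^ (CARD('a) ^ l) = \<alpha>"
    using root_power_shift[of _ 0] by (auto elim!: dvdE)
qed

lemma residue_bracket: "residue \<alpha> (bracket l [:0, 1:]) = \<alpha> ^ (CARD('a) ^ l) - \<alpha>"
  by (simp add: bracket_def residue_diff residue_power residue_pCons)

lemma dvd_bracket_iff: "f dvd bracket l [:0, 1:] \<longleftrightarrow> Polynomial.degree f dvd l"
  by (simp add: residue_bracket flip: residue_eq_0_iff root_power_eq_iff)

lemma residue_bracket_shift:
  "residue \<alpha> (bracket (Polynomial.degree f * i + l) [:0, 1:]) = residue \<alpha> (bracket l [:0, 1:])"
  by (simp add: residue_bracket root_power_shift)

text \<open>
  The derivative of \<open>T^(q^l) - T\<close> is \<open>-1\<close>.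
\<close>

lemma square_not_dvd_bracket:
  assumes "0 < l"
  shows "\<not> f ^ 2 dvd bracket l [:0, 1:]"
proof
  assume "f ^ 2 dvd bracket l [:0, 1:]"
  then obtain u where u: "bracket l [:0, 1:] = f ^ 2 * u" by (elim dvdE)
  have "(of_nat CARD('a) :: 'a) = 0"
    using CHAR_dvd_CARD[where 'a = 'a] by (simp add: of_nat_eq_0_iff_char_dvd)
  then have "pderiv (bracket l [:0, 1::'a:]) = - 1"
    using assms by (simp add: bracket_def pderiv_diff pderiv_power pderiv_pCons power_0_left one_pCons)
  moreover have "f dvd pderiv (bracket l [:0, 1:])"
    unfolding u by (simp add: pderiv_mult pderiv_power power2_eq_square)
  ultimately have "is_unit f" by simp
  then show False using prime by (simp add: prime_elem_def)
qed

end

lemma place_exists: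
  fixes f :: "'a::{finite,field} poly"
  assumes "prime_elem f"
  obtains \<alpha> where "place f \<alpha>"
proof -
  have "0 < Polynomial.degree f"
  proof (rule ccontr)
    assume "\<not> 0 < Polynomial.degree f"
    then have "is_unit f" using assms
      by (auto simp: is_unit_iff_degree prime_elem_def)
    then show False using assms by (simp add: prime_elem_def)
  qed
  then have "0 < Polynomial.degree (map_poly to_ac f)"
    by (simp add: degree_map_poly)
  then obtain \<alpha> where "poly (map_poly to_ac f) \<alpha> = 0"
    using alg_closed_imp_poly_has_root by blast
  then show ?thesis using that assms by (auto simp: place_def residue_def)
qed

section \<open>Carlitz factorials and binomials\<close>

abbreviation bracket_T :: "nat \<Rightarrow> 'a::{finite,field} poly" where
  "bracket_T l \<equiv> bracket l [:0, 1:]"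

text \<open>
  The factorial at \<open>T\<close> in Legendre form: the exponent of \<open>[l]\<close> in \<open>\<Pi>\<^sub>m\<close> is the integral part of \<open>m/q^l\<close>,
  as for the classical factorial. In this form divisibility statements about factorials reduce to
  inequalities between integral parts.
\<close>

definition factorial_T :: "nat \<Rightarrow> 'a::{finite,field} poly" where
  "factorial_T m = (\<Prod>l\<in>{1..m}. bracket_T l ^ (m div CARD('a) ^ l))"

lemma less_card_power: "m < CARD('a::{finite,field}) ^ m"
  by (rule power_gt_expt) (use two_le_card_field[where 'a = 'a] in simp)

lemma div_card_power_eq_0: "m \<le> l \<Longrightarrow> m div CARD('a::{finite,field}) ^ l = 0"
  using less_card_power[of l, where 'a = 'a] by simp

lemma bracket_T_nonzero:
  assumes "0 < l"
  shows "bracket_T l \<noteq> (0 :: 'a::{finite,field} poly)"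
proof -
  have "1 < CARD('a) ^ l"
    using two_le_card_field[where 'a = 'a] assms by (intro one_less_power) auto
  moreover have "[:0, 1::'a:] ^ n = Polynomial.monom 1 n" for n
    by (simp add: monom_altdef)
  moreover have "[:0, 1::'a:] = Polynomial.monom 1 1"
    by (simp add: monom_altdef)
  ultimately have "Polynomial.coeff (bracket_T l :: 'a poly) (CARD('a) ^ l) = 1"
    by (simp add: bracket_def)
  then show ?thesis by auto
qed

lemma factorial_T_nonzero: "factorial_T m \<noteq> (0 :: 'a::{finite,field} poly)"
  by (auto simp: factorial_T_def bracket_T_nonzero)

lemma factorial_T_upto:
  assumes "m \<le> N"
  shows "factorial_T m = (\<Prod>l\<in>{1..N}. bracket_T l ^ (m div CARD('a::{finite,field}) ^ l) :: 'a poly)"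
  unfolding factorial_T_def
  by (rule prod.mono_neutral_left) (use assms in \<open>auto simp: div_card_power_eq_0[where 'a = 'a]\<close>)

lemma carlitz_D_T: "carlitz_D i [:0, 1:] = (factorial_T (CARD('a) ^ i) :: 'a::{finite,field} poly)"
  unfolding carlitz_D_def factorial_T_def
proof (rule prod.mono_neutral_cong_left)
  let ?q = "CARD('a)"
  show "{1..i} \<subseteq> {1..?q ^ i}"
    using less_card_power[of i, where 'a = 'a] by auto
  show "\<forall>l\<in>{1..?q ^ i} - {1..i}. (bracket_T l :: 'a poly) ^ (?q ^ i div ?q ^ l) = 1"
    using two_le_card_field[where 'a = 'a] by (auto simp: power_strict_increasing)
  show "(bracket_T l :: 'a poly) ^ ?q ^ (i - l) = bracket_T l ^ (?q ^ i div ?q ^ l)" if "l \<in> {1..i}" for l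
    using that by (simp add: power_diff)
qed simp

lemma sum_digits: "(\<Sum>i<n. (x div b ^ i mod b) * b ^ i) = x mod (b ^ n)" for x b :: nat
proof (induction n)
  case (Suc n)
  have "x mod b ^ Suc n = b ^ n * (x div b ^ n mod b) + x mod b ^ n"
    by (simp only: power_Suc2 mod_mult2_eq)
  then show ?case using Suc by (simp add: mult.commute)
qed simp

lemma carlitz_factorial_T: "carlitz_factorial j [:0, 1:] = (factorial_T j :: 'a::{finite,field} poly)"
proof -
  let ?q = "CARD('a)"
  let ?c = "\<lambda>e. j div ?q ^ e mod ?q"
  have D: "carlitz_D e [:0, 1::'a:] = (\<Prod>l\<in>{1..j}. bracket_T l ^ (if l \<le> e then ?q ^ (e - l) else 0))"
    if "e \<le> j" for e
    unfolding carlitz_D_def by (rule prod.mono_neutral_cong_left) (use that in auto)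
  have "carlitz_factorial j [:0, 1::'a:] =
      (\<Prod>e\<in>{..j}. \<Prod>l\<in>{1..j}. bracket_T l ^ ((if l \<le> e then ?q ^ (e - l) else 0) * ?c e))"
    unfolding carlitz_factorial_def
    by (intro prod.cong refl) (simp only: atMost_iff D prod_power_distrib power_mult)
  also have "\<dots> = (\<Prod>l\<in>{1..j}. bracket_T l ^ (\<Sum>e\<in>{..j}. (if l \<le> e then ?q ^ (e - l) else 0) * ?c e))"
    by (subst prod.swap) (simp only: power_sum)
  also have "\<dots> = factorial_T j"
    unfolding factorial_T_def
  proof (intro prod.cong refl arg_cong2[where f = "(^)"])
    fix l assume l: "l \<in> {1..j}"
    have "(\<Sum>e\<in>{..j}. (if l \<le> e then ?q ^ (e - l) else 0) * ?c e) = (\<Sum>e\<in>{l..j}. ?q ^ (e - l) * ?c e)"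
      by (rule sum.mono_neutral_cong_right) auto
    also have "\<dots> = (\<Sum>i<Suc j - l. (j div ?q ^ l div ?q ^ i mod ?q) * ?q ^ i)"
      by (rule sum.reindex_bij_witness[of _ "\<lambda>i. i + l" "\<lambda>e. e - l"])
         (use l in \<open>auto simp: div_mult2_eq[symmetric] power_add[symmetric] mult.commute\<close>)
    also have "\<dots> = j div ?q ^ l mod ?q ^ (Suc j - l)" by (rule sum_digits)
    also have "\<dots> = j div ?q ^ l"
    proof (rule mod_less)
      have "j < ?q ^ Suc j" using less_card_power[of "Suc j", where 'a = 'a] by simp
      also have "?q ^ Suc j = ?q ^ (Suc j - l) * ?q ^ l"
        using l by (simp flip: power_add)
      finally show "j div ?q ^ l < ?q ^ (Suc j - l)" by (rule less_mult_imp_div_less)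
    qed
    finally show "(\<Sum>e\<in>{..j}. (if l \<le> e then ?q ^ (e - l) else 0) * ?c e) = j div ?q ^ l" .
  qed
  finally show ?thesis .
qed

text \<open>
  The polynomial \<open>x^(q^l)\<close> arises from \<open>x\<close> by substituting \<open>T^(q^l)\<close> for \<open>T\<close>, and \<open>u - v\<close> divides
  \<open>x(u) - x(v)\<close>.
\<close>

lemma bracket_T_dvd_bracket: "bracket_T l dvd bracket l (x :: 'a::{finite,field} poly)"
proof (induction x)
  case (pCons c x)
  let ?Q = "CARD('a) ^ l"
  define T where "T = [:0, 1::'a:]"
  have x: "pCons c x = [:c:] + T * x" by (simp add: T_def)
  have c: "[:c:] ^ ?Q = [:c:]"
    by (simp add: poly_const_pow finite_field_power_card_power)
  have "bracket l (pCons c x) = ([:c:] + T * x) ^ ?Q - ([:c:] + T * x)"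
    unfolding bracket_def x ..
  also have "\<dots> = (T ^ ?Q - T) * x ^ ?Q + T * (x ^ ?Q - x)"
    by (simp only: frobenius_add[where 'a = 'a, OF semiring_char_poly] c power_mult_distrib)
       (simp add: algebra_simps)
  finally show ?case
    using pCons.IH unfolding bracket_def T_def by (metis dvd_add dvd_mult dvd_mult2 dvd_refl)
qed (simp add: bracket_def power_0_left)

lemma carlitz_factorial_T_dvd: "factorial_T j dvd carlitz_factorial j (x :: 'a::{finite,field} poly)"
  unfolding carlitz_factorial_T[symmetric] unfolding carlitz_factorial_def carlitz_D_def
  by (intro prod_dvd_prod dvd_power_same bracket_T_dvd_bracket)

lemma factorial_ideal_eq: "factorial_ideal j = {g :: 'a::{finite,field} poly. factorial_T j dvd g}"
proof -
  interpret R: cring "poly_A :: 'a poly ring" by (rule cring_from_type_algebra)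
  have carrier: "carrier (poly_A :: 'a poly ring) = UNIV" by (simp add: ring_of_type_algebra_def)
  have P: "{g. factorial_T j dvd g} = PIdl\<^bsub>poly_A\<^esub> (factorial_T j :: 'a poly)"
    by (auto simp: mem_PIdl_poly_A)
  have "factorial_ideal j \<subseteq> PIdl\<^bsub>poly_A\<^esub> (factorial_T j :: 'a poly)"
    unfolding factorial_ideal_def
    by (rule R.genideal_minimal)
       (auto simp: R.cgenideal_ideal carrier mem_PIdl_poly_A carlitz_factorial_T_dvd)
  moreover have "PIdl\<^bsub>poly_A\<^esub> (factorial_T j :: 'a poly) \<subseteq> factorial_ideal j"
    unfolding factorial_ideal_def
  proof (rule R.cgenideal_minimal)
    show "ideal (Idl\<^bsub>poly_A\<^esub> (range (carlitz_factorial j))) (poly_A :: 'a poly ring)"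
      by (rule R.genideal_ideal) (simp add: carrier)
    have "range (carlitz_factorial j) \<subseteq> Idl\<^bsub>poly_A\<^esub> (range (carlitz_factorial j) :: 'a poly set)"
      by (rule R.genideal_self) (simp add: carrier)
    then show "factorial_T j \<in> Idl\<^bsub>poly_A\<^esub> (range (carlitz_factorial j) :: 'a poly set)"
      using carlitz_factorial_T[of j, where 'a = 'a] by (metis range_subsetD)
  qed
  ultimately show ?thesis by (simp add: P)
qed

text \<open>
  The quotient of \<open>\<Pi>\<^bsub>a+b\<^esub>\<close> by \<open>\<Pi>\<^sub>a \<Pi>\<^sub>b\<close>.
\<close>

definition factorial_binomial :: "nat \<Rightarrow> nat \<Rightarrow> 'a::{finite,field} poly" where
  "factorial_binomial a b =
     (\<Prod>l\<in>{1..a + b}. bracket_T l ^ ((a + b) div CARD('a) ^ l - a div CARD('a) ^ l - b div CARD('a) ^ l))"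

lemma factorial_T_add:
  "factorial_T (a + b) = factorial_binomial a b * factorial_T a * (factorial_T b :: 'a::{finite,field} poly)"
proof -
  let ?q = "CARD('a)"
  have le: "a div c + b div c \<le> (a + b) div c" for c :: nat
    by (simp only: div_add1_eq[of a b c] le_add1)
  have "factorial_T (a + b) = (\<Prod>l\<in>{1..a + b}. bracket_T l ^ ((a + b) div ?q ^ l - a div ?q ^ l - b div ?q ^ l)
      * bracket_T l ^ (a div ?q ^ l) * bracket_T l ^ (b div ?q ^ l) :: 'a poly)"
    unfolding factorial_T_def
  proof (rule prod.cong)
    fix l
    have "(a + b) div ?q ^ l = (a + b) div ?q ^ l - a div ?q ^ l - b div ?q ^ l + a div ?q ^ l + b div ?q ^ l"
      using le[of "?q ^ l"] by linarith
    then show "(bracket_T l :: 'a poly) ^ ((a + b) div ?q ^ l) = bracket_T l ^ ((a + b) div ?q ^ l - a div ?q ^ l - b div ?q ^ l)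
      * bracket_T l ^ (a div ?q ^ l) * bracket_T l ^ (b div ?q ^ l)"
      by (metis power_add)
  qed simp
  also have "\<dots> = factorial_binomial a b * factorial_T a * factorial_T b"
    by (simp add: prod.distrib factorial_binomial_def factorial_T_upto[of a "a + b"] factorial_T_upto[of b "a + b"])
  finally show ?thesis .
qed

lemma sub_div_eq:
  fixes m b c :: nat
  assumes "b \<le> m" "b < c"
  shows "m div c - (m - b) div c - b div c = (if m mod c < b then 1 else 0)"
proof -
  have m: "m = c * (m div c) + m mod c" by simp
  show ?thesis
  proof (cases "m mod c < b")
    case True
    then have "m div c \<noteq> 0" using assms m by (metis add_0 mult_0_right not_le)
    then obtain u where u: "m div c = Suc u" by (cases "m div c") auto
    have "m - b = c * u + (c + m mod c - b)"
      using m u True assms by (simp add: algebra_simps)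
    moreover have "c + m mod c - b < c" using True assms by linarith
    ultimately have "(m - b) div c = u" by (simp add: div_mult_self4)
    then show ?thesis using u True assms by simp
  next
    case False
    then have "m - b = c * (m div c) + (m mod c - b)" using m by linarith
    moreover have "m mod c - b < c"
      using assms(2) mod_less_divisor[of c m] by linarith
    ultimately have "(m - b) div c = m div c"
      by (metis add.right_neutral div_less div_mult_self4 gr_implies_not0)
    then show ?thesis using False assms by simp
  qed
qed

text \<open>
  When the second argument is \<open>q^s\<close>, the exponent of \<open>[l]\<close> is \<open>1\<close> if subtracting \<open>q^s\<close> from \<open>m\<close> borrows
  from the part of \<open>m\<close> above \<open>q^l\<close>, and \<open>0\<close> otherwise. The upper limit \<open>N\<close> is free because further
  exponents are \<open>0\<close>.
\<close>

lemma factorial_binomial_power: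
  assumes m: "CARD('a::{finite,field}) ^ s \<le> m" "m \<le> N"
  shows "factorial_binomial (m - CARD('a) ^ s) (CARD('a) ^ s) =
    (\<Prod>l\<in>{1..N}. bracket_T l ^ (if s < l \<and> m mod CARD('a) ^ l < CARD('a) ^ s then 1 else 0) :: 'a poly)"
proof -
  let ?q = "CARD('a)"
  have ex: "m div ?q ^ l - (m - ?q ^ s) div ?q ^ l - ?q ^ s div ?q ^ l =
      (if s < l \<and> m mod ?q ^ l < ?q ^ s then 1 else 0)" for l
  proof (cases "s < l")
    case True
    then have "?q ^ s < ?q ^ l" using two_le_card_field[where 'a = 'a] by (simp add: power_strict_increasing)
    then show ?thesis using True m sub_div_eq by auto
  next
    case False
    then have s: "?q ^ s = ?q ^ l * ?q ^ (s - l)" by (simp flip: power_add)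
    define u where "u = m - ?q ^ s"
    have "m = u + ?q ^ l * ?q ^ (s - l)" using m by (simp add: u_def s)
    then have "m div ?q ^ l = u div ?q ^ l + ?q ^ (s - l)" by simp
    then show ?thesis using False s unfolding u_def[symmetric] by simp
  qed
  show ?thesis
    unfolding factorial_binomial_def le_add_diff_inverse2[OF m(1)] ex
  proof (rule prod.mono_neutral_left)
    show "\<forall>l\<in>{1..N} - {1..m}. (bracket_T l :: 'a poly) ^
        (if s < l \<and> m mod ?q ^ l < ?q ^ s then 1 else 0) = 1"
    proof
      fix l assume l: "l \<in> {1..N} - {1..m}"
      then have "?q ^ m \<le> ?q ^ l" by (intro power_increasing) auto
      then have "m < ?q ^ l" using less_card_power[of m, where 'a = 'a] by linarith
      then show "(bracket_T l :: 'a poly) ^ (if s < l \<and> m mod ?q ^ l < ?q ^ s then 1 else 0) = 1"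
        using m(1) by simp
    qed
  qed (use m in auto)
qed

section \<open>Powers of the exponential modulo a prime\<close>

text \<open>
  A relation instead of a function: it is preserved when the same amount is subtracted from
  corresponding digits, which is what the induction below needs.
\<close>

definition digits_permuted :: "nat \<Rightarrow> (nat \<Rightarrow> nat) \<Rightarrow> nat \<Rightarrow> nat \<Rightarrow> bool" where
  "digits_permuted Q \<rho> m m' \<longleftrightarrow> (\<forall>i. m' div Q ^ (\<rho> i) mod Q = m div Q ^ i mod Q)"

lemma digits_permuted_eq_0_iff:
  assumes "1 < Q" "bij \<rho>" "digits_permuted Q \<rho> m m'"
  shows "m = 0 \<longleftrightarrow> m' = 0"
proof -
  have zero: "x = 0" if "\<And>i. x div Q ^ i mod Q = 0" for x
  proof -
    have "x < Q ^ x" by (rule power_gt_expt) (use assms(1) in simp)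
    then show ?thesis using sum_digits[where x = x and b = Q and n = x] by (simp add: that)
  qed
  have "m' div Q ^ k mod Q = 0" if "m = 0" for k
    using assms(2,3) that unfolding digits_permuted_def
    by (metis bij_pointE div_0 mod_0)
  then show ?thesis
    using zero[of m'] zero[of m] assms(3) unfolding digits_permuted_def by (metis div_0 mod_0)
qed

lemma digit_diff:
  fixes m c i k Q :: nat
  assumes c: "c \<le> m div Q ^ i mod Q"
  shows "(m - c * Q ^ i) div Q ^ k mod Q = (if k = i then m div Q ^ i mod Q - c else m div Q ^ k mod Q)"
proof (cases "Q = 0")
  case False
  define u where "u = m div Q ^ i"
  define m2 where "m2 = m - c * Q ^ i"
  have cu: "c \<le> u mod Q" using c by (simp add: u_def)
  then have cu': "c \<le> u" using mod_less_eq_dividend[of u Q] by linarith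
  have "c * Q ^ i \<le> u * Q ^ i" using cu' by simp
  also have "\<dots> \<le> m" by (simp add: u_def)
  finally have m: "m = m2 + c * Q ^ i" by (simp add: m2_def)
  have u2: "m2 div Q ^ i = u - c"
    using False by (simp add: u_def m)
  consider "k < i" | "k = i" | "i < k" by linarith
  then show ?thesis
  proof cases
    case 1
    then have "Q ^ i = Q ^ k * (Q * Q ^ (i - Suc k))"
      by (simp flip: power_add power_Suc)
    then have "m = m2 + Q ^ k * (c * (Q * Q ^ (i - Suc k)))"
      using m by (simp only: mult_ac)
    moreover have "(m2 + Q ^ k * z) div Q ^ k = m2 div Q ^ k + z" for z
      using False by simp
    ultimately have "m div Q ^ k = m2 div Q ^ k + c * (Q * Q ^ (i - Suc k))"
      by presburger
    then have "m div Q ^ k mod Q = m2 div Q ^ k mod Q"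
      by (metis mod_mult_self2 mult.left_commute)
    then show ?thesis using 1 by (simp add: m2_def)
  next
    case 2
    have "u - c = Q * (u div Q) + (u mod Q - c)"
      using cu by simp
    moreover have "u mod Q - c < Q" using False by (simp add: less_imp_diff_less)
    ultimately have "(u - c) mod Q = u mod Q - c" by simp
    then show ?thesis using 2 u2 by (simp add: u_def m2_def)
  next
    case 3
    have "u - c = Q * (u div Q) + (u mod Q - c)"
      using cu by simp
    moreover have "u mod Q - c < Q" using False by (simp add: less_imp_diff_less)
    ultimately have "(u - c) div Q = u div Q" using False by simp
    moreover have "Q ^ k = Q ^ i * (Q * Q ^ (k - Suc i))"
      using 3 by (simp flip: power_add power_Suc)
    ultimately have "m2 div Q ^ k = m div Q ^ k"
      using u2 by (simp add: div_mult2_eq u_def)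
    then show ?thesis using 3 by (simp add: m2_def)
  qed
qed (use c in \<open>auto simp: power_0_left\<close>)

lemma digits_permuted_diff:
  assumes "bij \<rho>" "digits_permuted Q \<rho> m m'" "c \<le> m div Q ^ i mod Q"
  shows "digits_permuted Q \<rho> (m - c * Q ^ i) (m' - c * Q ^ \<rho> i)"
proof -
  have "c \<le> m' div Q ^ \<rho> i mod Q" using assms(2,3) by (simp add: digits_permuted_def)
  moreover have "\<rho> k = \<rho> i \<longleftrightarrow> k = i" for k using assms(1) by (auto simp: bij_def inj_eq)
  ultimately show ?thesis
    using assms(2,3) by (simp add: digits_permuted_def digit_diff)
qed

lemma mult_add_less_mult_iff:
  fixes b x y z :: nat
  assumes "y < b"
  shows "(b * x + y < b * z) = (x < z)"
proof
  assume "x < z"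
  then have "b * Suc x \<le> b * z" by (intro mult_le_mono2) simp
  then show "b * x + y < b * z" using assms by simp
next
  assume "b * x + y < b * z"
  then have "b * x < b * z" by linarith
  then show "x < z" by simp
qed

context place
begin

abbreviation "h \<equiv> Polynomial.degree f"

text \<open>
  Both sides compare the digits of \<open>m\<close> in the positions from \<open>hi\<close> up to \<open>hi + l\<close> to the base \<open>q\<close>; the
  right-hand side reads them off from the \<open>i\<close>-th digit to the base \<open>Q = q^h\<close>.
\<close>

lemma mod_power_less_iff:
  fixes m i r l :: nat
  assumes "l \<le> h"
  shows "m mod CARD('a) ^ (h * i + l) < CARD('a) ^ (h * i + r) \<longleftrightarrow>
     m div (CARD('a) ^ h) ^ i mod CARD('a) ^ h mod CARD('a) ^ l < CARD('a) ^ r"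
proof -
  let ?q = "CARD('a)"
  define B where "B = (?q ^ h) ^ i"
  have B: "?q ^ (h * i + l) = B * ?q ^ l" for l by (simp add: B_def power_add power_mult)
  have "0 < B" by (simp add: B_def)
  have "?q ^ l dvd ?q ^ h" using assms by (rule le_imp_power_dvd)
  then have "m div B mod ?q ^ h mod ?q ^ l = m div B mod ?q ^ l" by (rule mod_mod_cancel)
  moreover have "m mod (B * ?q ^ l) = B * (m div B mod ?q ^ l) + m mod B" by (rule mod_mult2_eq)
  ultimately show ?thesis
    using mult_add_less_mult_iff[of "m mod B" B] \<open>0 < B\<close> by (simp only: B mod_less_divisor flip: B_def)
qed

text \<open>
  A borrow at position \<open>i\<close> to the base \<open>Q\<close> puts the factor \<open>[h(i + 1)]\<close> into the binomial, and \<open>f\<close>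
  divides it.
\<close>

lemma residue_factorial_binomial_borrow:
  assumes r: "r < h" and m: "CARD('a) ^ (h * i + r) \<le> m"
    and d: "m div (CARD('a) ^ h) ^ i mod CARD('a) ^ h < CARD('a) ^ r"
  shows "residue \<alpha> (factorial_binomial (m - CARD('a) ^ (h * i + r)) (CARD('a) ^ (h * i + r))) = 0"
proof -
  let ?q = "CARD('a)"
  have "m mod ?q ^ (h * i + h) < ?q ^ (h * i + r)"
    using mod_power_less_iff[of h m i r] d by simp
  then have "residue \<alpha> (bracket_T (h * i + h) ^ (if h * i + r < h * i + h \<and>
      m mod ?q ^ (h * i + h) < ?q ^ (h * i + r) then 1 else 0)) = 0"
    using r dvd_bracket_iff[of "h * i + h"] by (simp add: residue_eq_0_iff)
  moreover have "h * i + h \<in> {1..m + (h * i + h)}" using degree_pos by simp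
  ultimately show ?thesis
    unfolding factorial_binomial_power[OF m le_add1[of m "h * i + h"]] residue_prod
    by (intro prod_zero bexI[of _ "h * i + h"]) simp_all
qed

text \<open>
  Without a borrow only the factors \<open>[hi + l]\<close> with \<open>0 < l < h\<close> can occur. Which of them do occur is
  decided by the \<open>i\<close>-th digit, and their residues are those of \<open>[l]\<close>, so the position \<open>i\<close> does not
  enter the result.
\<close>

lemma residue_factorial_binomial:
  assumes r: "r < h" and m: "CARD('a) ^ (h * i + r) \<le> m"
    and d: "CARD('a) ^ r \<le> m div (CARD('a) ^ h) ^ i mod CARD('a) ^ h"
  shows "residue \<alpha> (factorial_binomial (m - CARD('a) ^ (h * i + r)) (CARD('a) ^ (h * i + r))) =
     (\<Prod>l\<in>{1..<h}. residue \<alpha> (bracket_T l ^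
        (if r < l \<and> m div (CARD('a) ^ h) ^ i mod CARD('a) ^ h mod CARD('a) ^ l < CARD('a) ^ r then 1 else 0)))"
proof -
  let ?q = "CARD('a)" and ?s = "h * i + r"
  define N where "N = m + (h * i + h)"
  let ?g = "\<lambda>l. residue \<alpha> (bracket_T l ^ (if ?s < l \<and> m mod ?q ^ l < ?q ^ ?s then 1 else 0))"
  have "residue \<alpha> (factorial_binomial (m - ?q ^ ?s) (?q ^ ?s)) = (\<Prod>l\<in>{1..N}. ?g l)"
    using factorial_binomial_power[OF m, of N] by (simp only: residue_prod N_def le_add1)
  also have "\<dots> = (\<Prod>l\<in>{h * i + 1..<h * i + h}. ?g l)"
  proof (rule prod.mono_neutral_right)
    show "\<forall>l\<in>{1..N} - {h * i + 1..<h * i + h}. ?g l = 1"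
    proof
      fix l assume "l \<in> {1..N} - {h * i + 1..<h * i + h}"
      then consider "l \<le> h * i" | "h * i + h \<le> l" by force
      then show "?g l = 1"
      proof cases
        case 2
        then have "?q ^ (h * i + h) dvd ?q ^ l" by (rule le_imp_power_dvd)
        then have "m mod ?q ^ (h * i + h) = m mod ?q ^ l mod ?q ^ (h * i + h)"
          by (simp add: mod_mod_cancel)
        then have "m mod ?q ^ (h * i + h) \<le> m mod ?q ^ l" by (metis mod_less_eq_dividend)
        moreover have "\<not> m mod ?q ^ (h * i + h) < ?q ^ ?s"
          using mod_power_less_iff[of h m i r] d by simp
        ultimately show ?thesis by simp
      qed simp
    qed
  qed (auto simp: N_def)
  also have "\<dots> = (\<Prod>l\<in>{1..<h}. ?g (h * i + l))"
    by (rule prod.reindex_bij_witness[of _ "\<lambda>l. h * i + l" "\<lambda>l. l - h * i"]) auto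
  also have "\<dots> = (\<Prod>l\<in>{1..<h}. residue \<alpha> (bracket_T l ^
        (if r < l \<and> m div (?q ^ h) ^ i mod ?q ^ h mod ?q ^ l < ?q ^ r then 1 else 0)))"
    by (rule prod.cong) (simp_all add: mod_power_less_iff residue_power residue_bracket_shift)
  finally show ?thesis .
qed

end

text \<open>
  The numbers \<open>H\<^sub>k(m)\<close>, defined by the recursion that comes from multiplying \<open>e^k\<close> by the series \<open>e\<close>,
  whose only exponents are the powers \<open>q^s\<close>. The identification with coefficients of \<open>e^k\<close> is
  \<open>hom_exp_power_coeff\<close> below.
\<close>

primrec exp_power_coeff :: "nat \<Rightarrow> nat \<Rightarrow> 'a::{finite,field} poly" where
  "exp_power_coeff 0 m = (if m = 0 then 1 else 0)"
| "exp_power_coeff (Suc k) m = (\<Sum>s | CARD('a) ^ s \<le> m.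
     factorial_binomial (m - CARD('a) ^ s) (CARD('a) ^ s) * exp_power_coeff k (m - CARD('a) ^ s))"

lemma finite_card_power_le: "finite {s. CARD('a::{finite,field}) ^ s \<le> m}"
proof (rule finite_subset)
  show "{s. CARD('a) ^ s \<le> m} \<subseteq> {..m}"
    using less_card_power[where 'a = 'a] by (auto intro: less_imp_le less_le_trans)
qed simp

context place
begin

text \<open>
  The \<open>s\<close> for which \<open>q^s\<close> can be subtracted from \<open>m\<close> without a borrow to the base \<open>q^h\<close>.
\<close>

definition no_borrow :: "nat \<Rightarrow> nat set" where
  "no_borrow m = {s. CARD('a) ^ (s mod h) \<le> m div (CARD('a) ^ h) ^ (s div h) mod CARD('a) ^ h}"

lemma no_borrow_le:
  assumes "s \<in> no_borrow m"
  shows "CARD('a) ^ s \<le> m"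
proof -
  let ?Q = "CARD('a) ^ h"
  have "CARD('a) ^ s = ?Q ^ (s div h) * CARD('a) ^ (s mod h)"
    by (simp flip: power_mult power_add)
  also have "\<dots> \<le> ?Q ^ (s div h) * (m div ?Q ^ (s div h))"
    using assms order_trans[OF _ mod_less_eq_dividend]
    by (intro mult_le_mono2) (simp only: no_borrow_def mem_Collect_eq)
  also have "\<dots> \<le> m" by simp
  finally show ?thesis .
qed

lemma residue_exp_power_coeff_Suc:
  "residue \<alpha> (exp_power_coeff (Suc k) m) = (\<Sum>s\<in>no_borrow m.
     residue \<alpha> (factorial_binomial (m - CARD('a) ^ s) (CARD('a) ^ s)) *
     residue \<alpha> (exp_power_coeff k (m - CARD('a) ^ s)))"
  unfolding exp_power_coeff.simps residue_sum residue_mult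
proof (rule sum.mono_neutral_right)
  show "\<forall>s\<in>{s. CARD('a) ^ s \<le> m} - no_borrow m.
      residue \<alpha> (factorial_binomial (m - CARD('a) ^ s) (CARD('a) ^ s)) *
      residue \<alpha> (exp_power_coeff k (m - CARD('a) ^ s)) = 0"
  proof
    fix s assume s: "s \<in> {s. CARD('a) ^ s \<le> m} - no_borrow m"
    have "s mod h < h" using degree_pos by simp
    from residue_factorial_binomial_borrow[OF this, of "s div h" m] s
    show "residue \<alpha> (factorial_binomial (m - CARD('a) ^ s) (CARD('a) ^ s)) *
        residue \<alpha> (exp_power_coeff k (m - CARD('a) ^ s)) = 0"
      by (simp add: no_borrow_def not_le)
  qed
qed (use no_borrow_le finite_card_power_le[where 'a = 'a] in auto)

text \<open>
  Only the exponents in \<open>no_borrow\<close> survive in the recursion, and \<open>hi + r \<mapsto> h \<rho>(i) + r\<close> maps those of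
  \<open>m\<close> bijectively to those of \<open>m'\<close>. Corresponding terms have equal binomials, and the arguments that
  remain are again related by the permutation of digits.
\<close>

theorem residue_exp_power_coeff_permuted:
  assumes \<rho>: "bij \<rho>" and m: "digits_permuted (CARD('a) ^ h) \<rho> m m'"
  shows "residue \<alpha> (exp_power_coeff k m) = residue \<alpha> (exp_power_coeff k m')"
  using m
proof (induction k arbitrary: m m')
  case 0
  have "1 < CARD('a) ^ h"
    using two_le_card_field[where 'a = 'a] degree_pos by (intro one_less_power) auto
  from digits_permuted_eq_0_iff[OF this \<rho> 0] show ?case by simp
next
  case (Suc k)
  let ?Q = "CARD('a) ^ h"
  define \<pi> where "\<pi> = (\<lambda>s. h * \<rho> (s div h) + s mod h)"
  define \<pi>' where "\<pi>' = (\<lambda>s. h * inv_into UNIV \<rho> (s div h) + s mod h)"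
  have h: "s mod h < h" for s using degree_pos by simp
  have div: "\<pi> s div h = \<rho> (s div h)" "\<pi> s mod h = s mod h"
    "\<pi>' s div h = inv_into UNIV \<rho> (s div h)" "\<pi>' s mod h = s mod h" for s
    using h[of s] by (simp_all add: \<pi>_def \<pi>'_def)
  have inv: "\<pi>' (\<pi> s) = s" "\<pi> (\<pi>' s) = s" for s
  proof -
    have "\<pi>' (\<pi> s) = h * inv_into UNIV \<rho> (\<pi> s div h) + \<pi> s mod h"
      "\<pi> (\<pi>' s) = h * \<rho> (\<pi>' s div h) + \<pi>' s mod h"
      by (simp_all only: \<pi>_def \<pi>'_def)
    then show "\<pi>' (\<pi> s) = s" "\<pi> (\<pi>' s) = s"
      unfolding div using \<rho> by (simp_all add: bij_is_inj bij_is_surj surj_f_inv_f inv_f_f)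
  qed
  have dig: "m' div ?Q ^ \<rho> i mod ?Q = m div ?Q ^ i mod ?Q" for i
    using Suc.prems by (simp add: digits_permuted_def)
  have dig': "m div ?Q ^ inv_into UNIV \<rho> i mod ?Q = m' div ?Q ^ i mod ?Q" for i
    using dig[of "inv_into UNIV \<rho> i"] \<rho> by (simp add: bij_is_surj surj_f_inv_f)
  show ?case
    unfolding residue_exp_power_coeff_Suc
  proof (rule sum.reindex_bij_witness[of _ \<pi>' \<pi>])
    fix s assume s: "s \<in> no_borrow m"
    let ?i = "s div h" and ?r = "s mod h"
    show s': "\<pi> s \<in> no_borrow m'"
      using s by (simp add: no_borrow_def div dig)
    have eq: "s = h * ?i + ?r" "\<pi> s = h * \<rho> ?i + ?r" by (simp_all add: \<pi>_def)
    have q: "CARD('a) ^ s = CARD('a) ^ ?r * ?Q ^ ?i" "CARD('a) ^ \<pi> s = CARD('a) ^ ?r * ?Q ^ \<rho> ?i"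
      by (simp_all add: \<pi>_def flip: power_mult power_add) (simp_all add: add.commute)
    have "digits_permuted ?Q \<rho> (m - CARD('a) ^ s) (m' - CARD('a) ^ \<pi> s)"
      unfolding q by (rule digits_permuted_diff[OF \<rho> Suc.prems]) (use s in \<open>simp add: no_borrow_def\<close>)
    then have "residue \<alpha> (exp_power_coeff k (m - CARD('a) ^ s)) =
        residue \<alpha> (exp_power_coeff k (m' - CARD('a) ^ \<pi> s))"
      by (rule Suc.IH)
    moreover have "residue \<alpha> (factorial_binomial (m - CARD('a) ^ s) (CARD('a) ^ s)) =
        residue \<alpha> (factorial_binomial (m' - CARD('a) ^ \<pi> s) (CARD('a) ^ \<pi> s))"
      using residue_factorial_binomial[OF h[of s], of ?i m] residue_factorial_binomial[OF h[of s], of "\<rho> ?i" m']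
        no_borrow_le[OF s] no_borrow_le[OF s'] s
      by (simp add: dig no_borrow_def flip: eq)
    ultimately show "residue \<alpha> (factorial_binomial (m' - CARD('a) ^ \<pi> s) (CARD('a) ^ \<pi> s)) *
          residue \<alpha> (exp_power_coeff k (m' - CARD('a) ^ \<pi> s)) =
        residue \<alpha> (factorial_binomial (m - CARD('a) ^ s) (CARD('a) ^ s)) *
          residue \<alpha> (exp_power_coeff k (m - CARD('a) ^ s))"
      by simp
  next
    fix s assume "s \<in> no_borrow m'"
    then show "\<pi>' s \<in> no_borrow m" by (simp add: no_borrow_def div dig')
  qed (simp_all add: inv)
qed

end

lemma digit_sum_eq:
  fixes c :: "nat \<Rightarrow> nat"
  assumes "\<And>t. c t < Q"
  shows "(\<Sum>t<N. c t * Q ^ t) div Q ^ k mod Q = (if k < N then c k else 0)"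
  using assms
proof (induction k arbitrary: c N)
  case (0 c N)
  show ?case
  proof (cases N)
    case (Suc N')
    have "(\<Sum>t<N. c t * Q ^ t) = c 0 + Q * (\<Sum>t<N'. c (Suc t) * Q ^ t)"
      unfolding Suc sum.lessThan_Suc_shift by (simp add: sum_distrib_left mult_ac)
    then show ?thesis using 0[of 0] Suc by simp
  qed simp
next
  case (Suc k c N)
  show ?case
  proof (cases N)
    case (Suc N')
    have "(\<Sum>t<N. c t * Q ^ t) = c 0 + Q * (\<Sum>t<N'. c (Suc t) * Q ^ t)"
      unfolding Suc sum.lessThan_Suc_shift by (simp add: sum_distrib_left mult_ac)
    then have "(\<Sum>t<N. c t * Q ^ t) div Q = (\<Sum>t<N'. c (Suc t) * Q ^ t)"
      using Suc.prems[of 0] by simp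
    then show ?thesis using Suc.IH[of "\<lambda>t. c (Suc t)" N'] Suc.prems \<open>N = Suc N'\<close>
      by (simp add: div_mult2_eq)
  qed simp
qed

lemma digits_permuted_sum:
  assumes \<rho>: "bij \<rho>" and "1 < Q"
  shows "digits_permuted Q \<rho> j (\<Sum>i\<le>j. (j div Q ^ i mod Q) * Q ^ \<rho> i)"
  unfolding digits_permuted_def
proof
  fix i
  define c where "c = (\<lambda>t. j div Q ^ inv_into UNIV \<rho> t mod Q)"
  have c: "c (\<rho> i) = j div Q ^ i mod Q" for i
    using \<rho> by (simp add: c_def bij_is_inj inv_f_f)
  have zero: "j div Q ^ i = 0" if "j < i" for i
  proof -
    have "i < Q ^ i" by (rule power_gt_expt) (use assms(2) in simp)
    then show ?thesis using that by simp
  qed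
  define N where "N = Suc (Max (\<rho> ` {..max i j}))"
  have N: "\<rho> k < N" if "k \<le> max i j" for k
    unfolding N_def less_Suc_eq_le by (rule Max_ge) (use that in auto)
  have "(\<Sum>i\<le>j. (j div Q ^ i mod Q) * Q ^ \<rho> i) = (\<Sum>t\<in>\<rho> ` {..j}. c t * Q ^ t)"
    using \<rho> by (subst sum.reindex) (auto simp: c bij_def intro: inj_on_subset)
  also have "\<dots> = (\<Sum>t<N. c t * Q ^ t)"
  proof (rule sum.mono_neutral_left)
    show "\<forall>t\<in>{..<N} - \<rho> ` {..j}. c t * Q ^ t = 0"
    proof
      fix t assume t: "t \<in> {..<N} - \<rho> ` {..j}"
      obtain k where k: "t = \<rho> k" using \<rho> by (metis bij_pointE)
      then have "j < k" using t by (auto simp: not_le)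
      then show "c t * Q ^ t = 0" by (simp add: k c zero)
    qed
  qed (use N in auto)
  finally show "(\<Sum>i\<le>j. (j div Q ^ i mod Q) * Q ^ \<rho> i) div Q ^ \<rho> i mod Q = j div Q ^ i mod Q"
    using digit_sum_eq[of c Q N "\<rho> i"] assms(2) N[of i] by (simp add: c) (simp add: c_def)
qed

text \<open>
  Powers of \<open>q\<close> are \<open>1\<close> modulo \<open>q - 1\<close>, so a number is congruent to the sum of its digits.
\<close>

lemma sum_permuted_digits_dvd:
  fixes q j :: nat
  assumes "1 < q" "0 < h" "(q - 1) dvd j"
  shows "(q - 1) dvd (\<Sum>i\<le>j. (j div (q ^ h) ^ i mod q ^ h) * (q ^ h) ^ \<rho> i)"
proof -
  let ?Q = "q ^ h"
  have "[q = 1] (mod (q - 1))"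
    using assms(1) by (metis dvd_refl less_imp_le cong_altdef_nat)
  then have "[q ^ n = 1 ^ n] (mod (q - 1))" for n by (rule cong_pow)
  then have Q: "[?Q ^ t = 1] (mod (q - 1))" for t by (simp flip: power_mult)
  have 1: "[(\<Sum>i\<le>j. (j div ?Q ^ i mod ?Q) * ?Q ^ \<rho> i) = (\<Sum>i\<le>j. (j div ?Q ^ i mod ?Q) * 1)] (mod (q - 1))"
    by (intro cong_sum cong_mult cong_refl Q)
  have 2: "[(\<Sum>i\<le>j. (j div ?Q ^ i mod ?Q) * ?Q ^ i) = (\<Sum>i\<le>j. (j div ?Q ^ i mod ?Q) * 1)] (mod (q - 1))"
    by (intro cong_sum cong_mult cong_refl Q)
  have 3: "(\<Sum>i\<le>j. (j div ?Q ^ i mod ?Q) * ?Q ^ i) = j"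
  proof -
    have "1 < ?Q" using assms by (intro one_less_power)
    then have "Suc j < ?Q ^ Suc j" by (intro power_gt_expt) simp
    then have "j mod ?Q ^ Suc j = j" by (intro mod_less) linarith
    then show ?thesis
      using sum_digits[where x = j and b = ?Q and n = "Suc j"] by (simp only: lessThan_Suc_atMost)
  qed
  show ?thesis
    using cong_dvd_iff[OF cong_trans[OF 1 cong_sym[OF 2]]] assms(3) by (simp only: 3)
qed

section \<open>The von Staudt theorem for Bernoulli-Carlitz numbers\<close>

text \<open>
  Beyond the coefficient \<open>n\<close> the series may be changed freely, so \<open>F\<close> can be split into a polynomial \<open>S\<close>
  and a multiple of \<open>X^(n + 1)\<close>; then additivity of the power map for finite sums is enough.
\<close>

lemma fps_power_card_nth:
  fixes F :: "'c::field fps"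
  assumes "CHAR('c) = CHAR('a::{finite,field})"
  shows "fps_nth (F ^ (CARD('a) ^ i)) n =
    (if CARD('a) ^ i dvd n then fps_nth F (n div CARD('a) ^ i) ^ (CARD('a) ^ i) else 0)"
proof -
  define Q where "Q = CARD('a) ^ i"
  have Q: "0 < Q" by (simp add: Q_def)
  define S where "S = (\<Sum>k\<le>n. fps_const (fps_nth F k) * fps_X ^ k)"
  define G where "G = fps_shift (Suc n) (F - S)"
  have S_nth: "fps_nth S m = fps_nth F m" if "m \<le> n" for m
    using that by (simp add: S_def fps_sum_nth fps_X_power_nth if_distrib cong: if_cong)
  have "F - S = G * fps_X ^ Suc n"
    by (rule fps_ext) (simp add: G_def fps_X_power_mult_right_nth S_nth del: power_Suc)
  then have F: "F = S + G * fps_X ^ Suc n" by (simp add: algebra_simps)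
  have char: "CHAR('c fps) = CHAR('a)" using assms by simp
  have "F ^ Q = S ^ Q + (G * fps_X ^ Suc n) ^ Q"
    unfolding Q_def by (subst F) (rule frobenius_add[OF char])
  also have "(G * fps_X ^ Suc n) ^ Q = G ^ Q * fps_X ^ (Suc n * Q)"
    by (simp only: power_mult_distrib power_mult)
  also have "S ^ Q = (\<Sum>k\<le>n. fps_const (fps_nth F k ^ Q) * fps_X ^ (k * Q))"
    unfolding S_def Q_def frobenius_sum[OF char]
    by (simp only: power_mult_distrib power_mult fps_const_power)
  finally have FQ: "F ^ Q = (\<Sum>k\<le>n. fps_const (fps_nth F k ^ Q) * fps_X ^ (k * Q)) + G ^ Q * fps_X ^ (Suc n * Q)" .
  have "n < Suc n * Q" using Q by (cases Q) auto
  then have "fps_nth (F ^ Q) n = (\<Sum>k\<le>n. if n = k * Q then fps_nth F k ^ Q else 0)"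
    by (simp add: FQ fps_sum_nth fps_X_power_mult_right_nth if_distrib cong: if_cong)
  also have "\<dots> = (if Q dvd n then fps_nth F (n div Q) ^ Q else 0)"
  proof (cases "Q dvd n")
    case True
    then obtain k where k: "n = k * Q" by (metis dvdE mult.commute)
    have "k \<le> n" using k Q by simp
    have "(\<Sum>l\<le>n. if n = l * Q then fps_nth F l ^ Q else 0) = (\<Sum>l\<le>n. if l = k then fps_nth F l ^ Q else 0)"
      by (rule sum.cong) (use k Q in auto)
    then show ?thesis using \<open>k \<le> n\<close> k Q by simp
  next
    case False
    then have "n \<noteq> k * Q" for k by auto
    then show ?thesis using False by simp
  qed
  finally show ?thesis by (simp add: Q_def)
qed

text \<open>
  The algebra of the exponential only uses that \<open>A\<close> is embedded in a field; no topology enters before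
  the zeta values do.
\<close>

locale embedding =
  fixes \<phi> :: "'a::{finite,field} poly \<Rightarrow> 'c::field"
  assumes hom_1: "\<phi> 1 = 1"
    and hom_add: "\<phi> (u + v) = \<phi> u + \<phi> v"
    and hom_mult: "\<phi> (u * v) = \<phi> u * \<phi> v"
    and inj: "\<phi> u = 0 \<Longrightarrow> u = 0"
begin

lemma hom_0: "\<phi> 0 = 0"
  by (metis hom_add add_0_left add_cancel_right_right)

lemma hom_eq_0_iff: "\<phi> u = 0 \<longleftrightarrow> u = 0"
  using inj hom_0 by auto

lemma hom_uminus: "\<phi> (- u) = - \<phi> u"
  using hom_add[of u "- u"] hom_0 by (simp add: eq_neg_iff_add_eq_0 add.commute)

lemma hom_diff: "\<phi> (u - v) = \<phi> u - \<phi> v"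
  using hom_add[of u "- v"] by (simp add: hom_uminus)

lemma hom_eq_iff: "\<phi> u = \<phi> v \<longleftrightarrow> u = v"
  using hom_eq_0_iff[of "u - v"] by (simp add: hom_diff)

lemma hom_power: "\<phi> (u ^ n) = \<phi> u ^ n"
  by (induction n) (simp_all add: hom_1 hom_mult)

lemma hom_sum: "\<phi> (sum g A) = (\<Sum>x\<in>A. \<phi> (g x))"
  by (induction A rule: infinite_finite_induct) (simp_all add: hom_0 hom_add)

lemma hom_of_nat: "\<phi> (of_nat n) = of_nat n"
  by (induction n) (simp_all add: hom_0 hom_1 hom_add)

lemma char_eq: "CHAR('c) = CHAR('a)"
proof (rule dvd_antisym)
  have iff: "of_nat n = (0 :: 'c) \<longleftrightarrow> of_nat n = (0 :: 'a poly)" for n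
    using hom_eq_0_iff[of "of_nat n"] by (simp add: hom_of_nat)
  show "CHAR('c) dvd CHAR('a)"
    using iff[of "CHAR('a)"] of_nat_eq_0_iff_char_dvd[where 'a = "'a poly"]
      of_nat_eq_0_iff_char_dvd[where 'a = 'c] by simp
  show "CHAR('a) dvd CHAR('c)"
    using iff[of "CHAR('c)"] of_nat_eq_0_iff_char_dvd[where 'a = "'a poly"]
      of_nat_eq_0_iff_char_dvd[where 'a = 'c] by simp
qed

abbreviation "\<theta> \<equiv> \<phi> [:0, 1:]"

lemma q_ge_2: "2 \<le> CARD('a)" by (rule two_le_card_field)

lemma theta_power_neq:
  assumes "n \<noteq> 1" shows "\<theta> ^ n \<noteq> \<theta>"
proof
  assume "\<theta> ^ n = \<theta>"
  then have "[:0, 1:] ^ n = [:0, 1 :: 'a:] ^ 1" by (simp flip: hom_power add: hom_eq_iff)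
  then have "Polynomial.monom (1::'a) n = Polynomial.monom 1 1" by (simp add: monom_altdef)
  then show False using assms by (metis degree_monom_eq one_neq_zero)
qed

lemma hom_bracket_T: "\<phi> (bracket_T l) = \<theta> ^ (CARD('a) ^ l) - \<theta>"
  by (simp add: bracket_def hom_diff hom_power)

end

locale carlitz_exp = embedding \<phi> for \<phi> :: "'a::{finite,field} poly \<Rightarrow> 'c::field" +
  fixes e :: "'c fps"
  assumes exp_nth_0: "fps_nth e 0 = 0"
    and exp_nth_1: "fps_nth e 1 = 1"
    and functional_equation:
      "fps_compose e (fps_const \<theta> * fps_X) = fps_const \<theta> * e + e ^ CARD('a)"
begin

lemma exp_nth_recursion: "(\<theta> ^ n - \<theta>) * fps_nth e n = fps_nth (e ^ CARD('a)) n"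
  using arg_cong[OF functional_equation, of "\<lambda>F. fps_nth F n"]
  unfolding fps_compose_linear by (simp add: algebra_simps)

text \<open>
  Comparing coefficients in the functional equation gives \<open>D\<^bsub>i+1\<^esub> = [i + 1] D\<^sub>i^q\<close> for the inverses of the
  coefficients, where \<open>D\<^sub>i\<close> is the factorial of \<open>q^i\<close>.
\<close>

lemma exp_nth_power: "fps_nth e (CARD('a) ^ i) = 1 / \<phi> (factorial_T (CARD('a) ^ i))"
proof (induction i)
  case 0
  then show ?case using exp_nth_1 q_ge_2 by (simp add: factorial_T_def hom_1)
next
  case (Suc i)
  have D: "factorial_T (CARD('a) ^ Suc i) = bracket_T (Suc i) * (factorial_T (CARD('a) ^ i) :: 'a poly) ^ CARD('a)"
  proof -
    have "(\<Prod>l\<in>{1..i}. (bracket_T l :: 'a poly) ^ CARD('a) ^ (i - l)) ^ CARD('a) = (\<Prod>l\<in>{1..i}. bracket_T l ^ CARD('a) ^ (Suc i - l))"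
      unfolding prod_power_distrib
      by (rule prod.cong) (auto simp: Suc_diff_le mult.commute simp flip: power_mult)
    then show ?thesis unfolding carlitz_D_T[symmetric] carlitz_D_def by (simp add: mult.commute)
  qed
  have "1 < CARD('a) ^ Suc i" using q_ge_2 by (intro one_less_power) auto
  then have ne: "\<theta> ^ (CARD('a) ^ Suc i) - \<theta> \<noteq> 0"
    using theta_power_neq[of "CARD('a) ^ Suc i"] by (metis less_irrefl right_minus_eq)
  have "fps_nth (e ^ (CARD('a) ^ 1)) (CARD('a) ^ Suc i) = fps_nth e (CARD('a) ^ i) ^ CARD('a)"
    unfolding fps_power_card_nth[OF char_eq] by simp
  then have "(\<theta> ^ (CARD('a) ^ Suc i) - \<theta>) * fps_nth e (CARD('a) ^ Suc i) = fps_nth e (CARD('a) ^ i) ^ CARD('a)"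
    using exp_nth_recursion[of "CARD('a) ^ Suc i"] by simp
  moreover have "\<phi> (factorial_T (CARD('a) ^ i)) \<noteq> 0" by (simp add: hom_eq_0_iff factorial_T_nonzero)
  ultimately show ?case
    using ne unfolding D hom_mult hom_power hom_bracket_T Suc
    by (simp add: power_divide field_simps del: power_Suc)
qed

lemma exp_nth_nonpower:
  assumes "\<And>i. n \<noteq> CARD('a) ^ i"
  shows "fps_nth e n = 0"
  using assms
proof (induction n rule: less_induct)
  case (less n)
  show ?case
  proof (cases "n = 0")
    case False
    have "n \<noteq> 1" using less.prems[of 0] by simp
    have "fps_nth (e ^ (CARD('a) ^ 1)) n = 0"
    proof (cases "CARD('a) dvd n")
      case True
      then obtain k where k: "n = CARD('a) * k" by (elim dvdE)
      have "2 * k \<le> CARD('a) * k" using q_ge_2 by (rule mult_right_mono) simp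
      then have "k < n" using k False by (cases "k = 0") auto
      moreover have "k \<noteq> CARD('a) ^ i" for i using less.prems[of "Suc i"] k by auto
      ultimately have "fps_nth e k = 0" by (rule less.IH)
      then show ?thesis unfolding fps_power_card_nth[OF char_eq] using k by simp
    qed (use fps_power_card_nth[OF char_eq, of e 1 n] in simp)
    then show ?thesis
      using exp_nth_recursion[of n] theta_power_neq[OF \<open>n \<noteq> 1\<close>] by simp
  qed (simp add: exp_nth_0)
qed

lemma hom_exp_power_coeff: "\<phi> (exp_power_coeff k m) = \<phi> (factorial_T m) * fps_nth (e ^ k) m"
proof (induction k arbitrary: m)
  case 0
  show ?case by (simp add: factorial_T_def hom_0 hom_1)
next
  case (Suc k)
  have inj: "inj_on (\<lambda>s. CARD('a) ^ s) {s. CARD('a) ^ s \<le> m}"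
    using q_ge_2 by (auto simp: inj_on_def)
  have "fps_nth (e ^ Suc k) m = (\<Sum>i=0..m. fps_nth e i * fps_nth (e ^ k) (m - i))"
    by (simp add: fps_mult_nth)
  also have "\<dots> = (\<Sum>i\<in>(\<lambda>s. CARD('a) ^ s) ` {s. CARD('a) ^ s \<le> m}. fps_nth e i * fps_nth (e ^ k) (m - i))"
    by (rule sum.mono_neutral_right) (auto intro!: exp_nth_nonpower)
  also have "\<dots> = (\<Sum>s | CARD('a) ^ s \<le> m. fps_nth e (CARD('a) ^ s) * fps_nth (e ^ k) (m - CARD('a) ^ s))"
    by (simp add: sum.reindex[OF inj])
  finally have nth: "fps_nth (e ^ Suc k) m = (\<Sum>s | CARD('a) ^ s \<le> m. fps_nth e (CARD('a) ^ s) * fps_nth (e ^ k) (m - CARD('a) ^ s))" .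
  show ?case
    unfolding exp_power_coeff.simps hom_sum nth sum_distrib_left
  proof (rule sum.cong)
    fix s assume "s \<in> {s. CARD('a) ^ s \<le> m}"
    then have m: "factorial_T m = factorial_binomial (m - CARD('a) ^ s) (CARD('a) ^ s) * factorial_T (m - CARD('a) ^ s) * (factorial_T (CARD('a) ^ s) :: 'a poly)"
      using factorial_T_add[of "m - CARD('a) ^ s" "CARD('a) ^ s", where 'a = 'a] by simp
    have "\<phi> (factorial_T (CARD('a) ^ s)) \<noteq> 0" by (simp add: hom_eq_0_iff factorial_T_nonzero)
    then show "\<phi> (factorial_binomial (m - CARD('a) ^ s) (CARD('a) ^ s) * exp_power_coeff k (m - CARD('a) ^ s)) =
        \<phi> (factorial_T m) * (fps_nth e (CARD('a) ^ s) * fps_nth (e ^ k) (m - CARD('a) ^ s))"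
      by (simp add: m hom_mult Suc exp_nth_power)
  qed simp
qed

text \<open>
  The analogue of the classical Hurwitz series (integral coefficients against \<open>z^m/m!\<close>).
\<close>

definition hurwitz :: "'c fps \<Rightarrow> bool" where
  "hurwitz F \<longleftrightarrow> (\<forall>m. \<exists>a. \<phi> a = \<phi> (factorial_T m) * fps_nth F m)"

lemma hurwitz_mult:
  assumes "hurwitz F" "hurwitz G"
  shows "hurwitz (F * G)"
proof -
  obtain a b where a: "\<And>m. \<phi> (a m) = \<phi> (factorial_T m) * fps_nth F m"
    and b: "\<And>m. \<phi> (b m) = \<phi> (factorial_T m) * fps_nth G m"
    using assms unfolding hurwitz_def by metis
  show ?thesis
    unfolding hurwitz_def
  proof
    fix m
    have "\<phi> (\<Sum>i=0..m. factorial_binomial i (m - i) * a i * b (m - i)) = \<phi> (factorial_T m) * fps_nth (F * G) m"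
      unfolding hom_sum fps_mult_nth sum_distrib_left
    proof (rule sum.cong)
      fix i assume "i \<in> {0..m}"
      then have m: "factorial_T m = factorial_binomial i (m - i) * factorial_T i * (factorial_T (m - i) :: 'a poly)"
        using factorial_T_add[of i "m - i", where 'a = 'a] by simp
      show "\<phi> (factorial_binomial i (m - i) * a i * b (m - i)) = \<phi> (factorial_T m) * (fps_nth F i * fps_nth G (m - i))"
        by (simp add: m hom_mult a b)
    qed simp
    then show "\<exists>c. \<phi> c = \<phi> (factorial_T m) * fps_nth (F * G) m" by blast
  qed
qed

lemma hurwitz_exp_power: "hurwitz (e ^ k)"
  unfolding hurwitz_def using hom_exp_power_coeff by blast

lemma hurwitz_power: "hurwitz F \<Longrightarrow> hurwitz (F ^ k)"
proof (induction k)
  case 0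
  show ?case using hurwitz_exp_power[of 0] by simp
qed (simp add: hurwitz_mult)

definition L :: "nat \<Rightarrow> 'a poly" where
  "L i = (\<Prod>l\<in>{1..i}. bracket_T l)"

lemma L_Suc: "L (Suc i) = L i * bracket_T (Suc i)"
  by (simp add: L_def)

lemma L_nonzero: "\<phi> (L i) \<noteq> 0"
  by (simp add: L_def hom_eq_0_iff bracket_T_nonzero)

text \<open>
  The coefficients of the Carlitz logarithm, the compositional inverse of \<open>e\<close>.
\<close>

definition log_coeff :: "nat \<Rightarrow> 'c" where
  "log_coeff i = (- 1) ^ i / \<phi> (L i)"

lemma log_coeff_Suc: "log_coeff (Suc i) * (\<theta> ^ (CARD('a) ^ Suc i) - \<theta>) = - log_coeff i"
proof -
  define b where "b = \<theta> ^ (CARD('a) ^ Suc i) - \<theta>"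
  have "\<phi> (L (Suc i)) = \<phi> (L i) * b"
    unfolding L_Suc hom_mult hom_bracket_T b_def ..
  then show ?thesis
    using L_nonzero[of "Suc i"] unfolding b_def[symmetric] by (simp add: log_coeff_def)
qed

text \<open>
  The partial sums of the logarithm of \<open>e\<close> satisfy \<open>g(Tz) = T g(z)\<close> up to one term of high order,
  because the functional equation makes the sum telescope. As \<open>T^n \<noteq> T\<close> for \<open>n \<noteq> 1\<close>, this leaves only
  the linear coefficient (\<open>log_partial_sum_nth\<close>).
\<close>

lemma log_partial_sum_compose:
  "fps_compose (\<Sum>i\<le>N. fps_const (log_coeff i) * e ^ (CARD('a) ^ i)) (fps_const \<theta> * fps_X) =
   fps_const \<theta> * (\<Sum>i\<le>N. fps_const (log_coeff i) * e ^ (CARD('a) ^ i)) + fps_const (log_coeff N) * e ^ (CARD('a) ^ Suc N)"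
proof (induction N)
  case 0
  show ?case using functional_equation by (simp add: log_coeff_def L_def hom_1)
next
  case (Suc N)
  have char: "CHAR('c fps) = CHAR('a)" using char_eq by simp
  have "fps_compose (e ^ (CARD('a) ^ Suc N)) (fps_const \<theta> * fps_X) = (fps_const \<theta> * e + e ^ CARD('a)) ^ (CARD('a) ^ Suc N)"
    using functional_equation by (simp flip: fps_compose_power)
  also have "\<dots> = fps_const (\<theta> ^ (CARD('a) ^ Suc N)) * e ^ (CARD('a) ^ Suc N) + e ^ (CARD('a) ^ Suc (Suc N))"
    unfolding frobenius_add[OF char] power_mult_distrib fps_const_power by (simp flip: power_mult)
  finally have c: "fps_compose (e ^ (CARD('a) ^ Suc N)) (fps_const \<theta> * fps_X) =
      fps_const (\<theta> ^ (CARD('a) ^ Suc N)) * e ^ (CARD('a) ^ Suc N) + e ^ (CARD('a) ^ Suc (Suc N))" .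
  define E where "E = e ^ (CARD('a) ^ Suc N)"
  define E' where "E' = e ^ (CARD('a) ^ Suc (Suc N))"
  define S where "S = (\<Sum>i\<le>N. fps_const (log_coeff i) * e ^ (CARD('a) ^ i))"
  have IH: "fps_compose S (fps_const \<theta> * fps_X) = fps_const \<theta> * S + fps_const (log_coeff N) * E"
    using Suc by (simp only: S_def E_def)
  have "fps_compose (S + fps_const (log_coeff (Suc N)) * E) (fps_const \<theta> * fps_X) =
      fps_const \<theta> * S + fps_const (log_coeff N) * E +
      fps_const (log_coeff (Suc N)) * (fps_const (\<theta> ^ (CARD('a) ^ Suc N)) * E + E')"
    by (simp add: fps_compose_add_distrib fps_compose_mult_distrib IH c[folded E_def E'_def] del: power_Suc)
  also have "\<dots> = fps_const \<theta> * (S + fps_const (log_coeff (Suc N)) * E) + fps_const (log_coeff (Suc N)) * E'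
      + fps_const (log_coeff N + log_coeff (Suc N) * (\<theta> ^ (CARD('a) ^ Suc N) - \<theta>)) * E"
    by (simp add: algebra_simps fps_const_add[symmetric] fps_const_mult[symmetric] fps_const_sub[symmetric]
        del: fps_const_add fps_const_mult fps_const_sub power_Suc)
  also have "\<dots> = fps_const \<theta> * (S + fps_const (log_coeff (Suc N)) * E) + fps_const (log_coeff (Suc N)) * E'"
    unfolding log_coeff_Suc by simp
  finally show ?case by (simp only: sum.atMost_Suc S_def E_def E'_def)
qed

lemma exp_power_nth_eq_0:
  assumes "n < CARD('a) ^ i"
  shows "fps_nth (e ^ (CARD('a) ^ i)) n = 0"
  unfolding fps_power_card_nth[OF char_eq]
  using assms exp_nth_0 by (auto simp: nat_dvd_not_less)

lemma log_partial_sum_nth: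
  assumes "n < CARD('a) ^ Suc N"
  shows "fps_nth (\<Sum>i\<le>N. fps_const (log_coeff i) * e ^ (CARD('a) ^ i)) n = fps_nth fps_X n"
proof (cases "n = 1")
  case True
  have "fps_nth (e ^ (CARD('a) ^ i)) 1 = (if i = 0 then 1 else 0)" for i
    using q_ge_2 exp_nth_1 exp_power_nth_eq_0[of 1 i] one_less_power[of "CARD('a)" i] by auto
  then have "fps_nth (\<Sum>i\<le>N. fps_const (log_coeff i) * e ^ (CARD('a) ^ i)) 1 = (\<Sum>i\<le>N. if i = 0 then log_coeff 0 else 0)"
    unfolding fps_sum_nth fps_mult_left_const_nth by (intro sum.cong) auto
  then show ?thesis using True by (simp add: log_coeff_def L_def hom_1)
next
  case False
  have "(\<theta> ^ n - \<theta>) * fps_nth (\<Sum>i\<le>N. fps_const (log_coeff i) * e ^ (CARD('a) ^ i)) n = 0"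
    using arg_cong[OF log_partial_sum_compose[of N], of "\<lambda>F. fps_nth F n"] exp_power_nth_eq_0[OF assms]
    unfolding fps_compose_linear by (simp add: algebra_simps)
  then show ?thesis using theta_power_neq[OF False] False by simp
qed

text \<open>
  The expansion \<open>z/e = \<Sum>\<^sub>i (-1)^i e^(q^i - 1)/L\<^sub>i\<close>, cut off at an index \<open>N\<close> beyond which the terms have no
  influence on the coefficient in question.
\<close>

lemma reciprocal_nth:
  assumes g: "g * e = fps_X" and n: "Suc n < CARD('a) ^ Suc N"
  shows "fps_nth g n = (\<Sum>i\<le>N. log_coeff i * fps_nth (e ^ (CARD('a) ^ i - 1)) n)"
proof -
  define S where "S = (\<Sum>i\<le>N. fps_const (log_coeff i) * e ^ (CARD('a) ^ i - 1))"
  \<comment> \<open>\<open>R\<close> has order at least \<open>q^(N + 1)\<close>; multiplying \<open>(g - S) e = R\<close> by \<open>g\<close> replaces \<open>e\<close> by \<open>X\<close>.\<close>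
  define R where "R = fps_X - S * e"
  have "S * e = (\<Sum>i\<le>N. fps_const (log_coeff i) * e ^ (CARD('a) ^ i))"
    unfolding S_def sum_distrib_right
    by (rule sum.cong) (simp_all add: mult.assoc flip: power_Suc2)
  then have R: "fps_nth R m = 0" if "m < CARD('a) ^ Suc N" for m
    using log_partial_sum_nth[OF that] by (simp add: R_def)
  have "(g - S) * fps_X = R * g"
    using g by (simp add: R_def algebra_simps flip: g)
  then have "fps_nth ((g - S) * fps_X) (Suc n) = fps_nth (R * g) (Suc n)" by simp
  also have "\<dots> = (\<Sum>i=0..Suc n. fps_nth R i * fps_nth g (Suc n - i))" by (rule fps_mult_nth)
  also have "\<dots> = 0" by (rule sum.neutral) (use R n in auto)
  finally show ?thesis by (simp add: S_def fps_sum_nth)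
qed

end

locale carlitz_exp_place = carlitz_exp \<phi> e + place f \<alpha>
  for \<phi> :: "'a::{finite,field} poly \<Rightarrow> 'c::field" and e :: "'c fps"
    and f :: "'a poly" and \<alpha> :: "'a alg_closure"
begin

text \<open>
  The quotient of \<open>D\<^bsub>t+s\<^esub>\<close> by \<open>D\<^sub>t^(q^s)\<close> is a product over \<open>[l]\<close> with \<open>t < l \<le> t + s\<close>. An interval of length
  \<open>s \<ge> h\<close> contains a multiple of \<open>h\<close>, and \<open>f\<close> divides the corresponding \<open>[l]\<close>.
\<close>

lemma hurwitz_exp_power_card:
  assumes s: "h \<le> s"
  obtains G where "hurwitz G" "e ^ (CARD('a) ^ s) = fps_const (\<phi> f) * G"
proof -
  have f0: "\<phi> f \<noteq> 0" using prime by (auto simp: hom_eq_0_iff)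
  define G where "G = fps_const (1 / \<phi> f) * e ^ (CARD('a) ^ s)"
  have "\<exists>a. \<phi> a = \<phi> (factorial_T n) * fps_nth G n" for n
  proof (cases "\<exists>t. n = CARD('a) ^ (t + s)")
    case True
    then obtain t where t: "n = CARD('a) ^ (t + s)" by blast
    define l where "l = h * ((t + s) div h)"
    have "t + s = l + (t + s) mod h" "(t + s) mod h < h" "l \<le> t + s"
      using degree_pos by (simp_all add: l_def)
    then have l: "t < l" "l \<le> t + s" using s by linarith+
    have "f dvd bracket_T l" by (simp add: dvd_bracket_iff l_def)
    moreover have "bracket_T l dvd (\<Prod>l\<in>{Suc t..t + s}. bracket_T l ^ CARD('a) ^ (t + s - l) :: 'a poly)"
    proof (rule dvd_trans)
      show "bracket_T l dvd (bracket_T l :: 'a poly) ^ CARD('a) ^ (t + s - l)" by (simp add: dvd_power)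
      show "(bracket_T l :: 'a poly) ^ CARD('a) ^ (t + s - l) dvd
          (\<Prod>l\<in>{Suc t..t + s}. bracket_T l ^ CARD('a) ^ (t + s - l))"
        using l by (intro dvd_prodI) auto
    qed
    ultimately have "f dvd (\<Prod>l\<in>{Suc t..t + s}. bracket_T l ^ CARD('a) ^ (t + s - l))"
      by (rule dvd_trans)
    then obtain a where a: "(\<Prod>l\<in>{Suc t..t + s}. bracket_T l ^ CARD('a) ^ (t + s - l)) = f * a"
      by (elim dvdE)
    have "(\<Prod>l\<in>{1..t + s}. bracket_T l ^ CARD('a) ^ (t + s - l) :: 'a poly) =
        (\<Prod>l\<in>{1..t}. bracket_T l ^ CARD('a) ^ (t + s - l)) * (\<Prod>l\<in>{Suc t..t + s}. bracket_T l ^ CARD('a) ^ (t + s - l))"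
      by (subst prod.union_disjoint[symmetric]) (auto intro!: prod.cong)
    also have "(\<Prod>l\<in>{1..t}. (bracket_T l :: 'a poly) ^ CARD('a) ^ (t + s - l)) = (\<Prod>l\<in>{1..t}. bracket_T l ^ CARD('a) ^ (t - l)) ^ (CARD('a) ^ s)"
      unfolding prod_power_distrib by (rule prod.cong) (auto simp flip: power_mult power_add)
    finally have "factorial_T n = factorial_T (CARD('a) ^ t) ^ (CARD('a) ^ s) * (f * a)"
      unfolding t carlitz_D_T[symmetric] by (simp only: carlitz_D_def a)
    moreover have "fps_nth (e ^ (CARD('a) ^ s)) n = (1 / \<phi> (factorial_T (CARD('a) ^ t))) ^ (CARD('a) ^ s)"
      unfolding fps_power_card_nth[OF char_eq] t by (simp add: power_add exp_nth_power)
    ultimately have "\<phi> a = \<phi> (factorial_T n) * fps_nth G n"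
      using f0 by (simp add: G_def hom_mult hom_power power_divide hom_eq_0_iff factorial_T_nonzero)
    then show ?thesis by blast
  next
    case False
    have "fps_nth (e ^ (CARD('a) ^ s)) n = 0"
    proof (cases "CARD('a) ^ s dvd n")
      case True
      then obtain k where k: "n = CARD('a) ^ s * k" by (elim dvdE)
      have "k \<noteq> CARD('a) ^ i" for i using False k by (auto simp: power_add mult.commute)
      then have "fps_nth e k = 0" by (rule exp_nth_nonpower)
      then show ?thesis unfolding fps_power_card_nth[OF char_eq] k by simp
    qed (simp only: fps_power_card_nth[OF char_eq] if_False)
    then have "\<phi> 0 = \<phi> (factorial_T n) * fps_nth G n" by (simp add: G_def hom_0)
    then show ?thesis by blast
  qed
  then have "hurwitz G" by (simp add: hurwitz_def)
  moreover have "e ^ (CARD('a) ^ s) = fps_const (\<phi> f) * G"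
    using f0 by (simp add: G_def flip: mult.assoc)
  ultimately show ?thesis by (rule that)
qed

text \<open>
  From \<open>q^i - 1 = (q^h - 1) + (q - 1)(q^h + \<dots> + q^(i - 1))\<close>: each of the \<open>(q - 1)(i - h)\<close> factors
  \<open>e^(q^s)\<close> with \<open>h \<le> s < i\<close> contributes one \<open>f\<close>.
\<close>

lemma exp_power_coeff_dvd:
  assumes "h \<le> i"
  shows "f ^ ((CARD('a) - 1) * (i - h)) dvd exp_power_coeff (CARD('a) ^ i - 1) m"
proof -
  have "\<exists>G. hurwitz G \<and> e ^ (CARD('a) ^ i - 1) = fps_const (\<phi> f ^ ((CARD('a) - 1) * (i - h))) * G"
    using assms
  proof (induction i rule: dec_induct)
    case base
    show ?case using hurwitz_exp_power[of "CARD('a) ^ h - 1"] by auto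
  next
    case (step i)
    then obtain G where G: "hurwitz G" "e ^ (CARD('a) ^ i - 1) = fps_const (\<phi> f ^ ((CARD('a) - 1) * (i - h))) * G" by blast
    obtain G' where G': "hurwitz G'" "e ^ (CARD('a) ^ i) = fps_const (\<phi> f) * G'"
      using hurwitz_exp_power_card[OF step.hyps(1)] by blast
    have "1 \<le> CARD('a) ^ i" by simp
    then have "CARD('a) ^ Suc i - 1 = (CARD('a) ^ i - 1) + CARD('a) ^ i * (CARD('a) - 1)"
      using q_ge_2 by (simp add: algebra_simps)
    then have "e ^ (CARD('a) ^ Suc i - 1) = e ^ (CARD('a) ^ i - 1) * (e ^ (CARD('a) ^ i)) ^ (CARD('a) - 1)"
      by (simp only: power_add power_mult)
    also have "\<dots> = fps_const (\<phi> f ^ ((CARD('a) - 1) * (i - h)) * \<phi> f ^ (CARD('a) - 1)) * (G * G' ^ (CARD('a) - 1))"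
      unfolding G G' by (simp add: power_mult_distrib mult_ac fps_const_mult[symmetric] del: fps_const_mult)
    also have "\<phi> f ^ ((CARD('a) - 1) * (i - h)) * \<phi> f ^ (CARD('a) - 1) = \<phi> f ^ ((CARD('a) - 1) * (Suc i - h))"
      using step.hyps(1) by (simp add: Suc_diff_le flip: power_add) (simp add: add.commute)
    finally show ?case using hurwitz_mult[OF G(1) hurwitz_power[OF G'(1)]] by blast
  qed
  then obtain G where G: "hurwitz G" "e ^ (CARD('a) ^ i - 1) = fps_const (\<phi> f ^ ((CARD('a) - 1) * (i - h))) * G" by blast
  then obtain a where "\<phi> a = \<phi> (factorial_T m) * fps_nth G m" unfolding hurwitz_def by blast
  then have "\<phi> (exp_power_coeff (CARD('a) ^ i - 1) m) = \<phi> (f ^ ((CARD('a) - 1) * (i - h)) * a)"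
    unfolding hom_exp_power_coeff G(2) by (simp add: hom_mult hom_power)
  then show ?thesis by (simp add: hom_eq_iff)
qed

lemma L_factorization: "\<exists>w. L i = f ^ (i div h) * w \<and> \<not> f dvd w"
proof (induction i)
  case 0
  show ?case using prime by (auto simp: L_def prime_elem_def)
next
  case (Suc i)
  then obtain w where w: "L i = f ^ (i div h) * w" "\<not> f dvd w" by blast
  show ?case
  proof (cases "h dvd Suc i")
    case True
    then obtain u where u: "bracket_T (Suc i) = f * u" using dvd_bracket_iff by (metis dvdE)
    have "\<not> f dvd u"
      using square_not_dvd_bracket[of "Suc i"] unfolding u power2_eq_square
      by (auto simp: mult_dvd_mono)
    then have "\<not> f dvd w * u" using w(2) prime by (simp add: prime_elem_dvd_mult_iff)
    moreover have "Suc i div h = Suc (i div h)" using True by (simp add: div_Suc dvd_eq_mod_eq_0)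
    ultimately have "L (Suc i) = f ^ (Suc i div h) * (w * u) \<and> \<not> f dvd w * u"
      by (simp add: L_Suc w(1) u mult_ac)
    then show ?thesis by blast
  next
    case False
    then have "\<not> f dvd bracket_T (Suc i)" by (simp add: dvd_bracket_iff)
    then have "\<not> f dvd w * bracket_T (Suc i)" using w(2) prime by (simp add: prime_elem_dvd_mult_iff)
    moreover have "Suc i div h = i div h" using False by (simp add: div_Suc dvd_eq_mod_eq_0)
    ultimately have "L (Suc i) = f ^ (Suc i div h) * (w * bracket_T (Suc i)) \<and> \<not> f dvd w * bracket_T (Suc i)"
      by (simp add: L_Suc w(1) mult_ac)
    then show ?thesis by blast
  qed
qed

text \<open>
  The von Staudt theorem at \<open>f\<close>. The number \<open>W\<close> clears all denominators prime to \<open>f\<close>, so the statement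
  says that \<open>f\<close> times the Bernoulli-Carlitz number is integral at \<open>f\<close>, and that the number itself is so
  exactly when \<open>f\<close> divides \<open>H\<^sub>k(j)\<close> for \<open>k = q^h - 1\<close>.
\<close>

theorem bernoulli_carlitz_local:
  assumes g: "g * e = fps_X" and q: "2 < CARD('a)"
  obtains W V where "\<not> f dvd W" "\<phi> (f * W) * (\<phi> (factorial_T j) * fps_nth g j) = \<phi> V"
    "f dvd V \<longleftrightarrow> f dvd exp_power_coeff (CARD('a) ^ h - 1) j"
proof -
  define N where "N = j + h"
  obtain w where w: "\<And>i. L i = f ^ (i div h) * w i" "\<And>i. \<not> f dvd w i"
    using L_factorization by metis
  define W where "W = (\<Prod>i\<le>N. w i)"
  define W' where "W' = (\<lambda>i. \<Prod>k\<in>{..N} - {i}. w k)"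
  have W: "W = w i * W' i" if "i \<le> N" for i
    unfolding W_def W'_def by (rule prod.remove) (use that in auto)
  have prod: "\<not> f dvd prod w A" if "finite A" for A
    using that
  proof induction
    case empty
    show ?case using prime by (simp add: prime_elem_def)
  next
    case (insert i A)
    then show ?case using w(2)[of i] prime by (simp add: prime_elem_dvd_mult_iff)
  qed
  have W': "\<not> f dvd W' i" for i unfolding W'_def by (rule prod) simp
  let ?H = "\<lambda>i. exp_power_coeff (CARD('a) ^ i - 1) j :: 'a poly"
  \<comment> \<open>\<open>v\<close> is the \<open>i\<close>-th term of the expansion after multiplication by \<open>f W\<close>.\<close>
  define P where "P = (\<lambda>i v. L i * v = f * W * (- 1) ^ i * ?H i \<and>
      (i \<noteq> h \<longrightarrow> f dvd v) \<and> (i = h \<longrightarrow> v = W' i * (- 1) ^ i * ?H i))"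
  have "\<exists>v. P i v" if i: "i \<le> N" for i
  proof -
    consider "i < h" | "i = h" | "h < i" by linarith
    then show ?thesis
    proof cases
      case 1
      then show ?thesis
        by (intro exI[of _ "f * W' i * (- 1) ^ i * ?H i"]) (simp add: P_def w(1)[of i] W[OF i] mult_ac)
    next
      case 2
      then show ?thesis
        using degree_pos i W[of h] w(1)[of h]
        by (intro exI[of _ "W' i * (- 1) ^ i * ?H i"]) (simp add: P_def mult_ac)
    next
      case 3
      obtain k where k: "i = h + k" "0 < k" using 3 less_imp_add_positive by blast
      have "i div h \<le> Suc (k div h)" using degree_pos k by simp
      also have "\<dots> \<le> Suc k" by (simp add: div_le_dividend)
      also have "\<dots> \<le> 2 * k" using k by simp
      \<comment> \<open>Here \<open>q > 2\<close> is essential: for \<open>q = 2\<close> and \<open>h = 1\<close> the exponent \<open>i - 1\<close> is too small.\<close>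
      also have "\<dots> \<le> (CARD('a) - 1) * (i - h)" using q k by simp
      finally have "f ^ (i div h) dvd ?H i"
        using exp_power_coeff_dvd[of i j] 3 by (meson dvd_trans le_imp_power_dvd less_imp_le)
      then obtain a where "?H i = f ^ (i div h) * a" by (elim dvdE)
      then show ?thesis
        using 3 by (intro exI[of _ "f * W' i * (- 1) ^ i * a"]) (simp add: P_def w(1)[of i] W[OF i] mult_ac)
    qed
  qed
  then have "\<forall>i\<in>{..N}. \<exists>v. P i v" by simp
  from bchoice[OF this] obtain v where "\<forall>i\<in>{..N}. P i (v i)" by blast
  then have v: "L i * v i = f * W * (- 1) ^ i * ?H i" "i \<noteq> h \<Longrightarrow> f dvd v i"
      "i = h \<Longrightarrow> v i = W' i * (- 1) ^ i * ?H i" if "i \<le> N" for i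
    using that unfolding P_def by blast+
  have "Suc j < CARD('a) ^ Suc N"
    using less_card_power[of "Suc N", where 'a = 'a] by (simp add: N_def)
  then have "\<phi> (f * W) * (\<phi> (factorial_T j) * fps_nth g j) =
      (\<Sum>i\<le>N. \<phi> (f * W) * log_coeff i * \<phi> (?H i))"
    by (simp add: reciprocal_nth[OF g] sum_distrib_left hom_exp_power_coeff mult_ac)
  also have "\<dots> = (\<Sum>i\<le>N. \<phi> (v i))"
  proof (rule sum.cong)
    fix i assume "i \<in> {..N}"
    then have "\<phi> (L i) * \<phi> (v i) = \<phi> (f * W) * (- 1) ^ i * \<phi> (?H i)"
      using arg_cong[OF v(1), of i \<phi>] by (simp add: hom_mult hom_power hom_uminus hom_1)
    then show "\<phi> (f * W) * log_coeff i * \<phi> (?H i) = \<phi> (v i)"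
      using L_nonzero[of i] by (simp add: log_coeff_def field_simps)
  qed simp
  also have "\<dots> = \<phi> (\<Sum>i\<le>N. v i)" by (simp add: hom_sum)
  finally have eq: "\<phi> (f * W) * (\<phi> (factorial_T j) * fps_nth g j) = \<phi> (\<Sum>i\<le>N. v i)" .
  have "h \<le> N" by (simp add: N_def)
  then have "(\<Sum>i\<le>N. v i) = v h + (\<Sum>i\<in>{..N} - {h}. v i)" by (intro sum.remove) auto
  moreover have "f dvd (\<Sum>i\<in>{..N} - {h}. v i)" by (rule dvd_sum) (use v(2) in auto)
  ultimately have "f dvd (\<Sum>i\<le>N. v i) \<longleftrightarrow> f dvd v h" by (simp add: dvd_add_left_iff)
  also have "\<dots> \<longleftrightarrow> f dvd ?H h"
  proof -
    have "\<not> f dvd (- 1) ^ h"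
    proof
      assume "f dvd (- 1) ^ h"
      then have "is_unit f" by (rule dvd_unit_imp_unit) (simp add: is_unit_power_iff)
      then show False using prime by (simp add: prime_elem_def)
    qed
    then show ?thesis using v(3)[OF \<open>h \<le> N\<close> refl] W' prime by (simp add: prime_elem_dvd_mult_iff)
  qed
  finally show ?thesis
    using that[of W "\<Sum>i\<le>N. v i"] eq prod[of "{..N}"] by (simp add: W_def)
qed

end

section \<open>The field \<open>C\<^sub>\<infinity>\<close> and the zeta values\<close>

lemma poly_to_fls_add: "poly_to_fls (f + g) = poly_to_fls f + poly_to_fls g"
  unfolding poly_to_fls_def by (rule poly_map_hom_add) (simp_all add: fls_plus_const)

lemma poly_to_fls_mult: "poly_to_fls (f * g) = poly_to_fls f * poly_to_fls g"
  unfolding poly_to_fls_def by (rule poly_map_hom_mult) (simp_all add: fls_plus_const fls_const_mult_const)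

lemma poly_to_fls_0 [simp]: "poly_to_fls 0 = 0"
  by (simp add: poly_to_fls_def)

lemma poly_to_fls_1 [simp]: "poly_to_fls 1 = 1"
  by (simp add: poly_to_fls_def)

text \<open>
  In the variable \<open>1/T\<close> the coefficient of \<open>T^n\<close> sits at \<open>-n\<close>.
\<close>

lemma poly_to_fls_nth:
  "fls_nth (poly_to_fls g) n = (if n \<le> 0 then Polynomial.coeff g (nat (- n)) else 0)"
proof (induction g arbitrary: n)
  case (pCons c g)
  have "poly_to_fls (pCons c g) = fls_const c + fls_X_inv * poly_to_fls g"
    by (simp add: poly_to_fls_def map_poly_pCons)
  then have *: "fls_nth (poly_to_fls (pCons c g)) n = (if n = 0 then c else 0) + fls_nth (poly_to_fls g) (n + 1)"
    by (simp add: fls_X_inv_times_conv_shift)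
  consider "0 < n" | "n = 0" | "n < 0" by linarith
  then show ?case
  proof cases
    case 3
    then have "nat (- n) = Suc (nat (- (n + 1)))" by simp
    then show ?thesis using 3 by (simp only: * pCons.IH coeff_pCons_Suc) simp
  next
    case 2
    then show ?thesis using * by (simp add: pCons.IH)
  qed (simp add: * pCons.IH)
qed simp

lemma poly_to_fls_subdegree:
  assumes "g \<noteq> 0"
  shows "fls_subdegree (poly_to_fls g) = - int (Polynomial.degree g)"
  by (rule fls_subdegree_eqI) (use assms in \<open>auto simp: poly_to_fls_nth intro!: coeff_eq_0\<close>)

lemma poly_to_fls_eq_0_iff: "poly_to_fls g = 0 \<longleftrightarrow> g = 0"
proof
  assume "poly_to_fls g = 0"
  then have "Polynomial.coeff g (Polynomial.degree g) = 0"
    using poly_to_fls_nth[of g "- int (Polynomial.degree g)"] by simp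
  then show "g = 0" by simp
qed simp

lemma dist_fls_le:
  fixes a b :: "'a::group_add fls"
  assumes "\<And>k. k < int d \<Longrightarrow> fls_nth a k = fls_nth b k"
  shows "dist a b \<le> (1 / 2) ^ d"
proof (cases "a = b")
  case False
  have d: "int d \<le> fls_subdegree (a - b)"
    by (rule fls_subdegree_geI) (use assms False in auto)
  then have "dist a b = inverse (2 ^ nat (fls_subdegree (a - b)))"
    using False by (simp add: dist_fls_def)
  also have "\<dots> \<le> inverse (2 ^ d)"
    using d by (intro le_imp_inverse_le power_increasing) auto
  finally show ?thesis by (simp add: power_one_over inverse_eq_divide)
qed simp

definition monic_below :: "nat \<Rightarrow> 'a::field poly set" where
  "monic_below d = {f. Polynomial.lead_coeff f = 1} \<inter> polys_below d"

lemma finite_monic_below [simp]: "finite (monic_below d :: 'a::{finite,field} poly set)"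
  by (simp add: monic_below_def)

lemma inverse_poly_to_fls_nth:
  assumes "f \<noteq> 0" "k < int (j * Polynomial.degree f)"
  shows "fls_nth (inverse (poly_to_fls f ^ j)) k = 0"
proof (rule fls_eq0_below_subdegree)
  have "fls_subdegree (inverse (poly_to_fls f ^ j)) = int (j * Polynomial.degree f)"
    using assms(1) by (simp add: fls_subdegree_pow poly_to_fls_subdegree poly_to_fls_eq_0_iff fls_inverse_subdegree)
  then show "k < fls_subdegree (inverse (poly_to_fls f ^ j))" using assms(2) by simp
qed

text \<open>
  Only the finitely many \<open>f\<close> of degree at most \<open>n\<close> contribute to the coefficient \<open>n\<close>, so the sum can be
  written down coefficient by coefficient.
\<close>

lemma carlitz_zeta_approx:
  assumes "0 < j"
  shows "dist (\<Sum>f\<in>monic_below d. inverse (poly_to_fls f ^ j)) (carlitz_zeta j :: 'a::{finite,field} fls) \<le> (1 / 2) ^ d"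
proof -
  let ?M = "{f :: 'a poly. Polynomial.lead_coeff f = 1}"
  let ?t = "\<lambda>f :: 'a poly. inverse (poly_to_fls f ^ j)"
  have vanish: "fls_nth (?t f) k = 0" if "f \<in> ?M" "f \<notin> polys_below d" "k < int d" for f k d
  proof (rule inverse_poly_to_fls_nth)
    show "f \<noteq> 0" using that(1) by auto
    then have "d \<le> Polynomial.degree f" using that(2) by (simp add: polys_below_iff_degree)
    also have "\<dots> \<le> j * Polynomial.degree f" using assms by simp
    finally show "k < int (j * Polynomial.degree f)" using that(3) by linarith
  qed
  have stable: "fls_nth (\<Sum>f\<in>F. ?t f) k = fls_nth (\<Sum>f\<in>monic_below d. ?t f) k"
    if "finite F" "monic_below d \<subseteq> F" "F \<subseteq> ?M" "k < int d" for F k d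
    unfolding fls_nth_sum
  proof (rule sum.mono_neutral_right)
    show "\<forall>f\<in>F - monic_below d. fls_nth (?t f) k = 0"
      using vanish[of _ d k] that by (auto simp: monic_below_def)
  qed (use that in auto)
  define S where "S = fps_to_fls (Abs_fps (\<lambda>n. fls_nth (\<Sum>f\<in>monic_below (Suc n). ?t f) (int n)))"
  have mono: "monic_below d \<subseteq> monic_below d'" if "d \<le> d'" for d d'
    using that by (auto simp: monic_below_def polys_below_def)
  have approx: "dist (\<Sum>f\<in>F. ?t f) S \<le> (1 / 2) ^ d"
    if F: "finite F" "monic_below d \<subseteq> F" "F \<subseteq> ?M" for F d
  proof (rule dist_fls_le)
    fix k assume k: "k < int d"
    show "fls_nth (\<Sum>f\<in>F. ?t f) k = fls_nth S k"
    proof (cases "k < 0")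
      case True
      have "fls_nth (\<Sum>f\<in>F. ?t f) k = fls_nth (\<Sum>f\<in>monic_below 0. ?t f) k"
        by (rule stable) (use F True mono[of 0 d] in auto)
      also have "monic_below 0 = {}" by (auto simp: monic_below_def polys_below_0)
      finally show ?thesis using True by (simp add: S_def)
    next
      case False
      then have "fls_nth (\<Sum>f\<in>F. ?t f) k = fls_nth (\<Sum>f\<in>monic_below (Suc (nat k)). ?t f) k"
        using F k by (intro stable order_trans[OF mono F(2)]) auto
      then show ?thesis using False by (simp add: S_def)
    qed
  qed
  have "(?t has_sum S) ?M"
    unfolding has_sum_def
  proof (rule tendstoI)
    fix \<epsilon> :: real assume "0 < \<epsilon>"
    then obtain d where d: "(1 / 2) ^ d < \<epsilon>" using real_arch_pow_inv[of \<epsilon> "1 / 2"] by auto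
    have "\<forall>\<^sub>F F in finite_subsets_at_top ?M. finite F \<and> monic_below d \<subseteq> F \<and> F \<subseteq> ?M"
      unfolding eventually_finite_subsets_at_top
      by (rule exI[of _ "monic_below d"]) (auto simp: monic_below_def)
    then show "\<forall>\<^sub>F F in finite_subsets_at_top ?M. dist (sum ?t F) S < \<epsilon>"
    proof (rule eventually_mono)
      fix F assume "finite F \<and> monic_below d \<subseteq> F \<and> F \<subseteq> ?M"
      then show "dist (sum ?t F) S < \<epsilon>" using le_less_trans[OF approx[of F d] d] by simp
    qed
  qed
  then have "carlitz_zeta j = S" unfolding carlitz_zeta_def by (rule infsumI)
  then show ?thesis using approx[of "monic_below d" d] by (simp add: monic_below_def)
qed

context C_infinity
begin

text \<open>
  The type of \<open>C\<^sub>\<infinity>\<close> carries no normed structure, so the rules for limits of sums and products are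
  derived here from the ultrametric inequality and multiplicativity.
\<close>

abbreviation N :: "'c \<Rightarrow> real" where
  "N x \<equiv> dist x 0"

lemma N_1 [simp]: "N 1 = 1"
  using dist_mult[of 1 1] by simp

lemma N_power: "N (x ^ n) = N x ^ n"
  by (induction n) (simp_all add: dist_mult)

lemma N_minus [simp]: "N (- x) = N x"
proof -
  have "N (- 1) ^ 2 = 1" using N_power[of "- 1" 2] by simp
  then have "N (- 1) = 1" by (simp add: power2_eq_1_iff) (metis zero_le_dist neg_0_le_iff_le not_one_le_zero)
  then show ?thesis using dist_mult[of "- 1" x] by simp
qed

lemma N_inverse: "N (inverse x) = inverse (N x)"
proof (cases "x = 0")
  case False
  then have "N (inverse x) * N x = 1" by (simp flip: dist_mult)
  then show ?thesis using inverse_unique[of "N x" "N (inverse x)"] by (simp add: mult.commute)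
qed simp

lemma N_divide: "N (x / y) = N x / N y"
  by (simp add: divide_inverse dist_mult N_inverse)

lemma N_prod: "N (prod g A) = (\<Prod>x\<in>A. N (g x))"
  by (induction A rule: infinite_finite_induct) (simp_all add: dist_mult)

lemma N_add_le: "N (x + y) \<le> max (N x) (N y)"
  using ultrametric[of x "- y" 0] dist_diff[of x "- y"] dist_diff[of 0 "- y"] by (simp add: dist_commute)

lemma N_diff_le: "N (x - y) \<le> max (N x) (N y)"
  using N_add_le[of x "- y"] by simp

lemma N_diff_commute: "N (x - y) = N (y - x)"
  using N_minus[of "x - y"] by simp

lemma N_add_eq:
  assumes "N y < N x"
  shows "N (x + y) = N x"
  using N_add_le[of x y] N_diff_le[of "x + y" y] assms by simp

lemma N_sum_le:
  assumes "\<And>x. x \<in> A \<Longrightarrow> N (g x) \<le> b" "0 \<le> b"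
  shows "N (sum g A) \<le> b"
  using assms
proof (induction A rule: infinite_finite_induct)
  case (insert x A)
  have "N (sum g A) \<le> b" using insert by simp
  then have "max (N (g x)) (N (sum g A)) \<le> b" using insert.prems by simp
  then show ?case using insert.hyps order_trans[OF N_add_le[of "g x" "sum g A"]] by simp
qed simp_all

lemma tendsto_N_iff: "(Xs \<longlongrightarrow> l) F \<longleftrightarrow> ((\<lambda>x. N (Xs x - l)) \<longlongrightarrow> 0) F"
  using tendsto_dist_iff[of Xs l F] by (simp add: dist_diff[symmetric])

lemma tendsto_add_C:
  fixes Xs Ys :: "'i \<Rightarrow> 'c"
  assumes "(Xs \<longlongrightarrow> a) F" "(Ys \<longlongrightarrow> b) F"
  shows "((\<lambda>x. Xs x + Ys x) \<longlongrightarrow> a + b) F"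
  unfolding tendsto_N_iff
proof (rule tendsto_0_le[where K = 1])
  show "((\<lambda>x. N (Xs x - a) + N (Ys x - b)) \<longlongrightarrow> 0) F"
    using tendsto_add[of "\<lambda>x. N (Xs x - a)" 0 F "\<lambda>x. N (Ys x - b)" 0] assms by (simp add: tendsto_N_iff)
  have "N (Xs x + Ys x - (a + b)) \<le> N (Xs x - a) + N (Ys x - b)" for x
  proof -
    have "Xs x + Ys x - (a + b) = (Xs x - a) + (Ys x - b)" by simp
    then have "N (Xs x + Ys x - (a + b)) \<le> max (N (Xs x - a)) (N (Ys x - b))" by (metis N_add_le)
    then show ?thesis using zero_le_dist[of "Xs x - a" 0] zero_le_dist[of "Ys x - b" 0] by linarith
  qed
  then show "\<forall>\<^sub>F x in F. norm (N (Xs x + Ys x - (a + b))) \<le> norm (N (Xs x - a) + N (Ys x - b)) * 1"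
    by simp
qed

lemma tendsto_mult_C:
  fixes Xs Ys :: "'i \<Rightarrow> 'c"
  assumes "(Xs \<longlongrightarrow> a) F" "(Ys \<longlongrightarrow> b) F"
  shows "((\<lambda>x. Xs x * Ys x) \<longlongrightarrow> a * b) F"
  unfolding tendsto_N_iff
proof (rule tendsto_0_le[where K = 1])
  have "((\<lambda>x. N (Ys x)) \<longlongrightarrow> N b) F" by (rule tendsto_dist[OF assms(2) tendsto_const])
  moreover have "((\<lambda>x. N (Xs x - a)) \<longlongrightarrow> 0) F" "((\<lambda>x. N (Ys x - b)) \<longlongrightarrow> 0) F"
    using assms by (simp_all add: tendsto_N_iff)
  ultimately have "((\<lambda>x. N (Xs x - a) * N (Ys x) + N a * N (Ys x - b)) \<longlongrightarrow> 0 * N b + N a * 0) F"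
    by (intro tendsto_add tendsto_mult tendsto_const)
  then show "((\<lambda>x. N (Xs x - a) * N (Ys x) + N a * N (Ys x - b)) \<longlongrightarrow> 0) F" by simp
  have "N (Xs x * Ys x - a * b) \<le> N (Xs x - a) * N (Ys x) + N a * N (Ys x - b)" for x
  proof -
    have "Xs x * Ys x - a * b = (Xs x - a) * Ys x + a * (Ys x - b)" by (simp add: algebra_simps)
    then have "N (Xs x * Ys x - a * b) \<le> max (N ((Xs x - a) * Ys x)) (N (a * (Ys x - b)))" by (metis N_add_le)
    then show ?thesis
      using zero_le_dist[of "(Xs x - a) * Ys x" 0] zero_le_dist[of "a * (Ys x - b)" 0]
      unfolding dist_mult by linarith
  qed
  then show "\<forall>\<^sub>F x in F. norm (N (Xs x * Ys x - a * b)) \<le> norm (N (Xs x - a) * N (Ys x) + N a * N (Ys x - b)) * 1"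
    by simp
qed

lemma tendsto_power_C:
  fixes Xs :: "'i \<Rightarrow> 'c"
  shows "(Xs \<longlongrightarrow> a) F \<Longrightarrow> ((\<lambda>x. Xs x ^ n) \<longlongrightarrow> a ^ n) F"
  by (induction n) (simp_all add: tendsto_mult_C)

lemma tendsto_sum_C:
  fixes Xs :: "'j \<Rightarrow> 'i \<Rightarrow> 'c"
  assumes "\<And>i. i \<in> I \<Longrightarrow> (Xs i \<longlongrightarrow> a i) F"
  shows "((\<lambda>x. \<Sum>i\<in>I. Xs i x) \<longlongrightarrow> (\<Sum>i\<in>I. a i)) F"
  using assms by (induction I rule: infinite_finite_induct) (auto intro: tendsto_add_C)

lemma tendsto_diff_C:
  fixes Xs Ys :: "'i \<Rightarrow> 'c"
  assumes "(Xs \<longlongrightarrow> a) F" "(Ys \<longlongrightarrow> b) F"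
  shows "((\<lambda>x. Xs x - Ys x) \<longlongrightarrow> a - b) F"
  using tendsto_add_C[OF assms(1) tendsto_mult_C[OF tendsto_const assms(2), of "- 1"]] by simp

lemma geometric_limit:
  assumes r: "0 \<le> r" "r < 1" and step: "\<And>d. N (Xs (Suc d) - Xs d) \<le> r ^ d"
  obtains l where "\<And>d. N (Xs d - l) \<le> r ^ d" "Xs \<longlonglongrightarrow> l"
proof -
  have close: "N (Xs m - Xs d) \<le> r ^ d" if "d \<le> m" for m d
    using that
  proof (induction m rule: dec_induct)
    case base
    then show ?case using r by simp
  next
    case (step m)
    have "Xs (Suc m) - Xs d = (Xs (Suc m) - Xs m) + (Xs m - Xs d)" by simp
    then have "N (Xs (Suc m) - Xs d) \<le> max (N (Xs (Suc m) - Xs m)) (N (Xs m - Xs d))" by (metis N_add_le)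
    also have "\<dots> \<le> r ^ d"
      using assms(3)[of m] step.IH power_decreasing[OF step.hyps(1), of r] r by simp
    finally show ?case .
  qed
  then have close: "dist (Xs m) (Xs d) \<le> r ^ d" if "d \<le> m" for m d
    unfolding dist_diff[of "Xs m"] using that .
  have "Cauchy Xs"
  proof (rule metric_CauchyI)
    fix \<epsilon> :: real assume "0 < \<epsilon>"
    then obtain d where d: "r ^ d < \<epsilon>" using real_arch_pow_inv[of \<epsilon> r] r by auto
    have "dist (Xs m) (Xs n) < \<epsilon>" if "m \<ge> d" "n \<ge> d" for m n
    proof -
      have "dist (Xs m) (Xs n) \<le> max (dist (Xs m) (Xs d)) (dist (Xs d) (Xs n))" by (rule ultrametric)
      also have "\<dots> \<le> r ^ d"
        using close[OF that(1)] close[OF that(2)] by (simp add: dist_commute)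
      finally show ?thesis using d by simp
    qed
    then show "\<exists>M. \<forall>m\<ge>M. \<forall>n\<ge>M. dist (Xs m) (Xs n) < \<epsilon>" by blast
  qed
  then obtain l where l: "Xs \<longlonglongrightarrow> l" using Cauchy_convergent convergent_def by blast
  have "N (Xs d - l) \<le> r ^ d" for d
  proof -
    have "(\<lambda>m. dist (Xs m) (Xs d)) \<longlonglongrightarrow> dist l (Xs d)" by (intro tendsto_dist l tendsto_const)
    then have "dist l (Xs d) \<le> r ^ d"
      by (rule LIMSEQ_le_const2) (use close in auto)
    then show ?thesis unfolding dist_diff[of "Xs d" l, symmetric] by (simp add: dist_commute)
  qed
  then show ?thesis using l that by blast
qed

lemma kappa_0 [simp]: "\<kappa> 0 = 0"
  by (metis hom_add add_0_left add_cancel_right_right)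

lemma kappa_sum: "\<kappa> (sum g A) = (\<Sum>x\<in>A. \<kappa> (g x))"
  by (induction A rule: infinite_finite_induct) (simp_all add: hom_add)

lemma kappa_power: "\<kappa> (u ^ n) = \<kappa> u ^ n"
  by (induction n) (simp_all add: hom_one hom_mult)

lemma kappa_inverse: "\<kappa> (inverse u) = inverse (\<kappa> u)"
proof (cases "u = 0")
  case False
  then have "\<kappa> u * \<kappa> (inverse u) = 1" by (simp flip: hom_mult add: hom_one)
  then show ?thesis by (simp add: inverse_unique)
qed simp

lemma N_kappa: "N (\<kappa> (to_ac s)) = dist s 0"
  using isometry[of s 0] by simp

lemma of_A_1: "of_A \<kappa> 1 = 1"
  by (simp add: of_A_def hom_one)

lemma of_A_add: "of_A \<kappa> (f + g) = of_A \<kappa> f + of_A \<kappa> g"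
  by (simp add: of_A_def poly_to_fls_add hom_add)

lemma of_A_mult: "of_A \<kappa> (f * g) = of_A \<kappa> f * of_A \<kappa> g"
  by (simp add: of_A_def poly_to_fls_mult hom_mult)

lemma N_of_A: "g \<noteq> 0 \<Longrightarrow> N (of_A \<kappa> g) = 2 ^ Polynomial.degree g"
  by (simp add: of_A_def N_kappa dist_fls_def poly_to_fls_eq_0_iff poly_to_fls_subdegree)

lemma of_A_eq_0: "of_A \<kappa> g = 0 \<Longrightarrow> g = 0"
  using N_of_A[of g] by fastforce

sublocale A: embedding "of_A \<kappa>"
  by unfold_locales (simp_all add: of_A_1 of_A_add of_A_mult of_A_eq_0)

lemma zeta_limit:
  assumes "0 < j"
  shows "(\<lambda>d. \<Sum>f\<in>monic_below d. inverse (of_A \<kappa> f ^ j)) \<longlonglongrightarrow> \<kappa> (to_ac (carlitz_zeta j))"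
proof -
  have sum: "(\<Sum>f\<in>monic_below d. inverse (of_A \<kappa> f ^ j)) =
      \<kappa> (to_ac (\<Sum>f\<in>monic_below d. inverse (poly_to_fls f ^ j)))" for d
    by (simp add: to_ac_sum kappa_sum of_A_def kappa_inverse kappa_power)
  show ?thesis
    unfolding sum tendsto_dist_iff[of _ "\<kappa> _"] isometry
  proof (rule tendsto_0_le[where K = 1])
    show "(\<lambda>d. (1 / 2) ^ d :: real) \<longlonglongrightarrow> 0" by (rule LIMSEQ_realpow_zero) auto
  qed (simp add: carlitz_zeta_approx[OF assms])
qed

text \<open>
  In the \<open>p\<close>-adic integers \<open>1/(q - 1) = -(1 + q + q^2 + \<dots>)\<close>, and one-units admit \<open>p\<close>-adic exponents.
  Hence the root is the infinite product of the powers \<open>w^(-q^i)\<close>.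
\<close>

lemma root_of_one_unit:
  assumes w: "N (w - 1) < 1"
  shows "\<exists>y. y ^ (CARD('a) - 1) = w"
proof -
  let ?q = "CARD('a)"
  have Nw: "N w = 1" using N_add_eq[of "w - 1" 1] w by simp
  then have w0: "w \<noteq> 0" by auto
  define a where "a = inverse w"
  have a: "N a = 1" by (simp add: a_def N_inverse Nw)
  have "a - 1 = (1 - w) / w" using w0 by (simp add: a_def field_simps)
  then have a1: "N (a - 1) < 1" using w by (simp add: N_divide Nw N_diff_commute)
  define Xs where "Xs = (\<lambda>m. \<Prod>i<m. a ^ (?q ^ i))"
  have NX: "N (Xs m) = 1" for m by (simp add: Xs_def N_prod N_power a)
  have "N (Xs (Suc m) - Xs m) \<le> N (a - 1) ^ m" for m
  proof -
    have "Xs (Suc m) - Xs m = Xs m * (a - 1) ^ (?q ^ m)"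
      by (simp add: Xs_def frobenius_diff[OF A.char_eq] algebra_simps)
    then have "N (Xs (Suc m) - Xs m) = N (a - 1) ^ (?q ^ m)" by (simp add: dist_mult NX N_power)
    also have "\<dots> \<le> N (a - 1) ^ m"
      using a1 less_card_power[of m, where 'a = 'a] by (intro power_decreasing) auto
    finally show ?thesis .
  qed
  from geometric_limit[OF _ a1 this] obtain y where y: "Xs \<longlonglongrightarrow> y" by auto
  have "(\<lambda>m. N (Xs m)) \<longlonglongrightarrow> N y" by (rule tendsto_dist[OF y tendsto_const])
  then have "N y = 1" using LIMSEQ_const_iff[of "1 :: real" "N y"] by (simp add: NX)
  then have y0: "y \<noteq> 0" by auto
  have "Xs (Suc m) = a * Xs m ^ ?q" for m
    unfolding Xs_def prod.lessThan_Suc_shift prod_power_distrib by (simp add: mult.commute flip: power_mult)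
  then have "(\<lambda>m. Xs (Suc m)) \<longlonglongrightarrow> a * y ^ ?q"
    by (simp add: tendsto_mult_C tendsto_power_C y)
  then have "y = a * y ^ ?q" using LIMSEQ_Suc[OF y] LIMSEQ_unique by blast
  also have "\<dots> = a * y ^ (?q - 1) * y" by (simp add: mult.assoc flip: power_Suc2)
  finally have "y ^ (?q - 1) = w" using y0 w0 by (simp add: a_def field_simps)
  then show ?thesis ..
qed

text \<open>
  The dense subfield is algebraically closed; a root of a close approximation differs from the
  wanted one by a root of a one-unit.
\<close>

lemma root_exists: "\<exists>y. y ^ (CARD('a) - 1) = (x :: 'c)"
proof (cases "x = 0")
  case True
  then show ?thesis using two_le_card_field[where 'a = 'a] by (intro exI[of _ 0]) (simp add: power_0_left)
next
  case False
  have "x \<in> closure (range \<kappa>)" using dense by simp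
  moreover have "0 < N x" using False by simp
  ultimately obtain u where u: "dist (\<kappa> u) x < N x" unfolding closure_approachable by blast
  then have "N (\<kappa> u - x) < N x" by (simp flip: dist_diff)
  then have Nu: "N (\<kappa> u) = N x" using N_add_eq[of "\<kappa> u - x" x] by simp
  then have u0: "\<kappa> u \<noteq> 0" using False by auto
  have "x / \<kappa> u - 1 = (x - \<kappa> u) / \<kappa> u" using u0 by (simp add: field_simps)
  then have "N (x / \<kappa> u - 1) < 1"
    using \<open>N (\<kappa> u - x) < N x\<close> \<open>0 < N x\<close> by (simp add: N_divide Nu N_diff_commute[of x])
  then obtain y where y: "y ^ (CARD('a) - 1) = x / \<kappa> u" using root_of_one_unit by blast
  have q: "0 < CARD('a) - 1" using two_le_card_field[where 'a = 'a] by simp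
  have "0 < Polynomial.degree (Polynomial.monom 1 (CARD('a) - 1) - [:u:])"
  proof (rule ccontr)
    assume "\<not> ?thesis"
    then have "Polynomial.coeff (Polynomial.monom 1 (CARD('a) - 1) - [:u:]) (CARD('a) - 1) = 0"
      using q by (intro coeff_eq_0) simp
    then show False using q by (simp add: coeff_pCons split: nat.splits)
  qed
  then obtain z where "poly (Polynomial.monom 1 (CARD('a) - 1) - [:u:]) z = 0"
    using alg_closed_imp_poly_has_root by blast
  then have "z ^ (CARD('a) - 1) = u" by (simp add: poly_monom)
  then have "(y * \<kappa> z) ^ (CARD('a) - 1) = x"
    using y u0 by (simp add: power_mult_distrib flip: kappa_power)
  then show ?thesis ..
qed

end

section \<open>The product expansion of the exponential and the zeta values\<close>

text \<open>
  The polynomial with simple zeros at \<open>S\<close> (which is to contain \<open>0\<close>) and linear coefficient \<open>1\<close>.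
\<close>

definition root_poly :: "'c::field set \<Rightarrow> 'c poly" where
  "root_poly S = [:0, 1:] * (\<Prod>a\<in>S - {0}. [:1, - inverse a:])"

lemma poly_root_poly: "poly (root_poly S) z = z * (\<Prod>a\<in>S - {0}. 1 - z * inverse a)"
  by (simp add: root_poly_def poly_prod)

lemma poly_root_poly_eq_0_iff:
  assumes "finite S" "0 \<in> S"
  shows "poly (root_poly S) z = 0 \<longleftrightarrow> z \<in> S"
  using assms by (auto simp: poly_root_poly field_simps)

lemma degree_root_poly_le:
  assumes "finite S" "0 \<in> S"
  shows "Polynomial.degree (root_poly S) \<le> card S"
proof -
  have "Polynomial.degree (root_poly S) \<le> 1 + Polynomial.degree (\<Prod>a\<in>S - {0}. [:1, - inverse a:])"
    unfolding root_poly_def by (rule order_trans[OF degree_mult_le]) simp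
  also have "Polynomial.degree (\<Prod>a\<in>S - {0}. [:1, - inverse a:]) \<le> (\<Sum>a\<in>S - {0}. 1)"
    using assms by (intro order_trans[OF degree_prod_sum_le] sum_mono) auto
  also have "1 + (\<Sum>a\<in>S - {0}. 1) = card S"
    using assms by (simp add: card_gt_0_iff card_Diff_singleton) (metis Suc_pred card_gt_0_iff empty_iff)
  finally show ?thesis by simp
qed

lemma coeff_root_poly: "Polynomial.coeff (root_poly S) 0 = 0" "Polynomial.coeff (root_poly S) 1 = 1"
proof -
  have "Polynomial.coeff (\<Prod>a\<in>A. [:1, - inverse a:]) 0 = 1" for A :: "'a set"
    by (induction A rule: infinite_finite_induct) (simp_all add: coeff_mult)
  then show "Polynomial.coeff (root_poly S) 0 = 0" "Polynomial.coeff (root_poly S) 1 = 1"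
    by (simp_all add: root_poly_def)
qed

text \<open>
  The difference of two such polynomials has a double zero at \<open>0\<close> and hence too many zeros. Both
  recursions for the lattice polynomials below come from this.
\<close>

lemma poly_eq_by_roots:
  fixes p r :: "'c::field poly"
  assumes S: "finite S" "0 \<in> S"
    and deg: "Polynomial.degree p \<le> card S" "Polynomial.degree r \<le> card S"
    and roots: "\<And>x. x \<in> S \<Longrightarrow> poly p x = 0" "\<And>x. x \<in> S \<Longrightarrow> poly r x = 0"
    and c1: "Polynomial.coeff p 1 = Polynomial.coeff r 1"
  shows "p = r"
proof (rule ccontr)
  assume "p \<noteq> r"
  define u where "u = p - r"
  have u: "u \<noteq> 0" "Polynomial.coeff u 0 = 0" "Polynomial.coeff u 1 = 0"
    using \<open>p \<noteq> r\<close> roots[OF S(2)] c1 by (simp_all add: u_def flip: poly_0_coeff_0)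
  obtain v where v: "u = pCons 0 (pCons 0 v)"
  proof -
    obtain a s where s: "u = pCons a s" by (cases u) auto
    obtain b v where "s = pCons b v" by (cases s) auto
    with s u that show ?thesis by simp
  qed
  have "v \<noteq> 0" using u v by auto
  have "Suc (Suc (Polynomial.degree v)) = Polynomial.degree u" using \<open>v \<noteq> 0\<close> v by simp
  also have "\<dots> \<le> card S" unfolding u_def using deg by (rule degree_diff_le)
  finally have "Suc (Polynomial.degree v) \<le> card (S - {0})" using S by (simp add: card_Diff_singleton)
  also have "S - {0} \<subseteq> {x. poly v x = 0}"
  proof
    fix x assume x: "x \<in> S - {0}"
    then have "poly u x = 0" using roots by (simp add: u_def)
    then show "x \<in> {x. poly v x = 0}" using x v by simp
  qed
  then have "card (S - {0}) \<le> card {x. poly v x = 0}"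
    using poly_roots_finite[OF \<open>v \<noteq> 0\<close>] by (rule card_mono[rotated])
  also have "\<dots> \<le> Polynomial.degree v" by (rule card_poly_roots_bound) fact
  finally show False by simp
qed

text \<open>
  Partial fractions: the logarithmic derivative of \<open>P\<close> is the sum of \<open>1/(X - a)\<close> over the roots \<open>a\<close>, and
  it equals \<open>1/P\<close> if the derivative of \<open>P\<close> is \<open>1\<close>. Expand in geometric series.
\<close>

lemma reciprocal_root_poly:
  fixes S :: "'c::field set"
  assumes "finite S" and deriv: "pderiv (root_poly S) = 1"
  shows "Abs_fps (\<lambda>k. if k = 0 then 1 else - (\<Sum>a\<in>S - {0}. inverse a ^ k)) * fps_of_poly (root_poly S) = fps_X"
proof -
  let ?S = "S - {0}"
  \<comment> \<open>The power series of \<open>X/(X - a)\<close>.\<close>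
  define G where "G = (\<lambda>a :: 'c. Abs_fps (\<lambda>k. if k = 0 then 0 else - (inverse a ^ k)))"
  define P where "P = (\<lambda>A. fps_of_poly (\<Prod>a\<in>A. [:1, - inverse a:]) :: 'c fps)"
  have G: "G a * (1 - fps_const (inverse a) * fps_X) = - fps_const (inverse a) * fps_X" for a
  proof (rule fps_ext)
    fix n show "fps_nth (G a * (1 - fps_const (inverse a) * fps_X)) n = fps_nth (- fps_const (inverse a) * fps_X) n"
      by (cases n) (auto simp: G_def right_diff_distrib mult.assoc[symmetric] mult.commute[of _ "fps_const _"])
  qed
  have root: "fps_of_poly (root_poly S) = fps_X * P ?S"
    by (simp add: root_poly_def P_def fps_of_poly_mult)
  have step: "G a * P ?S = - fps_const (inverse a) * fps_X * P (?S - {a})" if a: "a \<in> ?S" for a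
  proof -
    have "P ?S = (1 - fps_const (inverse a) * fps_X) * P (?S - {a})"
      unfolding P_def using assms(1) a
      by (subst prod.remove[of _ a]) (simp_all add: fps_of_poly_mult fps_of_poly_linear')
    then show ?thesis using G[of a] by (metis mult.assoc)
  qed
  have "1 = fps_of_poly (pderiv (root_poly S))" by (simp add: deriv)
  also have "pderiv (root_poly S) = (\<Prod>a\<in>?S. [:1, - inverse a:]) +
      [:0, 1:] * (\<Sum>a\<in>?S. (\<Prod>b\<in>?S - {a}. [:1, - inverse b:]) * [:- inverse a:])"
    unfolding root_poly_def pderiv_mult pderiv_prod by (simp add: pderiv_pCons)
  finally have one: "1 = P ?S + fps_X * (\<Sum>a\<in>?S. P (?S - {a}) * fps_const (- inverse a))"
    by (simp only: fps_of_poly_add fps_of_poly_mult fps_of_poly_sum fps_of_poly_const fps_of_poly_fps_X P_def)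
  have "Abs_fps (\<lambda>k. if k = 0 then 1 else - (\<Sum>a\<in>?S. inverse a ^ k)) = 1 + (\<Sum>a\<in>?S. G a)"
    by (rule fps_ext) (simp add: G_def fps_sum_nth sum_negf)
  then have "Abs_fps (\<lambda>k. if k = 0 then 1 else - (\<Sum>a\<in>?S. inverse a ^ k)) * fps_of_poly (root_poly S) =
      fps_X * (P ?S + (\<Sum>a\<in>?S. G a * P ?S))"
    by (simp add: root algebra_simps sum_distrib_left sum_distrib_right)
  also have "(\<Sum>a\<in>?S. G a * P ?S) = fps_X * (\<Sum>a\<in>?S. P (?S - {a}) * fps_const (- inverse a))"
    unfolding sum_distrib_left
    by (rule sum.cong) (simp_all add: step mult_ac flip: fps_const_neg)
  finally show ?thesis using one by simp
qed

context C_infinity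
begin

abbreviation "\<theta> \<equiv> T_of \<kappa>"
abbreviation const :: "'a \<Rightarrow> 'c" where "const c \<equiv> of_A \<kappa> [:c:]"

definition lattice_below :: "nat \<Rightarrow> 'c set" where
  "lattice_below d = of_A \<kappa> ` polys_below d"

lemma inj_of_A: "inj (of_A \<kappa>)"
  by (rule injI) (simp add: A.hom_eq_iff)

lemma finite_lattice_below [simp]: "finite (lattice_below d)"
  by (simp add: lattice_below_def)

lemma card_lattice_below: "card (lattice_below d) = CARD('a) ^ d"
  unfolding lattice_below_def
  by (subst card_image) (auto intro: inj_on_subset[OF inj_of_A] simp: card_polys_below)

lemma zero_in_lattice_below [simp]: "0 \<in> lattice_below d"
  unfolding lattice_below_def by (rule image_eqI[of _ _ 0]) (simp_all add: A.hom_0)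

lemma N_lattice_below:
  assumes "a \<in> lattice_below d" "a \<noteq> 0"
  shows "1 \<le> N a" "N a < 2 ^ d"
proof -
  obtain g where g: "a = of_A \<kappa> g" "g \<in> polys_below d" using assms(1) by (auto simp: lattice_below_def)
  with assms(2) have "g \<noteq> 0" by (auto simp: A.hom_0)
  with g(2) have "Polynomial.degree g < d" by (simp add: polys_below_iff_degree)
  then show "1 \<le> N a" "N a < 2 ^ d"
    using N_of_A[OF \<open>g \<noteq> 0\<close>] by (simp_all add: g(1) power_strict_increasing)
qed

lemma N_theta: "N \<theta> = 2"
  by (simp add: N_of_A)

lemma theta_nonzero: "\<theta> \<noteq> 0"
  using N_theta by auto

lemma const_power: "const c ^ CARD('a) = const c"
  by (simp add: poly_const_pow finite_field_power_card flip: A.hom_power)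

lemma of_A_pCons: "of_A \<kappa> (pCons c g) = const c + \<theta> * of_A \<kappa> g"
proof -
  have "pCons c g = [:c:] + [:0, 1:] * g" by simp
  then show ?thesis by (metis of_A_add of_A_mult)
qed

lemma lattice_below_top:
  assumes "x \<in> lattice_below (Suc d)"
  obtains y c where "y \<in> lattice_below d" "x = y + const c * \<theta> ^ d"
proof -
  obtain g where g: "x = of_A \<kappa> g" "g \<in> polys_below (Suc d)" using assms by (auto simp: lattice_below_def)
  define m where "m = Polynomial.monom (Polynomial.coeff g d) d"
  have "m = [:Polynomial.coeff g d:] * [:0, 1:] ^ d" by (simp add: m_def monom_altdef)
  then have "of_A \<kappa> m = const (Polynomial.coeff g d) * \<theta> ^ d" by (simp only: of_A_mult A.hom_power)
  then have "x = of_A \<kappa> (g - m) + const (Polynomial.coeff g d) * \<theta> ^ d"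
    by (simp add: g A.hom_diff)
  moreover have "g - m \<in> polys_below d" using g(2) by (auto simp: m_def polys_below_def)
  then have "of_A \<kappa> (g - m) \<in> lattice_below d" by (simp add: lattice_below_def)
  ultimately show ?thesis using that by blast
qed

lemma lattice_below_bottom:
  assumes "x \<in> lattice_below (Suc d)"
  obtains y c where "y \<in> lattice_below d" "x = \<theta> * (y + const c * inverse \<theta>)"
proof -
  obtain c g where g: "x = of_A \<kappa> (pCons c g)" "g \<in> polys_below d"
    using assms by (auto simp: lattice_below_def polys_below_Suc)
  have "x = \<theta> * (of_A \<kappa> g + const c * inverse \<theta>)"
    using g(1) of_A_pCons[of c g] theta_nonzero by (simp add: field_simps)
  moreover have "of_A \<kappa> g \<in> lattice_below d" using g(2) by (simp add: lattice_below_def)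
  ultimately show ?thesis using that by blast
qed

text \<open>
  These polynomials approximate the exponential of the lattice \<open>A\<close>, that is, the entire function
  \<open>z + \<dots>\<close> with simple zeros at the elements of \<open>A\<close>.
\<close>

definition E :: "nat \<Rightarrow> 'c poly" where
  "E d = root_poly (lattice_below d)"

definition Fq_linear :: "'c poly \<Rightarrow> bool" where
  "Fq_linear p \<longleftrightarrow> (\<forall>x y. poly p (x + y) = poly p x + poly p y) \<and>
     (\<forall>c x. poly p (const c * x) = const c * poly p x)"

lemma E_eq_0_iff: "poly (E d) z = 0 \<longleftrightarrow> z \<in> lattice_below d"
  by (simp add: E_def poly_root_poly_eq_0_iff)

text \<open>
  Applying \<open>X - w^(1-q) X^q\<close>, where \<open>w\<close> is the value at \<open>t\<close>, enlarges the space of zeros of an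
  \<open>F\<^sub>q\<close>-linear polynomial by the line through \<open>t\<close>.
\<close>

definition extend_kernel :: "nat \<Rightarrow> 'c \<Rightarrow> 'c poly" where
  "extend_kernel d t = E d - Polynomial.smult (inverse (poly (E d) t ^ (CARD('a) - 1))) (E d ^ CARD('a))"

lemma Fq_linear_extend_kernel:
  assumes "Fq_linear (E d)"
  shows "Fq_linear (extend_kernel d t)"
  using assms frobenius_add[OF A.char_eq, of _ _ 1]
  by (simp add: Fq_linear_def extend_kernel_def algebra_simps power_mult_distrib const_power)

lemma poly_extend_kernel_eq_0:
  assumes lin: "Fq_linear (E d)" and y: "y \<in> lattice_below d" and t: "t \<notin> lattice_below d"
  shows "poly (extend_kernel d t) (y + const c * t) = 0"
proof -
  define w where "w = poly (E d) t"
  have w: "w \<noteq> 0" using t by (simp add: w_def E_eq_0_iff)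
  have "poly (E d) (y + const c * t) = const c * w"
    using lin y by (simp add: Fq_linear_def w_def E_eq_0_iff[THEN iffD2])
  moreover have "w ^ CARD('a) = w ^ (CARD('a) - 1) * w" by (simp flip: power_Suc2)
  ultimately show ?thesis
    using w by (simp add: extend_kernel_def power_mult_distrib const_power flip: w_def)
qed

lemma degree_E: "Polynomial.degree (E d) \<le> CARD('a) ^ d"
  unfolding E_def card_lattice_below[symmetric] by (rule degree_root_poly_le) simp_all

lemma degree_extend_kernel: "Polynomial.degree (extend_kernel d t) \<le> CARD('a) ^ Suc d"
  unfolding extend_kernel_def
proof (intro degree_diff_le order_trans[OF degree_smult_le])
  have "CARD('a) ^ d \<le> CARD('a) ^ Suc d" by simp
  then show "Polynomial.degree (E d) \<le> CARD('a) ^ Suc d" using degree_E[of d] by linarith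
  have "Polynomial.degree (E d ^ CARD('a)) \<le> Polynomial.degree (E d) * CARD('a)" by (rule degree_power_le)
  also have "\<dots> \<le> CARD('a) ^ d * CARD('a)" using degree_E by (rule mult_right_mono) simp
  finally show "Polynomial.degree (E d ^ CARD('a)) \<le> CARD('a) ^ Suc d" by (simp add: mult.commute)
qed

lemma coeff_E: "Polynomial.coeff (E d) 0 = 0" "Polynomial.coeff (E d) 1 = 1"
  using coeff_root_poly[of "lattice_below d"] by (simp_all only: E_def)

lemma coeff_E_power: "Polynomial.coeff (E d ^ CARD('a)) 1 = 0" "Polynomial.coeff (E d ^ CARD('a)) CARD('a) = 1"
proof -
  have nth: "Polynomial.coeff (E d ^ CARD('a)) n =
      (if CARD('a) dvd n then Polynomial.coeff (E d) (n div CARD('a)) ^ CARD('a) else 0)" for n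
    using fps_power_card_nth[OF A.char_eq, of "fps_of_poly (E d)" 1 n] by (simp flip: fps_of_poly_power)
  show "Polynomial.coeff (E d ^ CARD('a)) 1 = 0"
    using two_le_card_field[where 'a = 'a] by (simp add: nth)
  show "Polynomial.coeff (E d ^ CARD('a)) CARD('a) = 1"
    using coeff_E(2)[of d] by (simp add: nth)
qed

lemma coeff_extend_kernel: "Polynomial.coeff (extend_kernel d t) 1 = 1"
  using coeff_E_power(1)[of d] coeff_E(2)[of d] by (simp add: extend_kernel_def)

lemma theta_power_notin: "\<theta> ^ d \<notin> lattice_below d"
  using N_lattice_below(2)[of "\<theta> ^ d" d] theta_nonzero by (auto simp: N_power N_theta)

lemma inverse_theta_notin: "inverse \<theta> \<notin> lattice_below d"
  using N_lattice_below(1)[of "inverse \<theta>" d] theta_nonzero by (auto simp: N_inverse N_theta)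

lemma E_Suc:
  assumes "Fq_linear (E d)"
  shows "E (Suc d) = extend_kernel d (\<theta> ^ d)"
proof (rule poly_eq_by_roots[of "lattice_below (Suc d)"])
  fix x assume "x \<in> lattice_below (Suc d)"
  then show "poly (E (Suc d)) x = 0" "poly (extend_kernel d (\<theta> ^ d)) x = 0"
    using poly_extend_kernel_eq_0[OF assms _ theta_power_notin]
    by (auto simp: E_eq_0_iff elim: lattice_below_top)
qed (simp_all only: card_lattice_below degree_E degree_extend_kernel coeff_E coeff_extend_kernel
    finite_lattice_below zero_in_lattice_below)

lemma E_linear: "Fq_linear (E d)" and pderiv_E: "pderiv (E d) = 1"
proof (induction d)
  case 0
  have "E 0 = [:0, 1:]" by (simp add: E_def root_poly_def lattice_below_def polys_below_0 A.hom_0)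
  then show "Fq_linear (E 0)" "pderiv (E 0) = 1" by (simp_all add: Fq_linear_def pderiv_pCons)
next
  case (Suc d)
  show "Fq_linear (E (Suc d))" unfolding E_Suc[OF Suc(1)] by (rule Fq_linear_extend_kernel[OF Suc(1)])
  have "(of_nat CARD('a) :: 'c) = 0"
    using CHAR_dvd_CARD[where 'a = 'a] by (simp add: of_nat_eq_0_iff_char_dvd A.char_eq)
  then have "pderiv (E d ^ CARD('a)) = 0" by (simp add: pderiv_power)
  then show "pderiv (E (Suc d)) = 1"
    unfolding E_Suc[OF Suc(1)] extend_kernel_def by (simp add: pderiv_diff pderiv_smult Suc(2))
qed

text \<open>
  Multiplication by \<open>T\<close> maps the space spanned by \<open>1/T\<close> and the polynomials of degree below \<open>d\<close> onto
  the polynomials of degree at most \<open>d\<close>. In the limit this becomes the functional equation of a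
  Drinfeld module of rank one.
\<close>

lemma E_theta: "pcompose (E (Suc d)) [:0, \<theta>:] = Polynomial.smult \<theta> (extend_kernel d (inverse \<theta>))"
proof (rule poly_eq_by_roots[of "(\<lambda>x. inverse \<theta> * x) ` lattice_below (Suc d)"])
  have card: "card ((\<lambda>x. inverse \<theta> * x) ` lattice_below (Suc d)) = CARD('a) ^ Suc d"
    using theta_nonzero by (subst card_image) (auto simp: inj_on_def card_lattice_below)
  show "Polynomial.degree (pcompose (E (Suc d)) [:0, \<theta>:]) \<le> card ((\<lambda>x. inverse \<theta> * x) ` lattice_below (Suc d))"
    unfolding card using degree_E[of "Suc d"] degree_pcompose_le[of "E (Suc d)" "[:0, \<theta>:]"]
    using theta_nonzero by simp
  show "Polynomial.degree (Polynomial.smult \<theta> (extend_kernel d (inverse \<theta>))) \<le>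
      card ((\<lambda>x. inverse \<theta> * x) ` lattice_below (Suc d))"
    unfolding card using degree_extend_kernel by (rule order_trans[OF degree_smult_le])
  show "Polynomial.coeff (pcompose (E (Suc d)) [:0, \<theta>:]) 1 =
      Polynomial.coeff (Polynomial.smult \<theta> (extend_kernel d (inverse \<theta>))) 1"
    using coeff_E(2)[of "Suc d"] coeff_extend_kernel[of d] by (simp add: coeff_pcompose_linear)
  fix x assume "x \<in> (\<lambda>x. inverse \<theta> * x) ` lattice_below (Suc d)"
  then obtain z where z: "z \<in> lattice_below (Suc d)" "x = inverse \<theta> * z" by blast
  then have "x * \<theta> = z" using theta_nonzero by simp
  then show "poly (pcompose (E (Suc d)) [:0, \<theta>:]) x = 0"
    using z(1) by (simp add: poly_pcompose E_eq_0_iff)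
  obtain y c where y: "y \<in> lattice_below d" "z = \<theta> * (y + const c * inverse \<theta>)"
    using z(1) by (rule lattice_below_bottom)
  then show "poly (Polynomial.smult \<theta> (extend_kernel d (inverse \<theta>))) x = 0"
    using poly_extend_kernel_eq_0[OF E_linear y(1) inverse_theta_notin, of c] \<open>x * \<theta> = z\<close> theta_nonzero
    by (simp add: mult.commute[of x])
next
  show "0 \<in> (\<lambda>x. inverse \<theta> * x) ` lattice_below (Suc d)"
    by (rule image_eqI[of _ _ 0]) simp_all
  show "finite ((\<lambda>x. inverse \<theta> * x) ` lattice_below (Suc d))"
    by (rule finite_imageI) (rule finite_lattice_below)
qed

definition fps_bounded :: "real \<Rightarrow> 'c fps \<Rightarrow> bool" where
  "fps_bounded b F \<longleftrightarrow> (\<forall>n. N (fps_nth F n) \<le> b)"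

lemma fps_bounded_mult:
  assumes "fps_bounded b F" "fps_bounded b' G"
  shows "fps_bounded (b * b') (F * G)"
proof -
  have "0 \<le> b" using assms(1) zero_le_dist order_trans unfolding fps_bounded_def by blast
  moreover have "0 \<le> b'" using assms(2) zero_le_dist order_trans unfolding fps_bounded_def by blast
  ultimately show ?thesis
    using assms unfolding fps_bounded_def fps_mult_nth
    by (auto intro!: N_sum_le mult_mono simp: dist_mult)
qed

lemma fps_bounded_power: "fps_bounded 1 F \<Longrightarrow> fps_bounded 1 (F ^ k)"
proof (induction k)
  case 0
  show ?case by (simp add: fps_bounded_def)
next
  case (Suc k)
  then show ?case using fps_bounded_mult[of 1 F 1 "F ^ k"] by simp
qed

lemma fps_bounded_prod: "(\<And>x. x \<in> A \<Longrightarrow> fps_bounded 1 (F x)) \<Longrightarrow> fps_bounded 1 (prod F A)"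
proof (induction A rule: infinite_finite_induct)
  case (insert x A)
  then show ?case using fps_bounded_mult[of 1 "F x" 1 "prod F A"] by simp
qed (simp_all add: fps_bounded_def)

lemma fps_bounded_E: "fps_bounded 1 (fps_of_poly (E d))"
proof -
  have "fps_bounded 1 (fps_of_poly [:1, - inverse a:])" if "a \<in> lattice_below d - {0}" for a
  proof -
    have "inverse (N a) \<le> 1" using N_lattice_below(1)[of a d] that by (simp add: inverse_le_1_iff)
    then show ?thesis
      by (auto simp: fps_bounded_def coeff_pCons N_inverse split: nat.splits)
  qed
  then have "fps_bounded 1 (\<Prod>a\<in>lattice_below d - {0}. fps_of_poly [:1, - inverse a:])"
    by (rule fps_bounded_prod)
  moreover have "fps_bounded 1 fps_X" by (simp add: fps_bounded_def)
  ultimately show ?thesis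
    using fps_bounded_mult[of 1 fps_X 1]
    unfolding E_def root_poly_def fps_of_poly_mult fps_of_poly_prod fps_of_poly_fps_X by simp
qed

text \<open>
  All coefficients are bounded by \<open>1\<close>, and the factor in front of the correction term is the inverse
  of a power of \<open>E\<^sub>d(T^d)\<close>, which is at least \<open>|T^d| = 2^d\<close> in absolute value. The convergence is uniform
  in \<open>n\<close>, so that values at points of the unit disc converge as well.
\<close>

lemma coeff_E_step: "N (Polynomial.coeff (E (Suc d)) n - Polynomial.coeff (E d) n) \<le> (1 / 2) ^ d"
proof -
  define w where "w = poly (E d) (\<theta> ^ d)"
  have "(2 :: real) ^ d \<le> 2 ^ d * (\<Prod>a\<in>lattice_below d - {0}. N (1 - \<theta> ^ d * inverse a))"
  proof -
    have "1 \<le> (\<Prod>a\<in>lattice_below d - {0}. N (1 - \<theta> ^ d * inverse a))"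
    proof (rule prod_ge_1)
      fix a assume a: "a \<in> lattice_below d - {0}"
      then have Na: "0 < N a" "N a < 2 ^ d" using N_lattice_below[of a d] by auto
      have "N (- (\<theta> ^ d * inverse a)) = 2 ^ d * inverse (N a)"
        by (simp only: N_minus dist_mult N_power N_inverse N_theta)
      moreover have "1 < 2 ^ d * inverse (N a)" using Na by (simp add: field_simps)
      ultimately have big: "1 < N (- (\<theta> ^ d * inverse a))" by linarith
      then have "N (- (\<theta> ^ d * inverse a) + 1) = N (- (\<theta> ^ d * inverse a))"
        by (intro N_add_eq) simp
      then show "1 \<le> N (1 - \<theta> ^ d * inverse a)" using big by (simp add: add.commute)
    qed
    then show ?thesis by simp
  qed
  also have "\<dots> = N w"
    by (simp add: w_def E_def poly_root_poly dist_mult N_prod N_power N_theta)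
  finally have w: "2 ^ d \<le> N w" .
  moreover have "(1::real) \<le> 2 ^ d" by simp
  ultimately have w1: "1 \<le> N w" by linarith
  have "2 ^ d \<le> N w ^ (CARD('a) - 1)"
  proof -
    have "1 \<le> CARD('a) - 1" using two_le_card_field[where 'a = 'a] by linarith
    then have "N w ^ 1 \<le> N w ^ (CARD('a) - 1)" using w1 by (rule power_increasing)
    with w show ?thesis by simp
  qed
  then have "inverse (N w ^ (CARD('a) - 1)) \<le> inverse (2 ^ d)"
    by (rule le_imp_inverse_le) simp
  then have \<mu>: "N (inverse (w ^ (CARD('a) - 1))) \<le> (1 / 2) ^ d"
    unfolding N_inverse N_power by (simp add: power_one_over inverse_eq_divide)
  have "N (Polynomial.coeff (E d ^ CARD('a)) n) \<le> 1"
    using fps_bounded_power[OF fps_bounded_E[of d], of "CARD('a)"]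
    unfolding fps_of_poly_power[symmetric] fps_bounded_def by simp
  then have "N (inverse (w ^ (CARD('a) - 1))) * N (Polynomial.coeff (E d ^ CARD('a)) n) \<le> (1 / 2) ^ d * 1"
    using \<mu> by (intro mult_mono) auto
  then show ?thesis
    unfolding E_Suc[OF E_linear] extend_kernel_def w_def[symmetric] by (simp add: dist_mult)
qed

definition Einf :: "'c fps" where
  "Einf = Abs_fps (\<lambda>n. lim (\<lambda>d. Polynomial.coeff (E d) n))"

lemma Einf_approx: "N (Polynomial.coeff (E d) n - fps_nth Einf n) \<le> (1 / 2) ^ d"
  and Einf_tendsto: "(\<lambda>d. Polynomial.coeff (E d) n) \<longlonglongrightarrow> fps_nth Einf n"
proof -
  obtain l where l: "\<And>d. N (Polynomial.coeff (E d) n - l) \<le> (1 / 2) ^ d"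
      "(\<lambda>d. Polynomial.coeff (E d) n) \<longlonglongrightarrow> l"
    by (rule geometric_limit[of "1 / 2" "\<lambda>d. Polynomial.coeff (E d) n"]) (auto intro: coeff_E_step)
  have "fps_nth Einf n = l" using limI[OF l(2)] by (simp add: Einf_def)
  then show "N (Polynomial.coeff (E d) n - fps_nth Einf n) \<le> (1 / 2) ^ d"
    "(\<lambda>d. Polynomial.coeff (E d) n) \<longlonglongrightarrow> fps_nth Einf n"
    using l by simp_all
qed

lemma Einf_nth: "fps_nth Einf 0 = 0" "fps_nth Einf 1 = 1"
  using Einf_tendsto[of 0] Einf_tendsto[of 1] by (simp_all only: coeff_E LIMSEQ_const_iff)

lemma fps_tendsto_mult:
  fixes Fs Gs :: "nat \<Rightarrow> 'c fps"
  assumes "\<And>n. (\<lambda>d. fps_nth (Fs d) n) \<longlonglongrightarrow> fps_nth F n" "\<And>n. (\<lambda>d. fps_nth (Gs d) n) \<longlonglongrightarrow> fps_nth G n"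
  shows "(\<lambda>d. fps_nth (Fs d * Gs d) n) \<longlonglongrightarrow> fps_nth (F * G) n"
  unfolding fps_mult_nth by (intro tendsto_sum_C tendsto_mult_C assms)

lemma fps_tendsto_power:
  fixes Fs :: "nat \<Rightarrow> 'c fps"
  assumes "\<And>n. (\<lambda>d. fps_nth (Fs d) n) \<longlonglongrightarrow> fps_nth F n"
  shows "(\<lambda>d. fps_nth (Fs d ^ k) n) \<longlonglongrightarrow> fps_nth (F ^ k) n"
proof (induction k arbitrary: n)
  case (Suc k)
  show ?case unfolding power_Suc by (rule fps_tendsto_mult[OF assms Suc])
qed simp

text \<open>
  The factor in \<open>E_theta\<close> converges because it can be read off from the coefficient of \<open>z^q\<close>, where the
  \<open>q\<close>-th power of \<open>E\<^sub>d\<close> has the coefficient \<open>1\<close>.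
\<close>

lemma Einf_functional_equation:
  "(\<theta> ^ n - \<theta>) * fps_nth Einf n = (\<theta> ^ CARD('a) - \<theta>) * fps_nth Einf CARD('a) * fps_nth (Einf ^ CARD('a)) n"
proof -
  define \<Delta> where "\<Delta> = (\<lambda>d. - \<theta> * inverse (poly (E d) (inverse \<theta>) ^ (CARD('a) - 1)))"
  have eq: "\<theta> ^ n * Polynomial.coeff (E (Suc d)) n - \<theta> * Polynomial.coeff (E d) n =
      \<Delta> d * Polynomial.coeff (E d ^ CARD('a)) n" for d n
    using arg_cong[OF E_theta[of d], of "\<lambda>p. Polynomial.coeff p n"]
    by (simp add: coeff_pcompose_linear extend_kernel_def \<Delta>_def algebra_simps)
  have lhs: "(\<lambda>d. \<theta> ^ n * Polynomial.coeff (E (Suc d)) n - \<theta> * Polynomial.coeff (E d) n)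
      \<longlonglongrightarrow> \<theta> ^ n * fps_nth Einf n - \<theta> * fps_nth Einf n" for n
    by (intro tendsto_diff_C tendsto_mult_C tendsto_const Einf_tendsto LIMSEQ_Suc[OF Einf_tendsto])
  have "\<Delta> \<longlonglongrightarrow> \<theta> ^ CARD('a) * fps_nth Einf CARD('a) - \<theta> * fps_nth Einf CARD('a)"
    using lhs[of "CARD('a)"] unfolding eq coeff_E_power(2) by simp
  moreover have "(\<lambda>d. Polynomial.coeff (E d ^ CARD('a)) n) \<longlonglongrightarrow> fps_nth (Einf ^ CARD('a)) n"
    using fps_tendsto_power[of "\<lambda>d. fps_of_poly (E d)" Einf "CARD('a)" n] Einf_tendsto
    by (simp flip: fps_of_poly_power)
  ultimately have "(\<lambda>d. \<Delta> d * Polynomial.coeff (E d ^ CARD('a)) n) \<longlonglongrightarrow>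
      (\<theta> ^ CARD('a) * fps_nth Einf CARD('a) - \<theta> * fps_nth Einf CARD('a)) * fps_nth (Einf ^ CARD('a)) n"
    by (rule tendsto_mult_C)
  then have "\<theta> ^ n * fps_nth Einf n - \<theta> * fps_nth Einf n =
      (\<theta> ^ CARD('a) * fps_nth Einf CARD('a) - \<theta> * fps_nth Einf CARD('a)) * fps_nth (Einf ^ CARD('a)) n"
    using lhs[of n] unfolding eq by (rule LIMSEQ_unique[rotated])
  then show ?thesis by (simp add: algebra_simps)
qed

lemma Einf_value_approx:
  assumes "N z \<le> 1" "CARD('a) ^ d < m"
  shows "N ((\<Sum>n<m. fps_nth Einf n * z ^ n) - poly (E d) z) \<le> (1 / 2) ^ d"
proof -
  have "poly (E d) z = (\<Sum>n\<le>Polynomial.degree (E d). Polynomial.coeff (E d) n * z ^ n)" by (rule poly_altdef)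
  also have "\<dots> = (\<Sum>n<m. Polynomial.coeff (E d) n * z ^ n)"
    by (rule sum.mono_neutral_left) (use degree_E[of d] assms(2) in \<open>auto intro: coeff_eq_0\<close>)
  finally have "(\<Sum>n<m. fps_nth Einf n * z ^ n) - poly (E d) z =
      (\<Sum>n<m. (fps_nth Einf n - Polynomial.coeff (E d) n) * z ^ n)"
    by (simp add: sum_subtractf left_diff_distrib)
  also have "N \<dots> \<le> (1 / 2) ^ d"
  proof (rule N_sum_le)
    fix n
    have "N ((fps_nth Einf n - Polynomial.coeff (E d) n) * z ^ n) \<le> (1 / 2) ^ d * 1"
      unfolding dist_mult N_power using Einf_approx[of d n] assms(1)
      by (intro mult_mono) (auto simp: N_diff_commute power_le_one)
    then show "N ((fps_nth Einf n - Polynomial.coeff (E d) n) * z ^ n) \<le> (1 / 2) ^ d" by simp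
  qed simp
  finally show ?thesis .
qed

text \<open>
  The multiples of a monic polynomial by the \<open>q - 1\<close> nonzero constants give equal terms, and
  \<open>q - 1 = -1\<close> in characteristic \<open>p\<close>.
\<close>

lemma sum_lattice_below_powers:
  assumes "(CARD('a) - 1) dvd k"
  shows "(\<Sum>a\<in>lattice_below d - {0}. inverse a ^ k) = - (\<Sum>f\<in>monic_below d. inverse (of_A \<kappa> f ^ k))"
proof -
  have const1: "const c ^ k = 1" if c: "c \<noteq> 0" for c
  proof -
    have "const c ^ (CARD('a) - 1) * const c = const c" by (simp add: const_power flip: power_Suc2)
    moreover have "const c \<noteq> 0" using c by (simp add: A.hom_eq_0_iff)
    ultimately have "const c ^ (CARD('a) - 1) = 1" by simp
    then show ?thesis using assms by (auto elim!: dvdE simp: power_mult)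
  qed
  have "lattice_below d - {0} = of_A \<kappa> ` (polys_below d - {0})"
    by (auto simp: lattice_below_def A.hom_eq_0_iff)
  then have "(\<Sum>a\<in>lattice_below d - {0}. inverse a ^ k) = (\<Sum>g\<in>polys_below d - {0}. inverse (of_A \<kappa> g ^ k))"
    by (simp add: sum.reindex inj_on_subset[OF inj_of_A] power_inverse)
  also have "\<dots> = (\<Sum>(c, f)\<in>(UNIV - {0}) \<times> monic_below d. inverse (of_A \<kappa> (Polynomial.smult c f) ^ k))"
    by (rule sum.reindex_bij_witness[of _ "\<lambda>(c, f). Polynomial.smult c f"
          "\<lambda>g. (Polynomial.lead_coeff g, Polynomial.smult (inverse (Polynomial.lead_coeff g)) g)"])
       (auto simp: monic_below_def polys_below_def)
  also have "\<dots> = (\<Sum>(c :: 'a, f)\<in>(UNIV - {0}) \<times> monic_below d. inverse (of_A \<kappa> f ^ k))"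
  proof (rule sum.cong)
    fix x :: "'a \<times> 'a poly" assume "x \<in> (UNIV - {0}) \<times> monic_below d"
    then obtain c f where x: "x = (c, f)" "c \<noteq> 0" by auto
    have "Polynomial.smult c f = [:c:] * f" by simp
    then show "(case x of (c, f) \<Rightarrow> inverse (of_A \<kappa> (Polynomial.smult c f) ^ k)) = (case x of (c, f) \<Rightarrow> inverse (of_A \<kappa> f ^ k))"
      using const1[OF x(2)] by (simp only: x of_A_mult power_mult_distrib prod.case mult_1_left)
  qed simp
  also have "\<dots> = of_nat (CARD('a) - 1) * (\<Sum>f\<in>monic_below d. inverse (of_A \<kappa> f ^ k))"
    by (simp add: sum.cartesian_product[symmetric] card_Diff_singleton)
  also have "(of_nat (CARD('a) - 1) :: 'c) = - 1"
  proof -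
    have "(of_nat CARD('a) :: 'c) = 0"
      using CHAR_dvd_CARD[where 'a = 'a] by (simp add: of_nat_eq_0_iff_char_dvd A.char_eq)
    then show ?thesis by (simp add: of_nat_diff)
  qed
  finally show ?thesis by simp
qed

text \<open>
  The reciprocals of the \<open>E\<^sub>d\<close> are known by partial fractions, and their coefficients tend to zeta
  values; it remains to see that the reciprocals converge to the reciprocal of the limit.
\<close>

lemma reciprocal_Einf_nth:
  assumes g: "g * Einf = fps_X" and k: "0 < k" "(CARD('a) - 1) dvd k"
  shows "fps_nth g k = \<kappa> (to_ac (carlitz_zeta k))"
proof -
  define G where "G = (\<lambda>d. Abs_fps (\<lambda>k. if k = 0 then 1 else - (\<Sum>a\<in>lattice_below d - {0}. inverse a ^ k)))"
  have G: "G d * fps_of_poly (E d) = fps_X" for d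
    using reciprocal_root_poly[of "lattice_below d"] pderiv_E[of d] by (simp add: G_def E_def)
  have bounded: "fps_bounded 1 (G d)" for d
    unfolding fps_bounded_def G_def
    using N_lattice_below(1)[of _ d]
    by (auto simp: N_power N_inverse inverse_le_1_iff intro!: N_sum_le power_le_one)
  \<comment> \<open>The difference of the two reciprocals is \<open>g (G\<^sub>d (E - E\<^sub>d)) / X\<close>, with \<open>G\<^sub>d\<close> bounded.\<close>
  have null: "(\<lambda>d. fps_nth (G d * (Einf - fps_of_poly (E d))) n) \<longlonglongrightarrow> fps_nth 0 n" for n
    unfolding tendsto_N_iff
  proof (rule tendsto_0_le[where K = 1])
    show "(\<lambda>d. (1 / 2) ^ d :: real) \<longlonglongrightarrow> 0" by (rule LIMSEQ_realpow_zero) auto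
    have "fps_bounded (1 * (1 / 2) ^ d) (G d * (Einf - fps_of_poly (E d)))" for d
      by (rule fps_bounded_mult[OF bounded])
         (use Einf_approx[of d] in \<open>auto simp: fps_bounded_def N_diff_commute\<close>)
    then show "\<forall>\<^sub>F d in sequentially. norm (N (fps_nth (G d * (Einf - fps_of_poly (E d))) n - fps_nth 0 n)) \<le> norm ((1 / 2) ^ d :: real) * 1"
      by (simp add: fps_bounded_def)
  qed
  have "(\<lambda>d. fps_nth (g * (G d * (Einf - fps_of_poly (E d)))) (Suc k)) \<longlonglongrightarrow> fps_nth (g * 0) (Suc k)"
    by (rule fps_tendsto_mult[OF tendsto_const null])
  moreover have "g * (G d * (Einf - fps_of_poly (E d))) = (G d - g) * fps_X" for d
  proof -
    have "g * (G d * (Einf - fps_of_poly (E d))) = G d * (g * Einf) - g * (G d * fps_of_poly (E d))"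
      by (simp add: algebra_simps)
    then show ?thesis by (simp add: g G algebra_simps)
  qed
  ultimately have "(\<lambda>d. fps_nth (G d) k - fps_nth g k) \<longlonglongrightarrow> 0" by simp
  then have "(\<lambda>d. fps_nth (G d) k) \<longlonglongrightarrow> fps_nth g k"
    using tendsto_N_iff[of "\<lambda>d. fps_nth (G d) k - fps_nth g k" 0] tendsto_N_iff[of "\<lambda>d. fps_nth (G d) k" "fps_nth g k"] by simp
  moreover have "fps_nth (G d) k = (\<Sum>f\<in>monic_below d. inverse (of_A \<kappa> f ^ k))" for d
    using k by (simp add: G_def sum_lattice_below_powers)
  ultimately show ?thesis using zeta_limit[OF k(1)] LIMSEQ_unique by simp
qed

end

lemma fps_reciprocal_exists:
  fixes F :: "'c::field fps"
  assumes "fps_nth F 0 = 0" "fps_nth F 1 = 1"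
  obtains g where "g * F = fps_X"
proof -
  define u where "u = fps_shift 1 F"
  have F: "F = u * fps_X"
    by (rule fps_ext) (use assms(1) in \<open>auto simp: u_def\<close>)
  have "fps_nth u 0 \<noteq> 0" using assms(2) by (simp add: u_def)
  then have "inverse u * u = 1" by (rule inverse_mult_eq_1)
  then have "inverse u * F = fps_X" by (simp add: F flip: mult.assoc)
  then show ?thesis by (rule that)
qed

locale carlitz_period = C_infinity \<kappa>
  for \<kappa> :: "'a::{finite,field} fls alg_closure \<Rightarrow> 'c::{field,complete_space}" +
  fixes e :: "'c fps" and \<xi> :: 'c
  assumes exponential: "carlitz_exponential \<kappa> e" and period: "period_lattice_generator \<kappa> e \<xi>"
begin

sublocale exp: carlitz_exp "of_A \<kappa>" e
  by unfold_locales (use exponential in \<open>simp_all add: carlitz_exponential_def\<close>)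

lemma kernel_iff: "(\<lambda>n. fps_nth e n * z ^ n) sums 0 \<longleftrightarrow> z \<in> range (\<lambda>a. of_A \<kappa> a * \<xi>)"
  using period by (auto simp: period_lattice_generator_def fps_kernel_def)

text \<open>
  The functional equations show that \<open>e\<close> is the lattice exponential of \<open>A\<close> rescaled by some \<open>\<delta>\<close>. Its zero
  \<open>1\<close> becomes a zero \<open>\<delta>\<close> of \<open>e\<close>, hence \<open>\<delta> = a\<xi>\<close> for some \<open>a\<close> in \<open>A\<close>. Conversely the zero \<open>\<xi>\<close> of \<open>e\<close> becomes a
  zero \<open>1/a\<close> of the lattice exponential, and this forces \<open>a\<close> to be constant.
\<close>

lemma period_scaling:
  obtains c where "c \<noteq> 0" "\<xi> \<noteq> 0" "\<And>n. const c * \<xi> * fps_nth Einf n = fps_nth e n * (const c * \<xi>) ^ n"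
proof -
  let ?q = "CARD('a)"
  define \<Delta> where "\<Delta> = (\<theta> ^ ?q - \<theta>) * fps_nth Einf ?q"
  obtain \<delta> where \<delta>: "\<delta> ^ (?q - 1) = \<Delta>" using root_exists by blast
  have scale: "\<delta> * fps_nth Einf n = fps_nth e n * \<delta> ^ n" for n
  proof (induction n rule: less_induct)
    case (less n)
    consider "n = 0" | "n = 1" | "1 < n" by linarith
    then show ?case
    proof cases
      case 3
      have fe: "(\<theta> ^ n - \<theta>) * fps_nth e n = (if ?q dvd n then fps_nth e (n div ?q) ^ ?q else 0)"
        using exp.exp_nth_recursion[of n] fps_power_card_nth[OF A.char_eq, of e 1 n] by simp
      have fE: "(\<theta> ^ n - \<theta>) * fps_nth Einf n = \<Delta> * (if ?q dvd n then fps_nth Einf (n div ?q) ^ ?q else 0)"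
        using Einf_functional_equation[of n] fps_power_card_nth[OF A.char_eq, of Einf 1 n] by (simp add: \<Delta>_def)
      have "(\<theta> ^ n - \<theta>) * (\<delta> * fps_nth Einf n) = (\<theta> ^ n - \<theta>) * (fps_nth e n * \<delta> ^ n)"
      proof (cases "?q dvd n")
        case True
        then obtain k where k: "n = ?q * k" by (elim dvdE)
        have "k \<noteq> 0" by (rule notI) (use 3 k in simp)
        have "2 * k \<le> ?q * k" using two_le_card_field[where 'a = 'a] by (rule mult_right_mono) simp
        then have "k < n" using \<open>k \<noteq> 0\<close> k by linarith
        have "(\<theta> ^ n - \<theta>) * (\<delta> * fps_nth Einf n) = \<delta> * \<Delta> * fps_nth Einf k ^ ?q"
          using fE k by (simp add: mult_ac)
        also have "\<delta> * \<Delta> = \<delta> ^ ?q" by (simp add: flip: \<delta> power_Suc)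
        also have "\<delta> ^ ?q * fps_nth Einf k ^ ?q = (fps_nth e k * \<delta> ^ k) ^ ?q"
          using less[OF \<open>k < n\<close>] by (simp flip: power_mult_distrib)
        also have "\<dots> = (\<theta> ^ n - \<theta>) * (fps_nth e n * \<delta> ^ n)"
          using fe k by (simp add: power_mult_distrib mult.commute[of k] flip: power_mult mult.assoc)
        finally show ?thesis .
      qed (use fe fE in auto)
      then show ?thesis using A.theta_power_neq[of n] 3 by simp
    qed (use Einf_nth exp.exp_nth_0 exp.exp_nth_1 in auto)
  qed
  have partial: "(\<Sum>n<m. fps_nth e n * (\<delta> * z) ^ n) = \<delta> * (\<Sum>n<m. fps_nth Einf n * z ^ n)" for m z
    unfolding sum_distrib_left by (rule sum.cong) (simp_all add: power_mult_distrib scale flip: mult.assoc)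
  \<comment> \<open>\<open>1\<close> is a zero of every \<open>E\<^sub>d\<close> with \<open>d > 0\<close>.\<close>
  have Einf_1: "(\<lambda>m. \<Sum>n<m. fps_nth Einf n * 1 ^ n) \<longlonglongrightarrow> 0"
  proof (rule metric_LIMSEQ_I)
    fix r :: real assume "0 < r"
    then obtain d where d: "(1 / 2) ^ d < r" using real_arch_pow_inv[of r "1 / 2"] by auto
    have "[:1:] \<in> polys_below (Suc d)" by (simp add: polys_below_def coeff_pCons split: nat.splits)
    then have "1 \<in> lattice_below (Suc d)"
      unfolding lattice_below_def by (metis image_eqI A.hom_1 one_pCons)
    then have "N (\<Sum>n<m. fps_nth Einf n * 1 ^ n) \<le> (1 / 2) ^ Suc d" if "Suc (?q ^ Suc d) \<le> m" for m
      using Einf_value_approx[of 1 "Suc d" m] that by (simp add: E_eq_0_iff[THEN iffD2])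
    moreover have "(1 / 2 :: real) ^ Suc d < r" using d \<open>0 < r\<close> by simp
    ultimately have "N (\<Sum>n<m. fps_nth Einf n * 1 ^ n) < r" if "Suc (?q ^ Suc d) \<le> m" for m
      using that le_less_trans by blast
    then show "\<exists>no. \<forall>m\<ge>no. N (\<Sum>n<m. fps_nth Einf n * 1 ^ n) < r" by blast
  qed
  \<comment> \<open>Otherwise the lattice exponential would be the identity, which does not vanish at \<open>1\<close>.\<close>
  have "\<delta> \<noteq> 0"
  proof
    assume "\<delta> = 0"
    then have "\<Delta> = 0" using \<delta> two_le_card_field[where 'a = 'a] by (simp add: power_0_left)
    have "fps_nth Einf n = (if n = 1 then 1 else 0)" for n
      using Einf_functional_equation[of n] A.theta_power_neq[of n] \<open>\<Delta> = 0\<close> Einf_nth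
      by (cases "n = 1") (auto simp: \<Delta>_def)
    then have "(\<Sum>n<Suc (Suc m). fps_nth Einf n * 1 ^ n) = 1" for m
      by (simp add: sum.delta')
    then have "(\<lambda>m. 1 :: 'c) \<longlonglongrightarrow> 0" using LIMSEQ_Suc[OF LIMSEQ_Suc[OF Einf_1]] by simp
    then show False using LIMSEQ_const_iff by (metis one_neq_zero)
  qed
  have "(\<lambda>n. fps_nth e n * \<delta> ^ n) sums 0"
  proof -
    have "(\<Sum>n<m. fps_nth e n * \<delta> ^ n) = \<delta> * (\<Sum>n<m. fps_nth Einf n * 1 ^ n)" for m
      using partial[where z = 1] by (simp only: mult_1_right)
    then show ?thesis
      unfolding sums_def using tendsto_mult_C[OF tendsto_const Einf_1, of \<delta>] by (simp only: mult_zero_right)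
  qed
  then obtain a where a: "\<delta> = of_A \<kappa> a * \<xi>" using kernel_iff by blast
  have a0: "of_A \<kappa> a \<noteq> 0" "\<xi> \<noteq> 0" "a \<noteq> 0" using \<open>\<delta> \<noteq> 0\<close> a by (auto simp: A.hom_0)
  define z where "z = inverse (of_A \<kappa> a)"
  have \<xi>: "\<xi> = \<delta> * z" using a a0 by (simp add: z_def)
  have Nz: "N z = inverse (2 ^ Polynomial.degree a)" using a0 by (simp add: z_def N_inverse N_of_A)
  have z1: "N z \<le> 1" "0 < N z" by (simp_all add: Nz inverse_le_1_iff)
  have "\<xi> \<in> range (\<lambda>a. of_A \<kappa> a * \<xi>)" by (rule image_eqI[of _ _ 1]) (simp_all add: A.hom_1)
  then have "(\<lambda>n. fps_nth e n * \<xi> ^ n) sums 0" by (simp only: kernel_iff)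
  then have "(\<lambda>m. \<delta> * (\<Sum>n<m. fps_nth Einf n * z ^ n)) \<longlonglongrightarrow> 0"
    unfolding sums_def \<xi> partial .
  from tendsto_mult_C[OF tendsto_const this, of "inverse \<delta>"]
  have Einf_z: "(\<lambda>m. \<Sum>n<m. fps_nth Einf n * z ^ n) \<longlonglongrightarrow> 0"
    using \<open>\<delta> \<noteq> 0\<close> by (simp flip: mult.assoc)
  have "Polynomial.degree a = 0"
  proof (rule ccontr)
    assume "Polynomial.degree a \<noteq> 0"
    then have Nz1: "N z < 1" using one_less_power[of "2 :: real" "Polynomial.degree a"] by (simp add: Nz inverse_less_1_iff)
    \<comment> \<open>Inside the open unit disc every factor \<open>1 - z/b\<close> of \<open>E\<^sub>d\<close> has absolute value \<open>1\<close>.\<close>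
    have NE: "N (poly (E d) z) = N z" for d
    proof -
      have "N (1 - z * inverse b) = 1" if "b \<in> lattice_below d - {0}" for b
      proof -
        have "N z * inverse (N b) < 1"
          using N_lattice_below(1)[of b d] that Nz1 z1 by (simp add: field_simps)
        then have "N (- (z * inverse b)) < N 1" by (simp add: dist_mult N_inverse)
        then show ?thesis using N_add_eq[of "- (z * inverse b)" 1] by simp
      qed
      then show ?thesis by (simp add: E_def poly_root_poly dist_mult N_prod)
    qed
    obtain d where d: "(1 / 2) ^ d < N z" using real_arch_pow_inv[of "N z" "1 / 2"] z1 by auto
    obtain m0 where m0: "\<And>m. m0 \<le> m \<Longrightarrow> N (\<Sum>n<m. fps_nth Einf n * z ^ n) < N z"
      using metric_LIMSEQ_D[OF Einf_z z1(2)] by blast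
    define S where "S = (\<Sum>n<max m0 (Suc (?q ^ d)). fps_nth Einf n * z ^ n)"
    have "N S < N z" unfolding S_def by (rule m0) simp
    moreover have "N (S - poly (E d) z) \<le> (1 / 2) ^ d"
      unfolding S_def by (rule Einf_value_approx[OF z1(1)]) simp
    moreover have "N (poly (E d) z) \<le> max (N S) (N (S - poly (E d) z))"
      using N_diff_le[of S "S - poly (E d) z"] by simp
    ultimately show False using d NE[of d] by simp
  qed
  then obtain c where "a = [:c:]" by (elim degree_eq_zeroE)
  then show ?thesis using that[of c] a a0 scale by auto
qed

text \<open>
  The constant \<open>c\<close> by which \<open>\<delta>\<close> and \<open>\<xi>\<close> differ disappears in the \<open>k\<close>-th power when \<open>q - 1\<close> divides \<open>k\<close>.
\<close>

theorem exponential_reciprocal_nth: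
  assumes g: "g * e = fps_X" and k: "0 < k" "(CARD('a) - 1) dvd k"
  shows "fps_nth g k = \<kappa> (to_ac (carlitz_zeta k)) / \<xi> ^ k"
proof -
  obtain c where c: "c \<noteq> 0" "\<xi> \<noteq> 0" "\<And>n. const c * \<xi> * fps_nth Einf n = fps_nth e n * (const c * \<xi>) ^ n"
    using period_scaling by blast
  define \<delta> where "\<delta> = const c * \<xi>"
  have "\<delta> \<noteq> 0" using c by (simp add: \<delta>_def A.hom_eq_0_iff)
  define G where "G = Abs_fps (\<lambda>n. \<delta> ^ n * fps_nth g n)"
  have "G * Einf = fps_X"
  proof (rule fps_ext)
    fix n
    have "\<delta> * fps_nth (G * Einf) n = (\<Sum>i=0..n. \<delta> ^ i * fps_nth g i * (\<delta> * fps_nth Einf (n - i)))"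
      unfolding fps_mult_nth sum_distrib_left by (rule sum.cong) (simp_all add: G_def mult_ac)
    also have "\<dots> = (\<Sum>i=0..n. \<delta> ^ n * (fps_nth g i * fps_nth e (n - i)))"
    proof (rule sum.cong)
      fix i assume "i \<in> {0..n}"
      then have "\<delta> ^ n = \<delta> ^ i * \<delta> ^ (n - i)" by (simp flip: power_add)
      then show "\<delta> ^ i * fps_nth g i * (\<delta> * fps_nth Einf (n - i)) = \<delta> ^ n * (fps_nth g i * fps_nth e (n - i))"
        using c(3)[of "n - i"] by (simp add: \<delta>_def[symmetric])
    qed simp
    also have "\<dots> = \<delta> ^ n * fps_nth (g * e) n" by (simp add: fps_mult_nth sum_distrib_left)
    also have "\<dots> = \<delta> * fps_nth fps_X n" by (simp add: g)
    finally show "fps_nth (G * Einf) n = fps_nth fps_X n" using \<open>\<delta> \<noteq> 0\<close> by simp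
  qed
  from reciprocal_Einf_nth[OF this k] have "\<delta> ^ k * fps_nth g k = \<kappa> (to_ac (carlitz_zeta k))"
    by (simp add: G_def)
  moreover have "\<delta> ^ k = \<xi> ^ k"
  proof -
    have "const c ^ (CARD('a) - 1) * const c = const c" by (simp add: const_power flip: power_Suc2)
    moreover have "const c \<noteq> 0" using c by (simp add: A.hom_eq_0_iff)
    ultimately have "const c ^ (CARD('a) - 1) = 1" by simp
    then show ?thesis using k(2) by (auto elim!: dvdE simp: \<delta>_def power_mult_distrib power_mult)
  qed
  ultimately show ?thesis using c(2) by (simp add: field_simps)
qed

end

section \<open>The denominator ideal at a prime\<close>

lemma poly_A_simps [simp]:
  "carrier poly_A = UNIV" "mult poly_A = (*)" "one poly_A = 1" "zero poly_A = 0" "add poly_A = (+)"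
  by (simp_all add: ring_of_type_algebra_def fun_eq_iff)

lemma primeideal_generator:
  fixes P :: "'a::field poly set"
  assumes "primeideal P poly_A" "P \<noteq> {0}"
  obtains f where "prime_elem f" "P = {g. f dvd g}"
proof -
  interpret P: primeideal P "poly_A :: 'a poly ring" by fact
  have mult: "y * x \<in> P" if "x \<in> P" for x y using P.I_l_closed[of x y] that by simp
  have diff: "x - y \<in> P" if "x \<in> P" "y \<in> P" for x y
  proof -
    have "x \<oplus>\<^bsub>poly_A\<^esub> (- 1) * y \<in> P" 
      by (rule additive_subgroup.a_closed[OF P.additive_subgroup_axioms that(1) mult[OF that(2)]])
    then show ?thesis by simp
  qed
  have zero: "0 \<in> P" using additive_subgroup.zero_closed[OF P.additive_subgroup_axioms] by simp
  obtain f where f: "\<And>x. x \<in> P \<longleftrightarrow> f dvd x"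
    by (rule poly_ideal_principal[of P]) (use zero mult diff in simp_all)
  have "prime_elem f"
  proof (rule prime_elemI)
    have "P \<subseteq> {0}" if "f = 0" using f that by auto
    then show "f \<noteq> 0" using assms(2) zero by auto
    show "\<not> is_unit f"
    proof
      assume "is_unit f"
      then have "P = UNIV" using f by (auto intro: unit_imp_dvd)
      then show False using P.I_notcarr by simp
    qed
    show "f dvd a \<or> f dvd b" if "f dvd a * b" for a b
      using P.I_prime[of a b] that by (simp add: f)
  qed
  then show ?thesis using that f by blast
qed

lemma ideal_power_poly_A:
  fixes f :: "'a::field poly"
  shows "{g. f dvd g} [^]\<^bsub>ideals_set poly_A\<^esub> (n :: nat) = {g. f ^ n dvd g}"
proof (induction n)
  case 0
  show ?case by (simp add: nat_pow_def ideals_set_def)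
next
  case (Suc n)
  have "ideal_prod poly_A {g. f ^ n dvd g} {g. f dvd g} = {g. f ^ Suc n dvd g}"
  proof (intro equalityI subsetI)
    fix x assume "x \<in> ideal_prod poly_A {g. f ^ n dvd g} {g. f dvd g}"
    then show "x \<in> {g. f ^ Suc n dvd g}"
    proof (induction rule: ideal_prod.induct)
      case (prod i j)
      then have "f ^ n * f dvd i * j" by (intro mult_dvd_mono) simp_all
      then show ?case by (simp add: mult.commute)
    qed simp
  next
    fix x assume "x \<in> {g. f ^ Suc n dvd g}"
    then obtain u where "x = f ^ Suc n * u" by (auto elim: dvdE)
    then have "x = f ^ n * u * f" by (simp add: mult_ac)
    moreover have "(f ^ n * u) \<otimes>\<^bsub>poly_A\<^esub> f \<in> ideal_prod poly_A {g. f ^ n dvd g} {g. f dvd g}"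
      by (rule ideal_prod.prod) simp_all
    ultimately show "x \<in> ideal_prod poly_A {g. f ^ n dvd g} {g. f dvd g}" by simp
  qed
  moreover have "{g. f dvd g} [^]\<^bsub>ideals_set poly_A\<^esub> Suc n =
      ideal_prod poly_A ({g. f dvd g} [^]\<^bsub>ideals_set poly_A\<^esub> n) {g. f dvd g}"
    by (simp add: nat_pow_def ideals_set_def)
  ultimately show ?case by (simp add: Suc)
qed

lemma ideal_valuation_eq_0:
  assumes "\<not> D \<subseteq> {g. f dvd g}"
  shows "ideal_valuation {g. f dvd g} D = 0"
proof -
  have "{n. D \<subseteq> {g. f ^ n dvd g}} = {0}"
  proof (intro equalityI subsetI)
    fix n assume n: "n \<in> {n. D \<subseteq> {g. f ^ n dvd g}}"
    show "n \<in> {0}"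
    proof (cases n)
      case (Suc m)
      then have "f dvd f ^ n" by simp
      then have "D \<subseteq> {g. f dvd g}" using n by (auto intro: dvd_trans)
      then show ?thesis using assms by blast
    qed simp
  qed (auto simp only: mem_Collect_eq power_0 one_dvd singleton_iff)
  then show ?thesis unfolding ideal_valuation_def ideal_power_poly_A by (simp add: zero_enat_def)
qed

text \<open>
  Both valuation lemmas avoid a generator of \<open>D\<close>: for the values \<open>0\<close> and \<open>1\<close> it is enough to know which of
  the first two powers of the prime contain \<open>D\<close>.
\<close>

lemma ideal_valuation_eq_1:
  assumes "D \<subseteq> {g. f dvd g}" "\<not> D \<subseteq> {g. f ^ 2 dvd g}"
  shows "ideal_valuation {g. f dvd g} D = 1"
proof -
  have "{n. D \<subseteq> {g. f ^ n dvd g}} = {0, 1}"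
  proof (intro equalityI subsetI)
    fix n assume n: "n \<in> {n. D \<subseteq> {g. f ^ n dvd g}}"
    have "\<not> 2 \<le> n"
    proof
      assume "2 \<le> n"
      then have "f ^ 2 dvd f ^ n" by (rule le_imp_power_dvd)
      then have "D \<subseteq> {g. f ^ 2 dvd g}" using n by (auto intro: dvd_trans)
      then show False using assms(2) by blast
    qed
    then show "n \<in> {0, 1}" by auto
  qed (use assms(1) in \<open>auto simp only: insert_iff empty_iff mem_Collect_eq power_0 power_one_right one_dvd\<close>)
  then show ?thesis
    unfolding ideal_valuation_def ideal_power_poly_A
    by (simp add: zero_enat_def one_enat_def sup_enat_def)
qed

lemma (in carlitz_period) mem_denominator_ideal_iff:
  assumes g: "g * e = fps_X" and j: "0 < j" "(CARD('a) - 1) dvd j"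
  shows "a \<in> denominator_ideal \<kappa> \<xi> j \<longleftrightarrow>
    of_A \<kappa> a * (of_A \<kappa> (factorial_T j) * fps_nth g j) \<in> range (of_A \<kappa>)"
proof
  let ?F = "factorial_T j :: 'a poly"
  let ?x = "fps_nth g j"
  have x: "\<kappa> (to_ac (carlitz_zeta j)) / \<xi> ^ j = ?x" using exponential_reciprocal_nth[OF g j] by simp
  have iff: "a \<in> denominator_ideal \<kappa> \<xi> j \<longleftrightarrow> (\<forall>b. ?F dvd b \<longrightarrow> of_A \<kappa> a * (of_A \<kappa> b * ?x) \<in> range (of_A \<kappa>))"
    by (auto simp: denominator_ideal_def bernoulli_carlitz_def factorial_ideal_eq x)
  show "of_A \<kappa> a * (of_A \<kappa> ?F * ?x) \<in> range (of_A \<kappa>)" if "a \<in> denominator_ideal \<kappa> \<xi> j"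
    using that iff by simp
  assume "of_A \<kappa> a * (of_A \<kappa> ?F * ?x) \<in> range (of_A \<kappa>)"
  then obtain u where u: "of_A \<kappa> a * (of_A \<kappa> ?F * ?x) = of_A \<kappa> u" by blast
  have "of_A \<kappa> a * (of_A \<kappa> (?F * v) * ?x) = of_A \<kappa> (u * v)" for v
    by (simp add: of_A_mult flip: u)
  then show "a \<in> denominator_ideal \<kappa> \<xi> j" unfolding iff by (auto elim!: dvdE)
qed

text \<open>
  In the notation of \<open>bernoulli_carlitz_local\<close>, the denominator ideal contains \<open>f W\<close>, which rules out
  valuations above \<open>1\<close>. It contains an element prime to \<open>f\<close> exactly when \<open>f\<close> divides \<open>V\<close>.
\<close>

lemma (in carlitz_period) ideal_valuation_denominator_ideal:
  assumes f: "place f \<alpha>" and q: "2 < CARD('a)" and j: "0 < j" "(CARD('a) - 1) dvd j"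
  shows "ideal_valuation {g. f dvd g} (denominator_ideal \<kappa> \<xi> j) =
    (if residue \<alpha> (exp_power_coeff (CARD('a) ^ Polynomial.degree f - 1) j) = 0 then 0 else 1)"
proof -
  interpret place f \<alpha> by (rule f)
  interpret carlitz_exp_place "of_A \<kappa>" e f \<alpha> ..
  obtain g where g: "g * e = fps_X"
    by (rule fps_reciprocal_exists[OF exp.exp_nth_0 exp.exp_nth_1])
  define b where "b = of_A \<kappa> (factorial_T j) * fps_nth g j"
  have mem: "a \<in> denominator_ideal \<kappa> \<xi> j \<longleftrightarrow> of_A \<kappa> a * b \<in> range (of_A \<kappa>)" for a
    unfolding b_def by (rule mem_denominator_ideal_iff[OF g j])
  obtain W V where WV: "\<not> f dvd W" "of_A \<kappa> (f * W) * b = of_A \<kappa> V"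
    "f dvd V \<longleftrightarrow> f dvd exp_power_coeff (CARD('a) ^ h - 1) j"
    unfolding b_def by (rule bernoulli_carlitz_local[OF g q, of j])
  have f0: "f \<noteq> 0" using prime by auto
  show ?thesis
  proof (cases "f dvd V")
    case True
    then obtain v where v: "V = f * v" by (elim dvdE)
    then have "of_A \<kappa> W * b = of_A \<kappa> v"
      using WV(2) f0 by (simp add: of_A_mult mult.assoc A.hom_eq_0_iff)
    then have "W \<in> denominator_ideal \<kappa> \<xi> j" by (simp add: mem)
    then have "\<not> denominator_ideal \<kappa> \<xi> j \<subseteq> {g. f dvd g}" using WV(1) by blast
    then show ?thesis
      using True WV(3) by (simp add: ideal_valuation_eq_0 residue_eq_0_iff)
  next
    case False
    have "denominator_ideal \<kappa> \<xi> j \<subseteq> {g. f dvd g}"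
    proof
      fix a assume "a \<in> denominator_ideal \<kappa> \<xi> j"
      then obtain u where u: "of_A \<kappa> a * b = of_A \<kappa> u" by (auto simp: mem)
      have "of_A \<kappa> (V * a) = of_A \<kappa> (f * W) * (of_A \<kappa> a * b)"
        by (simp add: of_A_mult[of V] mult_ac flip: WV(2))
      also have "\<dots> = of_A \<kappa> (f * W * u)" by (simp only: u of_A_mult)
      finally have "V * a = f * W * u" by (simp only: A.hom_eq_iff)
      then have "f dvd V * a" by (simp add: mult.assoc)
      then show "a \<in> {g. f dvd g}" using False prime by (simp add: prime_elem_dvd_mult_iff)
    qed
    moreover have "f * W \<in> denominator_ideal \<kappa> \<xi> j" by (simp add: mem WV(2))
    moreover have "\<not> f ^ 2 dvd f * W" using WV(1) f0 by (simp add: power2_eq_square)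
    ultimately have "ideal_valuation {g. f dvd g} (denominator_ideal \<kappa> \<xi> j) = 1"
      by (intro ideal_valuation_eq_1) auto
    then show ?thesis using False WV(3) by (simp add: residue_eq_0_iff)
  qed
qed

theorem corollary6:
  fixes \<kappa> :: "'a::{finite,field} fls alg_closure \<Rightarrow> 'c::{field,complete_space}"
    and e :: "'c fps"
    and \<xi> :: 'c
    and P :: "'a poly set"
    and \<sigma> :: "(nat \<Rightarrow> nat) \<Rightarrow> (nat \<Rightarrow> nat)"
    and p n h j :: nat
  assumes "Factorial_Ring.prime p" and "CARD('a) = p ^ n" and "CARD('a) > 2"
    and "C_infinity \<kappa>"
    and "carlitz_exponential \<kappa> e" and "period_lattice_generator \<kappa> e \<xi>"
    and "primeideal P poly_A" and "P \<noteq> {0}" and "ideal_degree P = h"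
    and "j > 0" and "(CARD('a) - 1) dvd j"
    and "\<sigma> \<in> digit_perm_group p (n * h)"
  shows "ideal_valuation P (denominator_ideal \<kappa> \<xi> j) =
         ideal_valuation P (denominator_ideal \<kappa> \<xi> (nat_action p \<sigma> j))"
proof -
  interpret carlitz_period \<kappa> e \<xi>
    using assms(4-6) by (simp add: carlitz_period_def carlitz_period_axioms_def)
  obtain f where f: "prime_elem f" "P = {g. f dvd g}"
    using assms(7,8) by (rule primeideal_generator)
  obtain \<alpha> where \<alpha>: "place f \<alpha>" using f(1) by (rule place_exists)
  interpret place f \<alpha> by (rule \<alpha>)
  have "P = PIdl\<^bsub>poly_A\<^esub> f" using f(2) by (auto simp: mem_PIdl_poly_A)
  then have h: "h = Polynomial.degree f" using assms(9) by (simp add: ideal_degree_PIdl)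
  have p: "1 < p" using assms(1) by (rule prime_gt_1_nat)
  have "n \<noteq> 0" using assms(2,3) by (intro notI) simp
  then have m: "0 < n * h" using degree_pos by (simp add: h)
  have Q: "p ^ (n * h) = CARD('a) ^ h" by (simp add: assms(2) power_mult)
  have Q1: "1 < CARD('a) ^ h" using assms(3) degree_pos by (intro one_less_power) (auto simp: h)
  obtain \<rho> where \<rho>: "\<sigma> = digit_perm p (n * h) \<rho>" "bij \<rho>"
    using assms(12) by (auto simp: digit_perm_group_def)
  define j' where "j' = nat_action p \<sigma> j"
  have j': "j' = (\<Sum>i\<le>j. (j div (CARD('a) ^ h) ^ i mod CARD('a) ^ h) * (CARD('a) ^ h) ^ \<rho> i)"
    unfolding j'_def \<rho>(1) nat_action_eq[OF p m \<rho>(2)] Q ..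
  have perm: "digits_permuted (CARD('a) ^ h) \<rho> j j'"
    unfolding j' by (rule digits_permuted_sum[OF \<rho>(2) Q1])
  have "0 < j'" using digits_permuted_eq_0_iff[OF Q1 \<rho>(2) perm] assms(10) by simp
  moreover have "(CARD('a) - 1) dvd j'"
    unfolding j' using assms(3,11) degree_pos by (intro sum_permuted_digits_dvd) (auto simp: h)
  ultimately show ?thesis
    using residue_exp_power_coeff_permuted[OF \<rho>(2) perm[unfolded h]] assms(3,10,11)
    by (simp add: f(2) ideal_valuation_denominator_ideal[OF \<alpha>] flip: j'_def)
qed

end
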